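(* Let $E\subset X$ be a Borel set of finite perimeter in $(X,\gamma)$ and, for $t>0$, let $$h_t:=\frac{|T_t^*D_\gamma\chi_E|}{T_t^*|D_\gamma\chi_E|}$$ be the density (Radon-Nikodym derivative) of the total variation measure $|T_t^*D_\gamma\chi_E|$ with respect to $T_t^*|D_\gamma\chi_E|$. Then $$\lim_{t\downarrow0}T_th_t=1\qquad\text{in }L^1(X,|D_\gamma\chi_E|).$$
   Context: Standing setting: $(X,\|\cdot\|)$ is a separable (real) Banach space and $\gamma$ is a Gaussian probability measure on the Borel $\sigma$-algebra of $X$, nondegenerate (all closed proper subspaces of $X$ are $\gamma$-negligible) and centered ($\int_X x\,d\gamma=0$). Cameron-Martin space: $H=\{\int_X f(x)x\,d\gamma(x): f\in L^2(X,\gamma)\}$. For $h\in H$, $\hat h\in L^2(X,\gamma)$ denotes the corresponding element, i.e. the unique element $f$ of the $L^2(X,\gamma)$-closure of $X^*$ with $h=\int_X f(x)x\,d\gamma(x)$; $H$ carries the Hilbert norm $|h|_H=\|\hat h\|_{L^2(X,\gamma)}$. $C^1_b(X)$ is the space of continuously differentiable cylindrical functions on $X$ that are bounded with bounded gradient; $\partial_h$ is the directional derivative along $h$. A bounded Borel function $u:X\to\mathbb{R}$ belongs to $BV(X,\gamma)$ if there exists a (unique) $H$-valued Borel measure $D_\gamma u$ with finite total variation in $X$ such that for all $\phi\in C^1_b(X)$ and $h\in H$ $$\int_X u\,\partial_h\phi\,d\gamma=-\int_X\phi\,d\langle D_\gamma u,h\rangle_H+\int_X u\,\phi\,\hat h\,d\gamma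 .$$ $|D_\gamma u|$ is the total variation measure of $D_\gamma u$. A Borel set $E$ has finite perimeter in $(X,\gamma)$ if its characteristic function $\chi_E$ is in $BV(X,\gamma)$. Ornstein-Uhlenbeck semigroup: for $f$ bounded Borel and $t>0$, $T_tf(x)=\int_X f(e^{-t}x+\sqrt{1-e^{-2t}}\,y)\,d\gamma(y)$, defined at every $x\in X$. The dual semigroup $T_t^*$ maps signed measures to signed measures by $\langle T_t^*\mu,\phi\rangle=\int_X T_t\phi\,d\mu$ for all bounded Borel $\phi$; on $H$-valued measures it acts componentwise. One has $|T_t^*D_\gamma\chi_E|\le T_t^*|D_\gamma\chi_E|$, so $h_t$ may be taken Borel with $0\le h_t\le1$; it is determined up to $T_t^*|D_\gamma\chi_E|$-negligible sets, so that $T_th_t$ is determined $|D_\gamma\chi_E|$-a.e. *)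

theory Defs
  imports "HOL-Probability.Probability"
begin

text \<open>Separable Banach spaces are the types of class \<open>{banach, second_countable_topology}\<close>,
  and the topological dual is \<open>'a \<Rightarrow>\<^sub>L real\<close>.\<close>

text \<open>The first alternative is the degenerate normal law; it always occurs for \<open>l = 0\<close>.\<close>

definition gaussian_measure :: "'a::{banach, second_countable_topology} measure \<Rightarrow> bool" where
  "gaussian_measure \<gamma> \<longleftrightarrow> prob_space \<gamma> \<and> sets \<gamma> = sets borel \<and>
     (\<forall>l :: 'a \<Rightarrow>\<^sub>L real.
        (\<exists>m. distr \<gamma> borel (blinfun_apply l) = return borel m) \<or>
        (\<exists>m \<sigma>. \<sigma> > 0 \<and>
           distr \<gamma> borel (blinfun_apply l) = density lborel (\<lambda>x. ennreal (normal_density m \<sigma> x))))"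

definition nondegenerate :: "'a::{banach, second_countable_topology} measure \<Rightarrow> bool" where
  "nondegenerate \<gamma> \<longleftrightarrow> (\<forall>V. subspace V \<and> closed V \<and> V \<noteq> UNIV \<longrightarrow> V \<in> null_sets \<gamma>)"

definition centered :: "'a::{banach, second_countable_topology} measure \<Rightarrow> bool" where
  "centered \<gamma> \<longleftrightarrow> has_bochner_integral \<gamma> (\<lambda>x. x) 0"

definition L2_space :: "'a measure \<Rightarrow> ('a \<Rightarrow> real) set" where
  "L2_space \<gamma> = {f \<in> borel_measurable \<gamma>. integrable \<gamma> (\<lambda>x. (f x)\<^sup>2)}"

definition L2_nrm :: "'a measure \<Rightarrow> ('a \<Rightarrow> real) \<Rightarrow> real" where
  "L2_nrm \<gamma> f = sqrt (\<integral>x. (f x)\<^sup>2 \<partial>\<gamma>)"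

definition CM_space :: "'a::{banach, second_countable_topology} measure \<Rightarrow> 'a set" where
  "CM_space \<gamma> = {(\<integral>x. f x *\<^sub>R x \<partial>\<gamma>) | f. f \<in> L2_space \<gamma>}"

definition dual_closure :: "'a::{banach, second_countable_topology} measure \<Rightarrow> ('a \<Rightarrow> real) set" where
  "dual_closure \<gamma> = {f \<in> L2_space \<gamma>.
     \<forall>\<epsilon>>0. \<exists>l :: 'a \<Rightarrow>\<^sub>L real. L2_nrm \<gamma> (\<lambda>x. f x - blinfun_apply l x) < \<epsilon>}"

text \<open>A representative of the \<open>L\<^sup>2\<close>-class of \<open>h\<close>-hat; it is unique up to \<open>\<gamma>\<close>-null sets.\<close>

definition CM_hat :: "'a::{banach, second_countable_topology} measure \<Rightarrow> 'a \<Rightarrow> 'a \<Rightarrow> real" where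
  "CM_hat \<gamma> h = (SOME f. f \<in> dual_closure \<gamma> \<and> h = (\<integral>x. f x *\<^sub>R x \<partial>\<gamma>))"

definition CM_norm :: "'a::{banach, second_countable_topology} measure \<Rightarrow> 'a \<Rightarrow> real" where
  "CM_norm \<gamma> h = L2_nrm \<gamma> (CM_hat \<gamma> h)"

definition CM_inner :: "'a::{banach, second_countable_topology} measure \<Rightarrow> 'a \<Rightarrow> 'a \<Rightarrow> real" where
  "CM_inner \<gamma> h k = (\<integral>x. CM_hat \<gamma> h x * CM_hat \<gamma> k x \<partial>\<gamma>)"

text \<open>Both are set functions, set to \<open>0\<close> outside the Borel sets so that they are
  determined by their values on Borel sets.\<close>

definition signed_measure :: "('a::topological_space set \<Rightarrow> real) \<Rightarrow> bool" where
  "signed_measure \<mu> \<longleftrightarrow> (\<forall>A. A \<notin> sets borel \<longrightarrow> \<mu> A = 0) \<and>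
     (\<forall>A :: nat \<Rightarrow> 'a set. range A \<subseteq> sets borel \<and> disjoint_family A \<longrightarrow>
        (\<lambda>n. \<mu> (A n)) sums \<mu> (\<Union>n. A n))"

definition jordan_pos :: "('a::topological_space set \<Rightarrow> real) \<Rightarrow> 'a measure" where
  "jordan_pos \<mu> = measure_of UNIV (sets borel)
     (\<lambda>A. SUP B\<in>{B \<in> sets borel. B \<subseteq> A}. ennreal (\<mu> B))"

definition signed_integral :: "('a::topological_space set \<Rightarrow> real) \<Rightarrow> ('a \<Rightarrow> real) \<Rightarrow> real" where
  "signed_integral \<mu> \<phi> =
     (\<integral>x. \<phi> x \<partial>jordan_pos \<mu>) - (\<integral>x. \<phi> x \<partial>jordan_pos (\<lambda>A. - \<mu> A))"

text \<open>Countable additivity is with respect to the Cameron-Martin norm.\<close>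

definition CM_valued_measure ::
  "'a::{banach, second_countable_topology} measure \<Rightarrow> ('a set \<Rightarrow> 'a) \<Rightarrow> bool" where
  "CM_valued_measure \<gamma> \<nu> \<longleftrightarrow> (\<forall>A. \<nu> A \<in> CM_space \<gamma>) \<and> (\<forall>A. A \<notin> sets borel \<longrightarrow> \<nu> A = 0) \<and>
     (\<forall>A :: nat \<Rightarrow> 'a set. range A \<subseteq> sets borel \<and> disjoint_family A \<longrightarrow>
        (\<lambda>n. CM_norm \<gamma> (\<nu> (\<Union>i. A i) - (\<Sum>i<n. \<nu> (A i)))) \<longlonglongrightarrow> 0)"

definition total_variation ::
  "'a::{banach, second_countable_topology} measure \<Rightarrow> ('a set \<Rightarrow> 'a) \<Rightarrow> 'a measure" where
  "total_variation \<gamma> \<nu> = measure_of UNIV (sets borel)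
     (\<lambda>A. SUP P\<in>{P :: nat \<Rightarrow> 'a set. range P \<subseteq> sets borel \<and> disjoint_family P \<and> (\<Union>i. P i) = A}.
        \<Sum>i. ennreal (CM_norm \<gamma> (\<nu> (P i))))"

text \<open>Cylindrical functions \<open>\<phi> x = v (l\<^sub>1 x, \<dots>, l\<^sub>n x)\<close>; tuples of arbitrary length are lists.\<close>

definition cylindrical :: "('a::{banach, second_countable_topology} \<Rightarrow> real) \<Rightarrow> bool" where
  "cylindrical \<phi> \<longleftrightarrow>
     (\<exists>(ls :: ('a \<Rightarrow>\<^sub>L real) list) (v :: real list \<Rightarrow> real). \<forall>x. \<phi> x = v (map (\<lambda>l. blinfun_apply l x) ls))"

definition C1b :: "('a::{banach, second_countable_topology} \<Rightarrow> real) set" where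
  "C1b = {\<phi>. cylindrical \<phi> \<and> bounded (range \<phi>) \<and>
     (\<exists>G :: 'a \<Rightarrow> 'a \<Rightarrow>\<^sub>L real. (\<forall>x. (\<phi> has_derivative blinfun_apply (G x)) (at x)) \<and>
        continuous_on UNIV G \<and> bounded (range G))}"

definition dir_deriv :: "'a::real_normed_vector \<Rightarrow> ('a \<Rightarrow> real) \<Rightarrow> 'a \<Rightarrow> real" where
  "dir_deriv h \<phi> x = deriv (\<lambda>s. \<phi> (x + s *\<^sub>R h)) 0"

definition is_BV_gradient :: "'a::{banach, second_countable_topology} measure \<Rightarrow>
    ('a \<Rightarrow> real) \<Rightarrow> ('a set \<Rightarrow> 'a) \<Rightarrow> bool" where
  "is_BV_gradient \<gamma> u \<nu> \<longleftrightarrow>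
     CM_valued_measure \<gamma> \<nu> \<and> emeasure (total_variation \<gamma> \<nu>) UNIV < \<infinity> \<and>
     (\<forall>\<phi>\<in>C1b. \<forall>h\<in>CM_space \<gamma>.
        (\<integral>x. u x * dir_deriv h \<phi> x \<partial>\<gamma>) =
          - signed_integral (\<lambda>A. CM_inner \<gamma> (\<nu> A) h) \<phi> + (\<integral>x. u x * \<phi> x * CM_hat \<gamma> h x \<partial>\<gamma>))"

definition BV :: "'a::{banach, second_countable_topology} measure \<Rightarrow> ('a \<Rightarrow> real) set" where
  "BV \<gamma> = {u \<in> borel_measurable borel. bounded (range u) \<and> (\<exists>\<nu>. is_BV_gradient \<gamma> u \<nu>)}"

text \<open>For \<open>u \<in> BV \<gamma>\<close> the gradient is unique, so the choice is immaterial.\<close>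

definition BV_gradient :: "'a::{banach, second_countable_topology} measure \<Rightarrow>
    ('a \<Rightarrow> real) \<Rightarrow> 'a set \<Rightarrow> 'a" where
  "BV_gradient \<gamma> u = (SOME \<nu>. is_BV_gradient \<gamma> u \<nu>)"

definition finite_perimeter :: "'a::{banach, second_countable_topology} measure \<Rightarrow> 'a set \<Rightarrow> bool" where
  "finite_perimeter \<gamma> E \<longleftrightarrow> E \<in> sets borel \<and> indicat_real E \<in> BV \<gamma>"

definition OU :: "'a::{banach, second_countable_topology} measure \<Rightarrow> real \<Rightarrow>
    ('a \<Rightarrow> real) \<Rightarrow> 'a \<Rightarrow> real" where
  "OU \<gamma> t f x = (\<integral>y. f (exp (- t) *\<^sub>R x + sqrt (1 - exp (- 2 * t)) *\<^sub>R y) \<partial>\<gamma>)"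

text \<open>The signed measure below is unique (test with indicator functions).\<close>

definition OU_dual :: "'a::{banach, second_countable_topology} measure \<Rightarrow> real \<Rightarrow>
    ('a set \<Rightarrow> real) \<Rightarrow> 'a set \<Rightarrow> real" where
  "OU_dual \<gamma> t \<mu> = (SOME \<rho>. signed_measure \<rho> \<and>
     (\<forall>\<phi>\<in>borel_measurable borel. bounded (range \<phi>) \<longrightarrow>
        signed_integral \<rho> \<phi> = signed_integral \<mu> (OU \<gamma> t \<phi>)))"

text \<open>A finite positive Borel measure \<open>M\<close> is the signed measure \<open>measure M\<close>; its image under
  the dual semigroup is again positive and is turned back into a measure.\<close>

definition OU_dual_pos :: "'a::{banach, second_countable_topology} measure \<Rightarrow> real \<Rightarrow>
    'a measure \<Rightarrow> 'a measure" where
  "OU_dual_pos \<gamma> t M =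
     measure_of UNIV (sets borel) (\<lambda>A. ennreal (OU_dual \<gamma> t (measure M) A))"

text \<open>Componentwise action: the component of the image along \<open>h\<close> is the image of the
  component along \<open>h\<close>, for every \<open>h\<close> in the Cameron-Martin space.\<close>

definition OU_dual_CM :: "'a::{banach, second_countable_topology} measure \<Rightarrow> real \<Rightarrow>
    ('a set \<Rightarrow> 'a) \<Rightarrow> 'a set \<Rightarrow> 'a" where
  "OU_dual_CM \<gamma> t \<nu> A = (THE k. k \<in> CM_space \<gamma> \<and>
     (\<forall>h\<in>CM_space \<gamma>. CM_inner \<gamma> k h = OU_dual \<gamma> t (\<lambda>B. CM_inner \<gamma> (\<nu> B) h) A))"

text \<open>Borel versions, with values in \<open>[0, 1]\<close>, of the Radon-Nikodym derivative of \<open>N\<close> with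
  respect to \<open>M\<close>.\<close>

definition unit_density :: "'a::topological_space measure \<Rightarrow> 'a measure \<Rightarrow> ('a \<Rightarrow> real) \<Rightarrow> bool" where
  "unit_density M N f \<longleftrightarrow> f \<in> borel_measurable borel \<and> (\<forall>x. 0 \<le> f x \<and> f x \<le> 1) \<and>
     density M (\<lambda>x. ennreal (f x)) = N"

definition tendsto_L1 :: "'a measure \<Rightarrow> ('b \<Rightarrow> 'a \<Rightarrow> real) \<Rightarrow> ('a \<Rightarrow> real) \<Rightarrow> 'b filter \<Rightarrow> bool" where
  "tendsto_L1 M f g F \<longleftrightarrow> (\<forall>\<^sub>F t in F. integrable M (f t)) \<and> integrable M g \<and>
     ((\<lambda>t. \<integral>x. \<bar>f t x - g x\<bar> \<partial>M) \<longlongrightarrow> 0) F"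

end

theory Submission
  imports Defs
begin

text \<open>
  Write \<open>\<nu>\<close> for the gradient of the characteristic function of \<open>E\<close>, \<open>M = |\<nu>|\<close> for its total variation
  and \<open>T\<^sub>t\<close> for the Ornstein-Uhlenbeck semigroup. Since \<open>0 \<le> h\<^sub>t \<le> 1\<close>, also \<open>0 \<le> T\<^sub>t h\<^sub>t \<le> 1\<close>, and duality gives
  \<open>\<integral> |T\<^sub>t h\<^sub>t - 1| dM = M(X) - \<integral> h\<^sub>t d(T\<^sub>t\<^sup>* M) = |\<nu>|(X) - |T\<^sub>t\<^sup>* \<nu>|(X)\<close>. So the claim says that the total mass
  of \<open>|T\<^sub>t\<^sup>* \<nu>|\<close> tends to that of \<open>|\<nu>|\<close>; one inequality is contained in \<open>h\<^sub>t \<le> 1\<close>, the other is lower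
  semicontinuity of the total variation (\<open>variation_lower_semicontinuous\<close>), and it holds for every
  Cameron-Martin valued measure \<open>\<nu>\<close> of finite variation.

  For the lower bound, almost all of the variation of \<open>\<nu>\<close> is carried by finitely many disjoint
  compact sets \<open>K\<^sub>i\<close>, on each of which it is seen by one functional \<open>l\<^sub>i\<close> of \<open>L\<^sup>2\<close> norm at most \<open>1\<close>: the sum
  of the numbers \<open>l\<^sub>i(\<nu>(K\<^sub>i))\<close> is close to \<open>M(X)\<close>. The \<open>K\<^sub>i\<close> have disjoint open neighbourhoods \<open>U\<^sub>i\<close>, and
  \<open>|T\<^sub>t\<^sup>* \<nu>|(X)\<close> is at least the sum of the \<open>l\<^sub>i(T\<^sub>t\<^sup>* \<nu>(U\<^sub>i)) = \<integral> T\<^sub>t \<chi>\<^bsub>U\<^sub>i\<^esub> g\<^sub>i dM\<close>, where \<open>g\<^sub>i\<close> is the density of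
  \<open>l\<^sub>i \<circ> \<nu>\<close> with respect to \<open>M\<close>. On \<open>K\<^sub>i\<close> the function \<open>T\<^sub>t \<chi>\<^bsub>U\<^sub>i\<^esub>\<close> tends to \<open>1\<close> because \<open>U\<^sub>i\<close> is open; all
  these functions are nonnegative with sum at most \<open>1\<close>, so the remaining contributions are small.

  Before that, the objects in the statement have to be identified. The total variation is a measure
  because the norm of \<open>\<nu>\<close> is countably subadditive (\<open>emeasure_total_variation\<close>). The dual semigroup on
  signed measures is integration against \<open>T\<^sub>t \<chi>\<^sub>A\<close> (\<open>OU_dual_eq\<close>), since a signed measure is recovered from its
  Jordan parts (\<open>jordan_decomposition\<close>). On \<open>H\<close>-valued measures it exists by a Riesz representation theorem for the
  Cameron-Martin space (\<open>CM_riesz\<close>), the minimisation being carried out over \<open>X\<^sup>*\<close> directly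
  (\<open>dual_riesz\<close>). That \<open>h\<close> and its representative in the closure of \<open>X\<^sup>*\<close> determine each other rests on two
  further facts: functionals separate the points of \<open>X\<close> (\<open>functionals_separate\<close>), and the norm of \<open>X\<close> is
  square integrable (\<open>gaussian_norm_square_integrable\<close>), so that \<open>\<integral> f(x) x d\<gamma>\<close> exists for every \<open>f\<close> in
  \<open>L\<^sup>2\<close>. The latter is Fernique's argument, which uses that \<open>\<gamma> \<otimes> \<gamma>\<close> is invariant under
  \<open>(x, y) \<mapsto> ((x + y) / \<surd>2, (x - y) / \<surd>2)\<close>; this in turn is read off from the characteristic functional (\<open>char_functional_unique\<close>).
\<close>

section \<open>Norming functionals\<close>

definition sublinear :: "('a::real_vector \<Rightarrow> real) \<Rightarrow> bool" where
  "sublinear q \<longleftrightarrow> (\<forall>x y. q (x + y) \<le> q x + q y) \<and> (\<forall>a>0. \<forall>x. q (a *\<^sub>R x) = a * q x)"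

text \<open>For sublinear \<open>q\<close> the shift is again sublinear and lies below \<open>q\<close>. Its value at \<open>- y\<close> is \<open>- q y\<close>, the least that a
  sublinear functional below \<open>q\<close> can take there: the shift makes \<open>q\<close> linear in direction \<open>y\<close>.\<close>

definition sublinear_shift :: "('a::real_vector \<Rightarrow> real) \<Rightarrow> 'a \<Rightarrow> 'a \<Rightarrow> real" where
  "sublinear_shift q y x = (INF s\<in>{0..}. q (x + s *\<^sub>R y) - s * q y)"

lemma sublinear_zero:
  assumes "sublinear q"
  shows "q 0 = 0"
proof -
  have "\<forall>a>0. \<forall>x. q (a *\<^sub>R x) = a * q x" using assms unfolding sublinear_def by blast
  then have "q ((2::real) *\<^sub>R 0) = 2 * q 0" by (metis zero_less_numeral)
  then show ?thesis by simp
qed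

lemma sublinear_neg:
  assumes "sublinear q"
  shows "- q (- x) \<le> q x"
proof -
  have "q (x + (- x)) \<le> q x + q (- x)" using assms unfolding sublinear_def by blast
  then show ?thesis using sublinear_zero[OF assms] by simp
qed

lemma sublinear_scale:
  assumes "sublinear q" "0 \<le> a"
  shows "q (a *\<^sub>R x) = a * q x"
proof (cases "a = 0")
  case True then show ?thesis using sublinear_zero[OF assms(1)] by simp
next
  case False then show ?thesis using assms unfolding sublinear_def by simp
qed

lemma sublinear_shift_bdd:
  assumes "sublinear q"
  shows "bdd_below ((\<lambda>s. q (x + s *\<^sub>R y) - s * q y) ` {0..})"
proof (rule bdd_belowI2)
  fix s :: real assume s: "s \<in> {0..}"
  have "s * q y = q ((x + s *\<^sub>R y) + (- x))"
    using sublinear_scale[OF assms, of s y] s by simp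
  also have "\<dots> \<le> q (x + s *\<^sub>R y) + q (- x)" using assms unfolding sublinear_def by blast
  finally show "- q (- x) \<le> q (x + s *\<^sub>R y) - s * q y" by simp
qed

lemma sublinear_shift_le:
  assumes "sublinear q" "0 \<le> s"
  shows "sublinear_shift q y x \<le> q (x + s *\<^sub>R y) - s * q y"
  unfolding sublinear_shift_def by (rule cINF_lower[OF sublinear_shift_bdd]) (use assms in auto)

lemma sublinear_shift_geI:
  assumes "\<And>s. 0 \<le> s \<Longrightarrow> c \<le> q (x + s *\<^sub>R y) - s * q y"
  shows "c \<le> sublinear_shift q y x"
  unfolding sublinear_shift_def by (rule cINF_greatest) (use assms in auto)

lemma sublinear_sublinear_shift:
  assumes q: "sublinear q"
  shows "sublinear (sublinear_shift q y)"
proof -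
  let ?p = "sublinear_shift q y"
  have add: "?p (u + v) \<le> ?p u + ?p v" for u v
  proof -
    have "?p (u + v) - ?p u \<le> ?p v"
    proof (rule sublinear_shift_geI)
      fix s' :: real assume s': "0 \<le> s'"
      have "?p (u + v) - (q (v + s' *\<^sub>R y) - s' * q y) \<le> ?p u"
      proof (rule sublinear_shift_geI)
        fix s :: real assume s: "0 \<le> s"
        have "?p (u + v) \<le> q ((u + v) + (s + s') *\<^sub>R y) - (s + s') * q y"
          by (rule sublinear_shift_le[OF q]) (use s s' in auto)
        also have "(u + v) + (s + s') *\<^sub>R y = (u + s *\<^sub>R y) + (v + s' *\<^sub>R y)"
          by (simp add: algebra_simps)
        also have "q \<dots> \<le> q (u + s *\<^sub>R y) + q (v + s' *\<^sub>R y)" using q unfolding sublinear_def by blast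
        finally show "?p (u + v) - (q (v + s' *\<^sub>R y) - s' * q y) \<le> q (u + s *\<^sub>R y) - s * q y"
          by (simp add: algebra_simps)
      qed
      then show "?p (u + v) - ?p u \<le> q (v + s' *\<^sub>R y) - s' * q y" by simp
    qed
    then show ?thesis by simp
  qed
  have le: "?p (a *\<^sub>R u) \<le> a * ?p u" if a: "0 < a" for a u
  proof -
    have "?p (a *\<^sub>R u) / a \<le> ?p u"
    proof (rule sublinear_shift_geI)
      fix s :: real assume s: "0 \<le> s"
      have "?p (a *\<^sub>R u) \<le> q (a *\<^sub>R u + (a * s) *\<^sub>R y) - (a * s) * q y"
        by (rule sublinear_shift_le[OF q]) (use s a in auto)
      also have "a *\<^sub>R u + (a * s) *\<^sub>R y = a *\<^sub>R (u + s *\<^sub>R y)" by (simp add: algebra_simps)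
      also have "q \<dots> = a * q (u + s *\<^sub>R y)" using sublinear_scale[OF q] a by simp
      finally show "?p (a *\<^sub>R u) / a \<le> q (u + s *\<^sub>R y) - s * q y"
        using a by (simp add: field_simps)
    qed
    then show ?thesis using a by (simp add: field_simps)
  qed
  have "?p (a *\<^sub>R u) = a * ?p u" if a: "0 < a" for a u
  proof (rule antisym)
    show "?p (a *\<^sub>R u) \<le> a * ?p u" by (rule le[OF a])
    have "?p u \<le> (1 / a) * ?p (a *\<^sub>R u)" using le[of "1 / a" "a *\<^sub>R u"] a by simp
    then show "a * ?p u \<le> ?p (a *\<^sub>R u)" using a by (simp add: field_simps)
  qed
  with add show ?thesis unfolding sublinear_def by blast
qed

text \<open>A minimal \<open>q\<close> is fixed by every shift; comparing with the shift by \<open>y\<close> at parameter \<open>1\<close> gives the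
  inequality \<open>q x + q y \<le> q (x + y)\<close> that turns subadditivity into additivity.\<close>

lemma minimal_sublinear_linear:
  fixes q :: "'a::real_vector \<Rightarrow> real"
  assumes q: "sublinear q"
    and min: "\<And>p. sublinear p \<Longrightarrow> (\<And>x. p x \<le> q x) \<Longrightarrow> p = q"
  shows "linear q"
proof -
  have shift: "sublinear_shift q y = q" for y
    by (rule min[OF sublinear_sublinear_shift[OF q]]) (use sublinear_shift_le[OF q, of 0] in auto)
  have ge: "q x + q y \<le> q (x + y)" for x y
    using sublinear_shift_le[OF q, of 1 y x] unfolding shift by simp
  have add: "q (x + y) = q x + q y" for x y
    using ge[of x y] q unfolding sublinear_def by (meson antisym)
  have neg: "q (- x) = - q x" for x
    using add[of x "- x"] sublinear_zero[OF q] by simp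
  have "q (a *\<^sub>R x) = a * q x" for a x
  proof (cases "0 \<le> a")
    case False
    then have "q ((- a) *\<^sub>R x) = (- a) * q x" using sublinear_scale[OF q, of "- a" x] by simp
    then show ?thesis using neg[of "a *\<^sub>R x"] by simp
  qed (rule sublinear_scale[OF q])
  with add show ?thesis by (intro linearI) auto
qed

text \<open>Zorn's lemma gives a minimal sublinear functional below the norm whose value at \<open>- x0\<close> is already the
  least possible; the shifted norm provides the starting point. Minimal sublinear functionals are
  linear, so no extension from subspaces is involved.\<close>

lemma norming_functional_exists:
  fixes x0 :: "'a::real_normed_vector"
  shows "\<exists>l :: 'a \<Rightarrow>\<^sub>L real. norm l \<le> 1 \<and> blinfun_apply l x0 = norm x0"
proof -
  define A where "A = {q :: 'a \<Rightarrow> real. sublinear q \<and> (\<forall>x. q x \<le> norm x) \<and> q (- x0) \<le> - norm x0}"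
  define P where "P = (\<lambda>q q' :: 'a \<Rightarrow> real. \<forall>x. q' x \<le> q x)"
  have norm_sub: "sublinear (norm :: 'a \<Rightarrow> real)"
    unfolding sublinear_def by (auto intro: norm_triangle_ineq)
  have start: "sublinear_shift norm x0 \<in> A"
    unfolding A_def using sublinear_sublinear_shift[OF norm_sub]
      sublinear_shift_le[OF norm_sub, of 0 x0] sublinear_shift_le[OF norm_sub, of 1 x0 "- x0"] by auto
  have lower: "- norm x \<le> q x" if "q \<in> A" for q x
  proof -
    have "q (- x) \<le> norm (- x)" using that unfolding A_def by blast
    then show ?thesis using sublinear_neg[of q x] that unfolding A_def by simp
  qed
  have "\<exists>m\<in>A. \<forall>a\<in>A. P m a \<longrightarrow> a = m"
  proof (rule predicate_Zorn)
    show "partial_order_on A (relation_of P A)"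
      unfolding P_def by (rule partial_order_on_relation_ofI) (auto intro: order_trans antisym intro!: ext)
    fix C assume "C \<in> Chains (relation_of P A)"
    then have CA: "C \<subseteq> A" and tot: "\<And>q q'. q \<in> C \<Longrightarrow> q' \<in> C \<Longrightarrow> P q q' \<or> P q' q"
      unfolding Chains_def relation_of_def by auto
    show "\<exists>u\<in>A. \<forall>a\<in>C. P a u"
    proof (cases "C = {}")
      case True then show ?thesis using start by blast
    next
      case False
      define u where "u x = (INF q\<in>C. q x)" for x
      have bdd: "bdd_below ((\<lambda>q. q x) ` C)" for x
        by (rule bdd_belowI2[of _ "- norm x"]) (use lower CA in auto)
      have ule: "u x \<le> q x" if "q \<in> C" for q x
        unfolding u_def by (rule cINF_lower[OF bdd that])
      have uge: "c \<le> u x" if "\<And>q. q \<in> C \<Longrightarrow> c \<le> q x" for c x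
        unfolding u_def by (rule cINF_greatest[OF False that])
      have sub: "q \<in> C \<Longrightarrow> sublinear q" for q using CA unfolding A_def by auto
      have uadd: "u (x + y) \<le> u x + u y" for x y
      proof -
        have "u (x + y) - u x \<le> u y"
        proof (rule uge)
          fix q assume qC: "q \<in> C"
          have "u (x + y) - q y \<le> u x"
          proof (rule uge)
            fix q' assume q'C: "q' \<in> C"
            obtain r where r: "r \<in> C" "r x \<le> q' x" "r y \<le> q y"
              using tot[OF qC q'C] qC q'C unfolding P_def by blast
            have "u (x + y) \<le> r (x + y)" by (rule ule[OF r(1)])
            also have "\<dots> \<le> r x + r y" using sub[OF r(1)] unfolding sublinear_def by blast
            finally show "u (x + y) - q y \<le> q' x" using r by simp
          qed
          then show "u (x + y) - u x \<le> q y" by simp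
        qed
        then show ?thesis by simp
      qed
      have uhom: "u (a *\<^sub>R x) \<le> a * u x" if a: "0 < a" for a x
      proof -
        have "u (a *\<^sub>R x) / a \<le> u x"
        proof (rule uge)
          fix q assume qC: "q \<in> C"
          have "u (a *\<^sub>R x) \<le> a * q x"
            using ule[OF qC, of "a *\<^sub>R x"] sublinear_scale[OF sub[OF qC], of a x] a by simp
          then show "u (a *\<^sub>R x) / a \<le> q x" using a by (simp add: field_simps)
        qed
        then show ?thesis using a by (simp add: field_simps)
      qed
      have uhom': "u (a *\<^sub>R x) = a * u x" if a: "0 < a" for a x
      proof (rule antisym[OF uhom[OF a]])
        have "u x \<le> (1 / a) * u (a *\<^sub>R x)" using uhom[of "1 / a" "a *\<^sub>R x"] a by simp
        then show "a * u x \<le> u (a *\<^sub>R x)" using a by (simp add: field_simps)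
      qed
      obtain q0 where q0: "q0 \<in> C" using False by blast
      have "u \<in> A"
        unfolding A_def sublinear_def
      proof (intro CollectI conjI allI impI)
        show "u x \<le> norm x" for x
          using order_trans[OF ule[OF q0]] CA q0 unfolding A_def by blast
        show "u (- x0) \<le> - norm x0"
          using order_trans[OF ule[OF q0]] CA q0 unfolding A_def by blast
      qed (use uadd uhom' in auto)
      then show ?thesis using ule unfolding P_def by blast
    qed
  qed
  then obtain q where qA: "q \<in> A" and min: "\<And>a. a \<in> A \<Longrightarrow> P q a \<Longrightarrow> a = q" by blast
  have q: "sublinear q" "\<And>x. q x \<le> norm x" "q (- x0) \<le> - norm x0" using qA unfolding A_def by auto
  have lin: "linear q"
  proof (rule minimal_sublinear_linear[OF q(1)])
    fix p assume p: "sublinear p" "\<And>x. p x \<le> q x"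
    have "p \<in> A" unfolding A_def using p q by (auto intro: order_trans)
    then show "p = q" using min p unfolding P_def by blast
  qed
  have abs: "norm (q x) \<le> norm x * 1" for x
    using q(2)[of x] q(2)[of "- x"] linear_neg[OF lin, of x] by (simp add: abs_le_iff)
  have bl: "bounded_linear q"
    using lin abs by (metis bounded_linear.intro bounded_linear_axioms.intro)
  have "blinfun_apply (Blinfun q) x0 = norm x0"
    using bounded_linear_Blinfun_apply[OF bl] q(2)[of x0] q(3) linear_neg[OF lin, of x0] by simp
  moreover have "norm (Blinfun q) \<le> 1"
    by (rule norm_blinfun_bound) (use abs bounded_linear_Blinfun_apply[OF bl] in auto)
  ultimately show ?thesis by blast
qed

lemma functionals_separate:
  fixes x :: "'a::real_normed_vector"
  assumes "\<And>l :: 'a \<Rightarrow>\<^sub>L real. blinfun_apply l x = 0"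
  shows "x = 0"
  using norming_functional_exists[of x] assms by auto

text \<open>Functionals that norm the points of a countable dense set suffice, because every functional of norm at
  most \<open>1\<close> is Lipschitz with constant \<open>1\<close>. This describes the norm by countably many functionals, which is
  what measurability arguments need.\<close>

lemma norming_sequence_exists:
  "\<exists>l :: nat \<Rightarrow> 'a::{real_normed_vector, second_countable_topology} \<Rightarrow>\<^sub>L real.
     \<forall>x r. norm x \<le> r \<longleftrightarrow> (\<forall>n. blinfun_apply (l n) x \<le> r)"
proof -
  obtain D :: "'a set" where D: "countable D" "\<And>X. open X \<Longrightarrow> X \<noteq> {} \<Longrightarrow> \<exists>d\<in>D. d \<in> X"
    using countable_dense_exists by blast
  have "D \<noteq> {}" using D(2)[of UNIV] by auto
  define l where "l n = (SOME l :: 'a \<Rightarrow>\<^sub>L real. norm l \<le> 1 \<and>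
    blinfun_apply l (from_nat_into D n) = norm (from_nat_into D n))" for n
  have l: "norm (l n) \<le> 1" "blinfun_apply (l n) (from_nat_into D n) = norm (from_nat_into D n)" for n
    unfolding l_def using someI_ex[OF norming_functional_exists[of "from_nat_into D n"]] by auto
  have le: "blinfun_apply (l n) x \<le> norm x" for n x
    using norm_blinfun[of "l n" x] l(1)[of n] mult_right_mono[of "norm (l n)" 1 "norm x"] by auto
  have "norm x \<le> r" if r: "\<And>n. blinfun_apply (l n) x \<le> r" for x r
  proof (rule field_le_epsilon)
    fix e :: real assume "0 < e"
    then obtain d where d: "d \<in> D" "d \<in> ball x (e / 2)" using D(2)[of "ball x (e / 2)"] by auto
    then obtain n where n: "from_nat_into D n = d"
      using from_nat_into_surj[OF D(1)] by blast
    have "norm x \<le> norm d + norm (x - d)" using norm_triangle_ineq[of d "x - d"] by simp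
    also have "norm d = blinfun_apply (l n) x + blinfun_apply (l n) (d - x)"
      using l(2)[of n] n by (simp add: blinfun.diff_right)
    also have "\<dots> \<le> r + norm (d - x)" using r[of n] le[of n "d - x"] by simp
    finally show "norm x \<le> r + e" using d(2) by (simp add: dist_norm norm_minus_commute)
  qed
  then have "\<forall>x r. norm x \<le> r \<longleftrightarrow> (\<forall>n. blinfun_apply (l n) x \<le> r)"
    using order_trans[OF le] by blast
  then show ?thesis by blast
qed

section \<open>Measures on a separable Banach space and their characteristic functionals\<close>

text \<open>The uniqueness theorem for distributions on the line, transferred to finite measures by
  normalisation; the total mass is the value of the characteristic function at \<open>0\<close>.\<close>

lemma finite_measure_char_unique:
  fixes M N :: "real measure"
  assumes fin: "finite_measure M" "finite_measure N"
    and borel: "sets M = sets borel" "sets N = sets borel"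
    and char: "\<And>s. (CLINT x|M. iexp (s * x)) = (CLINT x|N. iexp (s * x))"
  shows "M = N"
proof -
  interpret M: finite_measure M by fact
  interpret N: finite_measure N by fact
  have sp: "space M = UNIV" "space N = UNIV"
    using borel sets_eq_imp_space_eq[of _ borel] by auto
  define m where "m = measure M UNIV"
  have mN: "measure N UNIV = m"
    using char[of 0] unfolding m_def by (simp add: sp)
  show ?thesis
  proof (cases "m = 0")
    case True
    have "emeasure M UNIV = 0" "emeasure N UNIV = 0"
      using True mN unfolding m_def by (simp_all add: M.emeasure_eq_measure N.emeasure_eq_measure)
    then have "emeasure M A = emeasure N A" for A
      using emeasure_mono[of A UNIV M] emeasure_mono[of A UNIV N] sets.top[of M] sets.top[of N] sp
      by (metis le_zero_eq top_greatest)
    then show ?thesis using borel by (intro measure_eqI) auto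
  next
    case False
    then have m: "m > 0" unfolding m_def by (simp add: zero_less_measure_iff)
    define c where "c = ennreal (1 / m)"
    have real_dist: "real_distribution (density L (\<lambda>_. c))"
      if "finite_measure L" "sets L = sets borel" "measure L UNIV = m" for L :: "real measure"
    proof -
      interpret L: finite_measure L by fact
      have spL: "space L = UNIV" using sets_eq_imp_space_eq[OF that(2)] by simp
      have "emeasure (density L (\<lambda>_. c)) (space (density L (\<lambda>_. c))) = c * emeasure L UNIV"
        using that(2) by (subst emeasure_density_const) (auto simp: spL)
      also have "\<dots> = 1" using m that(3)
        by (simp add: L.emeasure_eq_measure c_def flip: ennreal_mult)
      finally show ?thesis
        using that(2) by (auto simp: real_distribution_def real_distribution_axioms_def intro!: prob_spaceI)
    qed
    have char_d: "char (density L (\<lambda>_. c)) s = (1 / m) *\<^sub>R (CLINT x|L. iexp (s * x))"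
      if "sets L = sets borel" for L :: "real measure" and s
    proof -
      have [measurable_cong]: "sets L = sets borel" by fact
      show ?thesis unfolding char_def c_def
        using m by (subst integral_density) auto
    qed
    have "density M (\<lambda>_. c) = density N (\<lambda>_. c)"
      by (intro Levy_uniqueness real_dist fin borel mN ext) (simp_all only: m_def char_d borel char)
    then have "c * emeasure M A = c * emeasure N A" if "A \<in> sets borel" for A
      using that borel by (metis emeasure_density_const)
    moreover have "c \<noteq> 0" "c \<noteq> \<infinity>" using m unfolding c_def by auto
    ultimately show ?thesis using borel
      by (intro measure_eqI) (auto simp: ennreal_mult_cancel_left)
  qed
qed

text \<open>A nonnegative weight \<open>u\<close> turns \<open>M\<close> into the finite measure with density \<open>u\<close>; its image under \<open>l\<close> lives on
  the line, where characteristic functions determine measures.\<close>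

lemma weighted_char_unique:
  fixes M N :: "'a::{real_normed_vector, second_countable_topology} measure" and l :: "'a \<Rightarrow>\<^sub>L real"
  assumes fin: "finite_measure M" "finite_measure N"
    and borel: "sets M = sets borel" "sets N = sets borel"
    and u[measurable]: "u \<in> borel_measurable borel" and u_bd: "\<And>x. 0 \<le> u x" "\<And>x. u x \<le> c"
    and char: "\<And>s. (CLINT x|M. of_real (u x) * iexp (s * l x)) = (CLINT x|N. of_real (u x) * iexp (s * l x))"
    and A: "A \<in> sets borel"
  shows "(\<integral>x. u x * indicator A (l x) \<partial>M) = (\<integral>x. u x * indicator A (l x) \<partial>N)"
proof -
  define D where "D L = distr (density L (\<lambda>x. ennreal (u x))) borel (blinfun_apply l)" for L
  have [measurable]: "blinfun_apply l \<in> borel_measurable borel"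
    by (intro borel_measurable_continuous_onI continuous_intros)
  note [measurable] = A
  have D_int: "(CLINT y|D L. f y) = (CLINT x|L. of_real (u x) * f (l x))"
    if [measurable_cong]: "sets L = sets borel" and [measurable]: "f \<in> borel_measurable borel"
    for L and f :: "real \<Rightarrow> complex"
    unfolding D_def using u_bd
    by (subst integral_distr, measurable, subst integral_density) (auto simp: scaleR_conv_of_real)
  have D_ind: "measure (D L) A = (\<integral>x. u x * indicator A (l x) \<partial>L)"
    if L[measurable_cong]: "sets L = sets borel" for L
  proof -
    have "measure (D L) A = (\<integral>y. indicator A y \<partial>D L)" unfolding D_def by simp
    also have "\<dots> = (\<integral>x. u x * indicator A (l x) \<partial>L)" unfolding D_def using u_bd
      by (subst integral_distr, measurable, subst integral_density) auto
    finally show ?thesis .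
  qed
  have D_fin: "finite_measure (D L)" if "finite_measure L" and L[measurable_cong]: "sets L = sets borel" for L
  proof -
    interpret L: finite_measure L by fact
    have "integrable L u"
      by (rule L.integrable_const_bound[of _ c]) (use u_bd in auto)
    then have "(\<integral>\<^sup>+ x. ennreal (u x) \<partial>L) < \<infinity>"
      using u_bd by (simp add: nn_integral_eq_integral)
    moreover have "space L = UNIV" using sets_eq_imp_space_eq[OF L] by simp
    ultimately show ?thesis unfolding D_def
      by (intro finite_measureI) (auto simp: emeasure_distr emeasure_density)
  qed
  have "D M = D N"
    by (rule finite_measure_char_unique)
       (use char in \<open>auto simp: D_int borel fin intro!: D_fin, auto simp: D_def\<close>)
  then show ?thesis using D_ind borel by metis
qed

text \<open>Indicator functions of finite dimensional cylinders, as products, so that an induction can replace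
  one constraint \<open>l x \<in> A\<close> after the other.\<close>

definition cylinder_weight :: "(('a::real_normed_vector \<Rightarrow>\<^sub>L real) \<times> real set) list \<Rightarrow> 'a \<Rightarrow> real" where
  "cylinder_weight xs x = prod_list (map (\<lambda>(l, A). indicator A (blinfun_apply l x)) xs)"

lemma cylinder_weight_simps [simp]:
  "cylinder_weight [] x = 1"
  "cylinder_weight ((l, A) # xs) x = indicator A (blinfun_apply l x) * cylinder_weight xs x"
  by (simp_all add: cylinder_weight_def)

lemma cylinder_weight_eq:
  "cylinder_weight xs = indicator {x. \<forall>(l, A)\<in>set xs. blinfun_apply l x \<in> A}"
proof (induction xs)
  case (Cons p xs)
  then show ?case by (cases p) (simp add: fun_eq_iff indicator_def split_beta)
qed (simp add: fun_eq_iff)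

lemma measurable_blinfun [measurable]:
  "blinfun_apply (l :: 'a::real_normed_vector \<Rightarrow>\<^sub>L 'b::real_normed_vector) \<in> borel_measurable borel"
  by (intro borel_measurable_continuous_onI continuous_intros)

lemma measurable_cylinder_weight:
  "(\<And>l A. (l, A) \<in> set xs \<Longrightarrow> A \<in> sets borel) \<Longrightarrow> cylinder_weight xs \<in> borel_measurable borel"
proof (induction xs)
  case Nil
  then show ?case by simp
next
  case (Cons p xs)
  obtain l A where p: "p = (l, A)" by force
  have [measurable]: "cylinder_weight xs \<in> borel_measurable borel" "A \<in> sets borel"
    using Cons p by auto
  have "(\<lambda>x. indicator A (blinfun_apply l x) * cylinder_weight xs x) \<in> borel_measurable borel" by measurable
  then show ?case unfolding p by (simp cong: measurable_cong)
qed

text \<open>Knowing all \<open>\<integral> w e\<^bsup>il\<^esup>\<close> for a weight \<open>w\<close> determines \<open>\<integral> w \<chi>\<^sub>A(l\<^sub>0) e\<^bsup>il\<^esup>\<close>. The one dimensional uniqueness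
  theorem needs nonnegative weights, so it is applied to \<open>w\<close>, \<open>w (1 + cos l)\<close> and \<open>w (1 + sin l)\<close>, from
  which the complex weight \<open>w e\<^bsup>il\<^esup>\<close> is recovered.\<close>

lemma cylinder_weight_char_eq:
  fixes M N :: "'a::{real_normed_vector, second_countable_topology} measure"
  assumes fin: "finite_measure M" "finite_measure N"
    and borel: "sets M = sets borel" "sets N = sets borel"
    and char: "\<And>l :: 'a \<Rightarrow>\<^sub>L real. (CLINT x|M. iexp (l x)) = (CLINT x|N. iexp (l x))"
  shows "(\<And>l A. (l, A) \<in> set xs \<Longrightarrow> A \<in> sets borel) \<Longrightarrow>
    (CLINT x|M. of_real (cylinder_weight xs x) * iexp (blinfun_apply l x))
      = (CLINT x|N. of_real (cylinder_weight xs x) * iexp (blinfun_apply l x))"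
proof (induction xs arbitrary: l)
  case Nil
  then show ?case using char by simp
next
  case (Cons p xs)
  obtain l0 A where p: "p = (l0, A)" by force
  define w where "w = cylinder_weight xs"
  have A[measurable]: "A \<in> sets borel" using Cons p by auto
  have w[measurable]: "w \<in> borel_measurable borel"
    unfolding w_def by (rule measurable_cylinder_weight) (use Cons in auto)
  have w_bd: "0 \<le> w x" "w x \<le> 1" for x
    unfolding w_def cylinder_weight_eq by (auto simp: indicator_def)
  note [measurable_cong] = borel
  interpret M: finite_measure M by fact
  interpret N: finite_measure N by fact
  have IH: "(CLINT x|M. of_real (w x) * iexp (blinfun_apply k x)) = (CLINT x|N. of_real (w x) * iexp (blinfun_apply k x))" for k
    unfolding w_def by (rule Cons.IH) (use Cons.prems in auto)
  have int: "integrable L (\<lambda>x. of_real (w x) * iexp (blinfun_apply k x))"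
    if "finite_measure L" and [measurable_cong]: "sets L = sets borel" for L k
    by (rule finite_measure.integrable_const_bound[OF that(1), of _ 1])
       (use w_bd in \<open>auto simp: norm_mult\<close>)
  \<comment> \<open>Written with exponentials, the weighted integrand only involves \<open>w e\<^bsup>ik\<^esup>\<close> for functionals \<open>k\<close>.\<close>
  have trig: "(CLINT x|M. of_real (w x * (1 + a * cos (l x) + b * sin (l x))) * iexp (s * l0 x))
      = (CLINT x|N. of_real (w x * (1 + a * cos (l x) + b * sin (l x))) * iexp (s * l0 x))" for a b s
  proof -
    have eq: "of_real (w x * (1 + a * cos (l x) + b * sin (l x))) * iexp (s * l0 x) =
        of_real (w x) * iexp (blinfun_apply (s *\<^sub>R l0) x)
        + (of_real a / 2 + of_real b / (2 * \<i>)) * (of_real (w x) * iexp (blinfun_apply (s *\<^sub>R l0 + l) x))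
        + (of_real a / 2 - of_real b / (2 * \<i>)) * (of_real (w x) * iexp (blinfun_apply (s *\<^sub>R l0 - l) x))" for x
    proof -
      have 1: "iexp (blinfun_apply (s *\<^sub>R l0 + l) x) = iexp (s * l0 x) * iexp (l x)"
        by (simp add: blinfun.add_left blinfun.scaleR_left exp_add algebra_simps)
      have 2: "iexp (blinfun_apply (s *\<^sub>R l0 - l) x) = iexp (s * l0 x) * iexp (- l x)"
        by (simp add: blinfun.diff_left blinfun.scaleR_left exp_add[symmetric] algebra_simps)
      have 3: "iexp (blinfun_apply (s *\<^sub>R l0) x) = iexp (s * l0 x)" by (simp add: blinfun.scaleR_left)
      have c: "of_real (cos (l x)) = (iexp (l x) + iexp (- l x)) / 2"
        by (simp add: cos_of_real[symmetric] cos_exp_eq)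
      have s: "of_real (sin (l x)) = (iexp (l x) - iexp (- l x)) / (2 * \<i>)"
        by (simp add: sin_of_real[symmetric] sin_exp_eq)
      show ?thesis unfolding 1 2 3 of_real_mult of_real_add c s
        by (simp add: field_simps)
    qed
    have lin: "(CLINT x|L. f x + c * g x + d * k x) = (CLINT x|L. f x) + c * (CLINT x|L. g x) + d * (CLINT x|L. k x)"
      if "integrable L f" "integrable L g" "integrable L k" for L :: "'a measure" and f g k c d
      using that by simp
    show ?thesis unfolding eq
      by (simp only: lin[OF int[OF fin(1) borel(1)] int[OF fin(1) borel(1)] int[OF fin(1) borel(1)]]
        lin[OF int[OF fin(2) borel(2)] int[OF fin(2) borel(2)] int[OF fin(2) borel(2)]] IH)
  qed
  have ind: "(\<integral>x. w x * (1 + a * cos (l x) + b * sin (l x)) * indicator A (l0 x) \<partial>M)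
      = (\<integral>x. w x * (1 + a * cos (l x) + b * sin (l x)) * indicator A (l0 x) \<partial>N)"
    if "0 \<le> a" "0 \<le> b" "a + b \<le> 1" for a b
  proof (rule weighted_char_unique[OF fin borel _ _ _ trig A, where c = 3])
    fix x
    have "\<bar>a * cos (l x)\<bar> \<le> a * 1" "\<bar>b * sin (l x)\<bar> \<le> b * 1"
      unfolding abs_mult using that by (auto intro: mult_left_le)
    then have *: "0 \<le> 1 + a * cos (l x) + b * sin (l x)" "1 + a * cos (l x) + b * sin (l x) \<le> 3"
      using that by (auto simp: abs_le_iff)
    show "0 \<le> w x * (1 + a * cos (l x) + b * sin (l x))" using * w_bd by simp
    show "w x * (1 + a * cos (l x) + b * sin (l x)) \<le> 3"
      using mult_mono[OF w_bd(2) *(2)] w_bd * by simp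
  qed measurable
  have intr: "integrable L (\<lambda>x. w x * f x * indicator A (l0 x))"
    if "finite_measure L" and [measurable_cong]: "sets L = sets borel"
      and [measurable]: "f \<in> borel_measurable borel" and f: "\<And>x. \<bar>f x\<bar> \<le> 1" for L f
    by (rule finite_measure.integrable_const_bound[OF that(1), of _ 1])
       (use w_bd f in \<open>auto simp: norm_mult abs_mult indicator_def intro!: mult_le_one\<close>)
  have split: "(\<integral>x. w x * (1 + a * cos (l x) + b * sin (l x)) * indicator A (l0 x) \<partial>L)
      = (\<integral>x. w x * 1 * indicator A (l0 x) \<partial>L)
        + (a * (\<integral>x. w x * cos (l x) * indicator A (l0 x) \<partial>L)
        + b * (\<integral>x. w x * sin (l x) * indicator A (l0 x) \<partial>L))"
    if L: "finite_measure L" "sets L = sets borel" for L a b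
  proof -
    have "w x * (1 + a * cos (l x) + b * sin (l x)) * indicator A (l0 x)
      = w x * 1 * indicator A (l0 x) + (a * (w x * cos (l x) * indicator A (l0 x))
        + b * (w x * sin (l x) * indicator A (l0 x)))" for x by (simp add: algebra_simps)
    moreover have "integrable L (\<lambda>x. w x * 1 * indicator A (l0 x))"
      "integrable L (\<lambda>x. w x * cos (l x) * indicator A (l0 x))"
      "integrable L (\<lambda>x. w x * sin (l x) * indicator A (l0 x))"
      by (rule intr[OF L], simp_all)+
    moreover have "(\<integral>x. f x + (a * g x + b * k x) \<partial>L) = (\<integral>x. f x \<partial>L) + (a * (\<integral>x. g x \<partial>L) + b * (\<integral>x. k x \<partial>L))"
      if "integrable L f" "integrable L g" "integrable L k" for f g k :: "'a \<Rightarrow> real"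
      using that by simp
    ultimately show ?thesis by presburger
  qed
  note S = split[OF fin(1) borel(1)] split[OF fin(2) borel(2)]
  have one: "(\<integral>x. w x * 1 * indicator A (l0 x) \<partial>M) = (\<integral>x. w x * 1 * indicator A (l0 x) \<partial>N)"
    using ind[of 0 0] unfolding S by simp
  have cos: "(\<integral>x. w x * cos (l x) * indicator A (l0 x) \<partial>M) = (\<integral>x. w x * cos (l x) * indicator A (l0 x) \<partial>N)"
    using ind[of 1 0] one unfolding S by simp
  have sin: "(\<integral>x. w x * sin (l x) * indicator A (l0 x) \<partial>M) = (\<integral>x. w x * sin (l x) * indicator A (l0 x) \<partial>N)"
    using ind[of 0 1] one unfolding S by simp
  have fin_split: "(CLINT x|L. of_real (cylinder_weight (p # xs) x) * iexp (l x))
      = of_real (\<integral>x. w x * cos (l x) * indicator A (l0 x) \<partial>L)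
        + \<i> * of_real (\<integral>x. w x * sin (l x) * indicator A (l0 x) \<partial>L)"
    if L: "finite_measure L" "sets L = sets borel" for L
  proof -
    have "of_real (cylinder_weight (p # xs) x) * iexp (l x) =
        complex_of_real (w x * cos (l x) * indicator A (l0 x))
        + \<i> * complex_of_real (w x * sin (l x) * indicator A (l0 x))" for x
      unfolding p w_def[symmetric]
      by (simp add: w_def exp_Euler cos_of_real sin_of_real algebra_simps flip: w_def)
    moreover have "integrable L (\<lambda>x. w x * cos (l x) * indicator A (l0 x))"
      "integrable L (\<lambda>x. w x * sin (l x) * indicator A (l0 x))"
      by (rule intr[OF L], simp_all)+
    moreover have "(CLINT x|L. of_real (g x) + \<i> * of_real (k x)) = of_real (\<integral>x. g x \<partial>L) + \<i> * of_real (\<integral>x. k x \<partial>L)"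
      if "integrable L g" "integrable L k" for g k :: "'a \<Rightarrow> real"
      using that by simp
    ultimately show ?thesis by presburger
  qed
  show ?case unfolding fin_split[OF fin(1) borel(1)] fin_split[OF fin(2) borel(2)] cos sin ..
qed

text \<open>With a norming sequence, closed balls are countable intersections of half spaces, and in a separable
  space open sets are countable unions of closed balls.\<close>

lemma sets_borel_cylinders:
  "sets (borel :: 'a::{real_normed_vector, second_countable_topology} measure) =
    sigma_sets UNIV {{x. \<forall>(l, A)\<in>set xs. blinfun_apply l x \<in> A} | xs ::
      (('a \<Rightarrow>\<^sub>L real) \<times> real set) list. \<forall>(l, A)\<in>set xs. A \<in> sets borel}" (is "_ = sigma_sets UNIV ?G")
proof
  obtain l :: "nat \<Rightarrow> 'a \<Rightarrow>\<^sub>L real" where l: "\<And>x r. norm x \<le> r \<longleftrightarrow> (\<forall>n. l n x \<le> r)"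
    using norming_sequence_exists[where 'a='a] by blast
  interpret S: sigma_algebra UNIV "sigma_sets UNIV ?G" by (rule sigma_algebra_sigma_sets) simp
  have half: "{x. l n x \<le> c} \<in> sigma_sets UNIV ?G" for n c
    by (rule sigma_sets.Basic, rule CollectI, rule exI[of _ "[(l n, {..c})]"]) auto
  have cball: "cball a r \<in> sigma_sets UNIV ?G" for a r
  proof -
    have "cball a r = (\<Inter>n. {x. l n x \<le> l n a + r})"
    proof -
      have "x \<in> cball a r \<longleftrightarrow> (\<forall>n. l n x \<le> l n a + r)" for x
        using l[of "x - a" r] by (simp add: dist_norm norm_minus_commute blinfun.diff_right algebra_simps)
      then show ?thesis by auto
    qed
    also have "\<dots> \<in> sigma_sets UNIV ?G" using half by (intro S.countable_INT) auto
    finally show ?thesis .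
  qed
  have open_in: "U \<in> sigma_sets UNIV ?G" if U: "open U" for U
  proof -
    obtain D :: "'a set" where D: "countable D" "\<And>X. open X \<Longrightarrow> X \<noteq> {} \<Longrightarrow> \<exists>d\<in>D. d \<in> X"
      using countable_dense_exists by blast
    define F where "F = {(d, n) \<in> D \<times> (UNIV :: nat set). cball d (1 / real (Suc n)) \<subseteq> U}"
    have cF: "countable F" unfolding F_def using D(1)
      by (intro countable_subset[OF _ countable_SIGMA[of D "\<lambda>_. UNIV"]]) auto
    have "U = (\<Union>(d, n)\<in>F. cball d (1 / real (Suc n)))"
    proof
      show "U \<subseteq> (\<Union>(d, n)\<in>F. cball d (1 / real (Suc n)))"
      proof
        fix x assume "x \<in> U"
        then obtain e where e: "e > 0" "ball x e \<subseteq> U" using U openE by blast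
        obtain n where n: "2 / real (Suc n) < e"
          using reals_Archimedean[of "e / 2"] e(1) by (auto simp: field_simps)
        obtain d where d: "d \<in> D" "d \<in> ball x (1 / real (Suc n))"
          using D(2)[of "ball x (1 / real (Suc n))"] by auto
        have "cball d (1 / real (Suc n)) \<subseteq> ball x e"
        proof
          fix y assume "y \<in> cball d (1 / real (Suc n))"
          then have "dist x y < 1 / real (Suc n) + 1 / real (Suc n)"
            using d(2) dist_triangle[of x y d] by (auto simp: dist_commute)
          also have "\<dots> = 2 / real (Suc n)" by simp
          finally show "y \<in> ball x e" using n by simp
        qed
        then have "(d, n) \<in> F" unfolding F_def using d(1) e(2) by auto
        moreover have "x \<in> cball d (1 / real (Suc n))" using d(2) by (auto simp: dist_commute)
        ultimately show "x \<in> (\<Union>(d, n)\<in>F. cball d (1 / real (Suc n)))" by blast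
      qed
    qed (auto simp: F_def)
    also have "\<dots> \<in> sigma_sets UNIV ?G"
      using cball cF by (intro S.countable_UN') auto
    finally show ?thesis .
  qed
  have "sigma_sets UNIV {S :: 'a set. open S} \<subseteq> sigma_sets UNIV ?G"
    by (rule sigma_sets_mono) (use open_in in auto)
  then show "sets (borel :: 'a measure) \<subseteq> sigma_sets UNIV ?G"
    unfolding borel_def by simp
next
  have "{x. \<forall>(l, A)\<in>set xs. blinfun_apply l x \<in> A} \<in> sets borel"
    if "\<forall>(l, A)\<in>set xs. A \<in> sets borel" for xs :: "(('a \<Rightarrow>\<^sub>L real) \<times> real set) list"
  proof -
    have "cylinder_weight xs \<in> borel_measurable borel"
      by (rule measurable_cylinder_weight) (use that in auto)
    then show ?thesis unfolding cylinder_weight_eq by (simp add: borel_measurable_indicator_iff)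
  qed
  then have "?G \<subseteq> sets borel" by blast
  then show "sigma_sets UNIV ?G \<subseteq> sets borel"
    using sets.sigma_sets_subset[of ?G borel] by simp
qed

theorem char_functional_unique:
  fixes M N :: "'a::{real_normed_vector, second_countable_topology} measure"
  assumes fin: "finite_measure M" "finite_measure N"
    and borel: "sets M = sets borel" "sets N = sets borel"
    and char: "\<And>l :: 'a \<Rightarrow>\<^sub>L real. (CLINT x|M. iexp (l x)) = (CLINT x|N. iexp (l x))"
  shows "M = N"
proof -
  let ?G = "{{x. \<forall>(l, A)\<in>set xs. blinfun_apply l x \<in> A} | xs ::
      (('a \<Rightarrow>\<^sub>L real) \<times> real set) list. \<forall>(l, A)\<in>set xs. A \<in> sets borel}"
  interpret M: finite_measure M by fact
  interpret N: finite_measure N by fact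
  show ?thesis
  proof (rule measure_eqI_generator_eq[where E = ?G and \<Omega> = UNIV and A = "\<lambda>_. UNIV"])
    show "Int_stable ?G"
    proof (rule Int_stableI)
      fix S T assume S: "S \<in> ?G" and T: "T \<in> ?G"
      obtain xs :: "(('a \<Rightarrow>\<^sub>L real) \<times> real set) list" where "\<forall>(l, A)\<in>set xs. A \<in> sets borel" "S = {x. \<forall>(l, A)\<in>set xs. blinfun_apply l x \<in> A}"
        using S by blast
      moreover obtain ys :: "(('a \<Rightarrow>\<^sub>L real) \<times> real set) list" where "\<forall>(l, A)\<in>set ys. A \<in> sets borel" "T = {x. \<forall>(l, A)\<in>set ys. blinfun_apply l x \<in> A}"
        using T by blast
      ultimately show "S \<inter> T \<in> ?G" by (intro CollectI exI[of _ "xs @ ys"]) auto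
    qed
    fix X assume "X \<in> ?G"
    then obtain xs :: "(('a \<Rightarrow>\<^sub>L real) \<times> real set) list" where xs: "\<forall>(l, A)\<in>set xs. A \<in> sets borel"
      and X: "X = {x. \<forall>(l, A)\<in>set xs. blinfun_apply l x \<in> A}" by blast
    have Xb: "X \<in> sets borel"
      by (subst sets_borel_cylinders, rule sigma_sets.Basic) fact
    have "(CLINT x|M. of_real (cylinder_weight xs x) * iexp (blinfun_apply 0 x))
      = (CLINT x|N. of_real (cylinder_weight xs x) * iexp (blinfun_apply 0 x))"
      by (rule cylinder_weight_char_eq[OF fin borel char]) (use xs in auto)
    then have "measure M X = measure N X"
      using Xb borel unfolding cylinder_weight_eq X[symmetric] by simp
    then show "emeasure M X = emeasure N X"
      by (simp add: M.emeasure_eq_measure N.emeasure_eq_measure)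
  next
    show "range (\<lambda>_. UNIV) \<subseteq> ?G" by (auto intro!: exI[of _ "[]"])
    show "sets M = sigma_sets UNIV ?G" "sets N = sigma_sets UNIV ?G"
      unfolding borel by (rule sets_borel_cylinders)+
  qed auto
qed

section \<open>Second moments of a centered Gaussian measure\<close>

lemma gaussian_sets: "gaussian_measure \<gamma> \<Longrightarrow> sets \<gamma> = sets borel"
  and gaussian_prob: "gaussian_measure \<gamma> \<Longrightarrow> prob_space \<gamma>"
  unfolding gaussian_measure_def by auto

text \<open>In the degenerate case the centering forces the point mass to sit at \<open>0\<close>, so that both cases are
  covered by one formula in terms of the second moment.\<close>

lemma gaussian_functional:
  fixes \<gamma> :: "'a::{banach, second_countable_topology} measure" and l :: "'a \<Rightarrow>\<^sub>L real"
  assumes g: "gaussian_measure \<gamma>" and c: "centered \<gamma>"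
  shows gaussian_functional_square_integrable: "integrable \<gamma> (\<lambda>x. (l x)\<^sup>2)"
    and gaussian_char: "(CLINT x|\<gamma>. iexp (l x)) = of_real (exp (- (\<integral>x. (l x)\<^sup>2 \<partial>\<gamma>) / 2))"
proof -
  note s[measurable_cong] = gaussian_sets[OF g]
  interpret prob_space \<gamma> by (rule gaussian_prob[OF g])
  have mean: "(\<integral>x. l x \<partial>\<gamma>) = 0"
    using has_bochner_integral_bounded_linear[OF blinfun.bounded_linear_right, of \<gamma> "\<lambda>x. x" 0 l] c
    unfolding centered_def by (simp add: has_bochner_integral_integral_eq)
  have mean_d: "(\<integral>y. y \<partial>distr \<gamma> borel (blinfun_apply l)) = 0"
    using mean by (subst integral_distr) auto
  consider m where "distr \<gamma> borel (blinfun_apply l) = return borel m"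
    | m \<sigma> where "\<sigma> > 0" "distr \<gamma> borel (blinfun_apply l) = density lborel (\<lambda>x. ennreal (normal_density m \<sigma> x))"
    using g unfolding gaussian_measure_def by blast
  then have "integrable \<gamma> (\<lambda>x. (l x)\<^sup>2) \<and> (CLINT x|\<gamma>. iexp (l x)) = of_real (exp (- (\<integral>x. (l x)\<^sup>2 \<partial>\<gamma>) / 2))"
  proof cases
    case 1
    have m: "m = 0" using mean_d unfolding 1 by (simp add: integral_return)
    have "AE y in distr \<gamma> borel (blinfun_apply l). y = 0"
      unfolding 1 m by (subst AE_return) auto
    then have ae: "AE x in \<gamma>. l x = 0"
      by (subst (asm) AE_distr_iff) auto
    have "(\<integral>x. (l x)\<^sup>2 \<partial>\<gamma>) = (\<integral>x. 0 \<partial>\<gamma>)"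
      by (rule integral_cong_AE) (use ae in auto)
    moreover have "(CLINT x|\<gamma>. iexp (l x)) = (CLINT x|\<gamma>. 1)"
      by (rule integral_cong_AE) (use ae in auto)
    moreover have "integrable \<gamma> (\<lambda>x. (l x)\<^sup>2) \<longleftrightarrow> integrable \<gamma> (\<lambda>x. 0 :: real)"
      by (rule integrable_cong_AE) (use ae in auto)
    ultimately show ?thesis by (simp add: prob_space)
  next
    case 2
    have m: "m = 0"
      using mean_d 2(1) unfolding 2(2) by (subst (asm) integral_density) (auto simp: integral_normal_moment_nz_1)
    note d = 2(2)[unfolded m]
    have "integrable (distr \<gamma> borel (blinfun_apply l)) (\<lambda>y. y\<^sup>2)"
      unfolding d using integrable_normal_moment[OF 2(1), of 0 2] by (subst integrable_density) auto
    then have int: "integrable \<gamma> (\<lambda>x. (l x)\<^sup>2)"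
      by (subst (asm) integrable_distr_eq) auto
    have "(\<integral>x. (l x)\<^sup>2 \<partial>\<gamma>) = (\<integral>y. y\<^sup>2 \<partial>distr \<gamma> borel (blinfun_apply l))"
      by (subst integral_distr) auto
    also have "\<dots> = \<sigma>\<^sup>2"
      unfolding d using integral_normal_moment_even[OF 2(1), of 0 1] 2(1)
      by (subst integral_density) (auto simp: fact_numeral)
    finally have var: "(\<integral>x. (l x)\<^sup>2 \<partial>\<gamma>) = \<sigma>\<^sup>2" .
    have "distributed \<gamma> lborel (blinfun_apply l) (normal_density 0 \<sigma>)"
      unfolding distributed_def using d by (auto cong: distr_cong)
    then have "distributed \<gamma> lborel (\<lambda>x. l x / \<sigma>) std_normal_density"
      using normal_standard_normal_convert[OF 2(1), of "blinfun_apply l" 0] by simp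
    then have std: "distr \<gamma> borel (\<lambda>x. l x / \<sigma>) = std_normal_distribution"
      unfolding distributed_def by (auto cong: distr_cong)
    have "(CLINT x|\<gamma>. iexp (l x)) = (CLINT x|\<gamma>. iexp (\<sigma> * (l x / \<sigma>)))"
      using 2(1) by simp
    also have "\<dots> = (CLINT y|distr \<gamma> borel (\<lambda>x. l x / \<sigma>). iexp (\<sigma> * y))"
      by (subst integral_distr) auto
    also have "\<dots> = of_real (exp (- \<sigma>\<^sup>2 / 2))"
      unfolding std char_def[symmetric] by (simp only: char_std_normal_distribution)
    finally show ?thesis using int var by simp
  qed
  then show "integrable \<gamma> (\<lambda>x. (l x)\<^sup>2)"
    "(CLINT x|\<gamma>. iexp (l x)) = of_real (exp (- (\<integral>x. (l x)\<^sup>2 \<partial>\<gamma>) / 2))" by auto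
qed

text \<open>The characteristic functional of \<open>\<gamma> \<otimes> \<gamma>\<close> at \<open>(l1, l2)\<close> depends only on the sum of the second moments of
  \<open>l1\<close> and \<open>l2\<close>. The map replaces them by \<open>(l1 + l2) / \<surd>2\<close> and \<open>(l1 - l2) / \<surd>2\<close>, which leaves this sum unchanged
  by the parallelogram law.\<close>

lemma gaussian_rotation:
  fixes \<gamma> :: "'a::{banach, second_countable_topology} measure"
  assumes g: "gaussian_measure \<gamma>" and c: "centered \<gamma>"
  shows "distr (\<gamma> \<Otimes>\<^sub>M \<gamma>) borel (\<lambda>(x, y). ((1 / sqrt 2) *\<^sub>R (x + y), (1 / sqrt 2) *\<^sub>R (x - y))) = \<gamma> \<Otimes>\<^sub>M \<gamma>"
    (is "distr _ _ ?R = _")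
proof (rule char_functional_unique)
  note s[measurable_cong] = gaussian_sets[OF g]
  interpret G: prob_space \<gamma> by (rule gaussian_prob[OF g])
  interpret P: pair_prob_space \<gamma> \<gamma> ..
  have sP: "sets (\<gamma> \<Otimes>\<^sub>M \<gamma>) = sets (borel :: ('a \<times> 'a) measure)"
    unfolding borel_prod[symmetric] by (rule sets_pair_measure_cong) (rule s)+
  then show "sets (\<gamma> \<Otimes>\<^sub>M \<gamma>) = sets borel" .
  have R[measurable]: "?R \<in> \<gamma> \<Otimes>\<^sub>M \<gamma> \<rightarrow>\<^sub>M borel"
    unfolding measurable_cong_sets[OF sP refl]
    by (intro borel_measurable_continuous_onI) (auto simp: split_beta intro!: continuous_intros)
  show "finite_measure (distr (\<gamma> \<Otimes>\<^sub>M \<gamma>) borel ?R)"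
    by (rule P.finite_measure_distr) (rule R)
  show "finite_measure (\<gamma> \<Otimes>\<^sub>M \<gamma>)" by (rule P.finite_measure_axioms)
  show "sets (distr (\<gamma> \<Otimes>\<^sub>M \<gamma>) borel ?R) = sets borel" by simp
  fix L :: "('a \<times> 'a) \<Rightarrow>\<^sub>L real"
  have char2: "(CLINT z|\<gamma> \<Otimes>\<^sub>M \<gamma>. iexp (blinfun_apply a (fst z) + blinfun_apply b (snd z))) =
      of_real (exp (- ((\<integral>x. (a x)\<^sup>2 \<partial>\<gamma>) + (\<integral>x. (b x)\<^sup>2 \<partial>\<gamma>)) / 2))" for a b :: "'a \<Rightarrow>\<^sub>L real"
  proof -
    have "(CLINT z|\<gamma> \<Otimes>\<^sub>M \<gamma>. iexp (a (fst z) + b (snd z))) = (CLINT x|\<gamma>. (CLINT y|\<gamma>. iexp (a x + b y)))"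
      by (subst P.integral_fst'[symmetric]) (auto intro!: P.integrable_const_bound[of _ 1])
    also have "\<dots> = (CLINT x|\<gamma>. iexp (a x) * (CLINT y|\<gamma>. iexp (b y)))"
      by (simp add: exp_add distrib_left)
    also have "\<dots> = (CLINT x|\<gamma>. iexp (a x)) * (CLINT y|\<gamma>. iexp (b y))" by simp
    also have "\<dots> = of_real (exp (- ((\<integral>x. (a x)\<^sup>2 \<partial>\<gamma>) + (\<integral>x. (b x)\<^sup>2 \<partial>\<gamma>)) / 2))"
      unfolding gaussian_char[OF g c] by (simp add: exp_add[symmetric] add_divide_distrib flip: of_real_mult)
    finally show ?thesis .
  qed
  have bl: "bounded_linear (\<lambda>x :: 'a. (x, 0 :: 'a))" "bounded_linear (\<lambda>y :: 'a. (0 :: 'a, y))"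
    by (intro bounded_linear_intros)+
  define l1 where "l1 = blinfun_compose L (Blinfun (\<lambda>x :: 'a. (x, 0 :: 'a)))"
  define l2 where "l2 = blinfun_compose L (Blinfun (\<lambda>y :: 'a. (0 :: 'a, y)))"
  have L: "L (u, v) = l1 u + l2 v" for u v
    unfolding l1_def l2_def using blinfun.add_right[of L "(u, 0)" "(0, v)"]
    by (simp add: bounded_linear_Blinfun_apply[OF bl(1)] bounded_linear_Blinfun_apply[OF bl(2)])
  define a where "a = (1 / sqrt 2) *\<^sub>R (l1 + l2)"
  define b where "b = (1 / sqrt 2) *\<^sub>R (l1 - l2)"
  have LR: "L (?R z) = a (fst z) + b (snd z)" for z
    unfolding a_def b_def by (cases z) (simp add: L blinfun.bilinear_simps algebra_simps)
  note int = gaussian_functional_square_integrable[OF g c]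
  have "(\<integral>x. (a x)\<^sup>2 \<partial>\<gamma>) + (\<integral>x. (b x)\<^sup>2 \<partial>\<gamma>) = (\<integral>x. (a x)\<^sup>2 + (b x)\<^sup>2 \<partial>\<gamma>)"
    by (rule Bochner_Integration.integral_add[symmetric]) (rule int)+
  also have "(\<lambda>x. (a x)\<^sup>2 + (b x)\<^sup>2) = (\<lambda>x. (l1 x)\<^sup>2 + (l2 x)\<^sup>2)"
    unfolding a_def b_def
    by (auto simp: blinfun.bilinear_simps fun_eq_iff power_mult_distrib power_divide power2_eq_square field_simps)
  also have "(\<integral>x. (l1 x)\<^sup>2 + (l2 x)\<^sup>2 \<partial>\<gamma>) = (\<integral>x. (l1 x)\<^sup>2 \<partial>\<gamma>) + (\<integral>x. (l2 x)\<^sup>2 \<partial>\<gamma>)"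
    by (rule Bochner_Integration.integral_add) (rule int)+
  finally have var: "(\<integral>x. (a x)\<^sup>2 \<partial>\<gamma>) + (\<integral>x. (b x)\<^sup>2 \<partial>\<gamma>) = (\<integral>x. (l1 x)\<^sup>2 \<partial>\<gamma>) + (\<integral>x. (l2 x)\<^sup>2 \<partial>\<gamma>)" .
  have "(CLINT z|distr (\<gamma> \<Otimes>\<^sub>M \<gamma>) borel ?R. iexp (L z)) = (CLINT z|\<gamma> \<Otimes>\<^sub>M \<gamma>. iexp (a (fst z) + b (snd z)))"
    by (subst integral_distr) (simp_all only: R LR, measurable)
  also have "\<dots> = (CLINT z|\<gamma> \<Otimes>\<^sub>M \<gamma>. iexp (l1 (fst z) + l2 (snd z)))"
    unfolding char2 var ..
  also have "\<dots> = (CLINT z|\<gamma> \<Otimes>\<^sub>M \<gamma>. iexp (L z))"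
    by (simp add: L[symmetric])
  finally show "(CLINT z|distr (\<gamma> \<Otimes>\<^sub>M \<gamma>) borel ?R. iexp (L z)) = (CLINT z|\<gamma> \<Otimes>\<^sub>M \<gamma>. iexp (L z))" .
qed

text \<open>Fernique's inequality. After rotation, the event that one coordinate is at most \<open>s\<close> while the other
  exceeds \<open>t\<close> forces both original coordinates to exceed \<open>(t - s) / \<surd>2\<close>.\<close>

lemma gaussian_tail_ineq:
  fixes \<gamma> :: "'a::{banach, second_countable_topology} measure"
  assumes g: "gaussian_measure \<gamma>" and c: "centered \<gamma>"
  shows "measure \<gamma> {x. norm x \<le> s} * measure \<gamma> {x. norm x > t}
    \<le> (measure \<gamma> {x. norm x > (t - s) / sqrt 2})\<^sup>2"
proof -
  note s[measurable_cong] = gaussian_sets[OF g]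
  interpret G: prob_space \<gamma> by (rule gaussian_prob[OF g])
  interpret P: pair_prob_space \<gamma> \<gamma> ..
  have sP: "sets (\<gamma> \<Otimes>\<^sub>M \<gamma>) = sets (borel :: ('a \<times> 'a) measure)"
    unfolding borel_prod[symmetric] by (rule sets_pair_measure_cong) (rule s)+
  have spP: "space (\<gamma> \<Otimes>\<^sub>M \<gamma>) = UNIV" using sets_eq_imp_space_eq[OF sP] by simp
  let ?R = "\<lambda>(x, y). ((1 / sqrt 2) *\<^sub>R (x + y), (1 / sqrt 2) *\<^sub>R (x - y)) :: 'a \<times> 'a"
  have R[measurable]: "?R \<in> \<gamma> \<Otimes>\<^sub>M \<gamma> \<rightarrow>\<^sub>M borel"
    unfolding measurable_cong_sets[OF sP refl]
    by (intro borel_measurable_continuous_onI) (auto simp: split_beta intro!: continuous_intros)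
  have m: "{x. norm x \<le> r} \<in> sets \<gamma>" "{x. norm x > r} \<in> sets \<gamma>" for r
    unfolding s by measurable
  have times: "measure (\<gamma> \<Otimes>\<^sub>M \<gamma>) (A \<times> B) = measure \<gamma> A * measure \<gamma> B"
    if "A \<in> sets \<gamma>" "B \<in> sets \<gamma>" for A B
    using G.emeasure_pair_measure_Times[OF that]
    by (simp add: G.emeasure_eq_measure P.emeasure_eq_measure flip: ennreal_mult)
  let ?S = "{x. norm x > t} \<times> {x. norm x \<le> s}" and ?r = "(t - s) / sqrt 2"
  have S: "?S \<in> sets (\<gamma> \<Otimes>\<^sub>M \<gamma>)" using m by (rule pair_measureI[rotated])
  have "measure \<gamma> {x. norm x \<le> s} * measure \<gamma> {x. norm x > t} = measure (\<gamma> \<Otimes>\<^sub>M \<gamma>) ?S"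
    using times[OF m(2) m(1)] by simp
  also have "\<dots> = measure (distr (\<gamma> \<Otimes>\<^sub>M \<gamma>) borel ?R) ?S"
    unfolding gaussian_rotation[OF g c] ..
  also have "\<dots> = measure (\<gamma> \<Otimes>\<^sub>M \<gamma>) (?R -` ?S)"
    using S unfolding sP by (subst measure_distr) (auto simp: spP)
  also have "\<dots> \<le> measure (\<gamma> \<Otimes>\<^sub>M \<gamma>) ({x. norm x > ?r} \<times> {x. norm x > ?r})"
  proof (rule P.finite_measure_mono)
    show "?R -` ?S \<subseteq> {x. norm x > ?r} \<times> {x. norm x > ?r}"
    proof
      fix z assume z: "z \<in> ?R -` ?S"
      obtain x y where xy: "z = (x, y)" by force
      have 1: "t < norm (x + y) / sqrt 2" and 2: "norm (x - y) / sqrt 2 \<le> s"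
        using z unfolding xy by auto
      have dbl: "norm (v + v) = 2 * norm v" for v :: 'a by (simp add: scaleR_2[symmetric])
      have 3: "norm (x + y) \<le> norm (x - y) + 2 * norm y" "norm (x + y) \<le> norm (x - y) + 2 * norm x"
        using norm_triangle_ineq[of "x - y" "2 *\<^sub>R y"] norm_triangle_ineq[of "y - x" "2 *\<^sub>R x"]
        by (auto simp: scaleR_2 dbl norm_minus_commute algebra_simps)
      have "t - s < (2 * norm x) / sqrt 2" "t - s < (2 * norm y) / sqrt 2"
        using 1 2 3 by (auto simp: field_simps)
      moreover have "2 * a / sqrt 2 = a * sqrt 2" for a :: real by (simp add: field_simps)
      ultimately have "?r < norm x" "?r < norm y"
        by (simp_all add: pos_divide_less_eq)
      then show "z \<in> {x. norm x > ?r} \<times> {x. norm x > ?r}" unfolding xy by simp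
    qed
    show "{x. norm x > ?r} \<times> {x. norm x > ?r} \<in> P.events"
      using m by (intro pair_measureI)
  qed
  also have "\<dots> = (measure \<gamma> {x. norm x > ?r})\<^sup>2"
    using times[OF m(2) m(2)] by (simp add: power2_eq_square)
  finally show ?thesis .
qed

text \<open>The first moment gives tails of order \<open>1 / t\<close> by Markov's inequality. Each use of the tail inequality
  squares the order, so two uses give \<open>1 / t\<^sup>4\<close>, which is enough for a second moment.\<close>

lemma gaussian_norm_square_integrable:
  fixes \<gamma> :: "'a::{banach, second_countable_topology} measure"
  assumes g: "gaussian_measure \<gamma>" and c: "centered \<gamma>"
  shows "integrable \<gamma> (\<lambda>x. (norm x)\<^sup>2)"
proof -
  note s[measurable_cong] = gaussian_sets[OF g]
  interpret G: prob_space \<gamma> by (rule gaussian_prob[OF g])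
  have sp: "space \<gamma> = UNIV" using sets_eq_imp_space_eq[OF s] by simp
  define Q where "Q t = measure \<gamma> {x. norm x > t}" for t
  define m where "m = (\<integral>x. norm x \<partial>\<gamma>)"
  have Q0: "0 \<le> Q t" for t unfolding Q_def by simp
  have Q_anti: "Q t \<le> Q s" if "s \<le> t" for s t
    unfolding Q_def by (rule G.finite_measure_mono) (use that in \<open>auto simp: s\<close>)
  have intn: "integrable \<gamma> norm"
    using c unfolding centered_def by (auto intro: integrable_norm simp: has_bochner_integral_iff)
  have m0: "0 \<le> m" unfolding m_def by simp
  have markov: "Q t \<le> m / t" if "t > 0" for t
  proof -
    have "Q t \<le> measure \<gamma> {x\<in>space \<gamma>. norm x \<ge> t}"
      unfolding Q_def by (rule G.finite_measure_mono) (auto simp: sp)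
    also have "\<dots> \<le> m / t" unfolding m_def
      by (rule integral_Markov_inequality_measure[OF intn _ _ that]) auto
    finally show ?thesis .
  qed
  \<comment> \<open>By the inequality of Markov the ball of this radius has probability at least one half.\<close>
  define s0 where "s0 = 2 * m + 1"
  have s0: "s0 \<ge> 1" unfolding s0_def using m0 by simp
  have half: "measure \<gamma> {x. norm x \<le> s0} \<ge> 1 / 2"
  proof -
    have "{x. norm x \<le> s0} = space \<gamma> - {x. norm x > s0}" by (auto simp: sp)
    then have "measure \<gamma> {x. norm x \<le> s0} = 1 - Q s0"
      unfolding Q_def by (subst G.prob_compl[symmetric]) (auto simp: s)
    moreover have "Q s0 \<le> 1 / 2"
    proof -
      have "Q s0 \<le> m / s0" using markov[of s0] s0 by simp
      also have "\<dots> \<le> 1 / 2" using m0 unfolding s0_def by (simp add: field_simps)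
      finally show ?thesis .
    qed
    ultimately show ?thesis by simp
  qed
  have step: "Q t \<le> 2 * (Q (t / 4))\<^sup>2" if t: "t \<ge> 2 * s0" for t
  proof -
    have "(1 / 2) * Q t \<le> measure \<gamma> {x. norm x \<le> s0} * Q t"
      by (rule mult_right_mono[OF half Q0])
    also have "\<dots> \<le> (Q ((t - s0) / sqrt 2))\<^sup>2"
      using gaussian_tail_ineq[OF g c, of s0 t] unfolding Q_def .
    also have "\<dots> \<le> (Q (t / 4))\<^sup>2"
    proof (rule power_mono[OF Q_anti Q0])
      have "sqrt 2 \<le> 2" using real_sqrt_le_mono[of 2 4] by simp
      then have "t / 4 * sqrt 2 \<le> t / 4 * 2" using t s0 by (intro mult_left_mono) auto
      then show "t / 4 \<le> (t - s0) / sqrt 2" using t by (simp add: field_simps)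
    qed
    finally show ?thesis by simp
  qed
  have two: "Q t \<le> 32 * m\<^sup>2 / t\<^sup>2" if t: "t \<ge> 2 * s0" for t
  proof -
    have "Q t \<le> 2 * (Q (t / 4))\<^sup>2" by (rule step[OF t])
    also have "\<dots> \<le> 2 * (m / (t / 4))\<^sup>2"
      using t s0 by (intro mult_left_mono power_mono markov Q0) auto
    also have "\<dots> = 32 * m\<^sup>2 / t\<^sup>2" by (simp add: power_divide power_mult_distrib)
    finally show ?thesis .
  qed
  define C where "C = 2 * (512 * m\<^sup>2)\<^sup>2"
  have C0: "0 \<le> C" unfolding C_def by simp
  have four: "Q t \<le> C / t ^ 4" if t: "t \<ge> 8 * s0" for t
  proof -
    have "Q t \<le> 2 * (Q (t / 4))\<^sup>2" by (rule step) (use t s0 in auto)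
    also have "\<dots> \<le> 2 * (32 * m\<^sup>2 / (t / 4)\<^sup>2)\<^sup>2"
      using t s0 by (intro mult_left_mono power_mono two Q0) auto
    also have "\<dots> = C / t ^ 4" unfolding C_def by (simp add: power_divide power_mult_distrib)
    finally show ?thesis .
  qed
  define K where "K = nat \<lceil>8 * s0\<rceil>"
  have K: "real K \<ge> 8 * s0" unfolding K_def by linarith
  have "ennreal ((norm x)\<^sup>2) \<le> ennreal (real K ^ 2)
      + (\<Sum>n. ennreal (real (n + K + 1) ^ 2) * indicator {x. norm x > real (n + K)} x)" for x :: 'a
  proof (cases "norm x \<le> real K")
    case True
    then have "ennreal ((norm x)\<^sup>2) \<le> ennreal (real K ^ 2)" by (intro ennreal_leI power_mono) auto
    then show ?thesis by (rule add_increasing2[OF zero_le])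
  next
    case False
    define n where "n = nat (\<lceil>norm x\<rceil> - 1) - K"
    have n: "real (n + K) < norm x" "norm x \<le> real (n + K + 1)"
      using False unfolding n_def by linarith+
    have "ennreal ((norm x)\<^sup>2) \<le> ennreal (real (n + K + 1) ^ 2) * indicator {x. norm x > real (n + K)} x"
      using n by (auto intro!: ennreal_leI power_mono)
    also have "\<dots> \<le> (\<Sum>n. ennreal (real (n + K + 1) ^ 2) * indicator {x. norm x > real (n + K)} x)"
    proof -
      have "F n \<le> (\<Sum>n. F n)" for F :: "nat \<Rightarrow> ennreal"
        using sum_le_suminf[of F "{n}"] by simp
      then show ?thesis .
    qed
    finally show ?thesis by (rule add_increasing[OF zero_le])
  qed
  then have "(\<integral>\<^sup>+x. ennreal ((norm x)\<^sup>2) \<partial>\<gamma>) \<le> (\<integral>\<^sup>+x. (ennreal (real K ^ 2)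
      + (\<Sum>n. ennreal (real (n + K + 1) ^ 2) * indicator {x. norm x > real (n + K)} x)) \<partial>\<gamma>)"
    by (intro nn_integral_mono)
  also have "\<dots> = ennreal (real K ^ 2) + (\<Sum>n. ennreal (real (n + K + 1) ^ 2) * emeasure \<gamma> {x. norm x > real (n + K)})"
  proof -
    have F[measurable]: "(\<lambda>x. ennreal (real (n + K + 1) ^ 2) * indicator {x. norm x > real (n + K)} x) \<in> borel_measurable \<gamma>" for n
      by measurable
    have "(\<integral>\<^sup>+x. (\<Sum>n. ennreal (real (n + K + 1) ^ 2) * indicator {x. norm x > real (n + K)} x) \<partial>\<gamma>)
        = (\<Sum>n. ennreal (real (n + K + 1) ^ 2) * emeasure \<gamma> {x. norm x > real (n + K)})"
      by (subst nn_integral_suminf[OF F], rule suminf_cong, rule nn_integral_cmult_indicator) (simp add: s)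
    then show ?thesis by (subst nn_integral_add) (simp_all only: nn_integral_const G.emeasure_space_1 mult_1_right, measurable)
  qed
  also have "\<dots> \<le> ennreal (real K ^ 2) + (\<Sum>n. ennreal (4 * C * (1 / real (Suc n) ^ 2)))"
  proof (intro add_left_mono suminf_le)
    fix n
    let ?r = "real (n + K)"
    have r: "?r \<ge> 8 * s0" "?r \<ge> 1" using K s0 by auto
    have rn: "?r \<ge> real (Suc n)" using K s0 by auto
    have "real (n + K + 1) ^ 2 * Q ?r \<le> (2 * ?r) ^ 2 * (C / ?r ^ 4)"
      using r by (intro mult_mono power_mono four Q0) auto
    also have "\<dots> = 4 * C * (1 / ?r ^ 2)"
    proof -
      have "(2 * r) ^ 2 * (C / r ^ 4) = 4 * C * (1 / r ^ 2)" if "r \<ge> 1" for r :: real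
        using that by (simp add: field_simps power2_eq_square power4_eq_xxxx)
      then show ?thesis using r(2) .
    qed
    also have "\<dots> \<le> 4 * C * (1 / real (Suc n) ^ 2)"
      using rn C0 by (intro mult_left_mono divide_left_mono power_mono) auto
    finally have "real (n + K + 1) ^ 2 * Q ?r \<le> 4 * C * (1 / real (Suc n) ^ 2)" .
    then show "ennreal (real (n + K + 1) ^ 2) * emeasure \<gamma> {x. norm x > ?r} \<le> ennreal (4 * C * (1 / real (Suc n) ^ 2))"
      unfolding G.emeasure_eq_measure Q_def[symmetric]
      by (subst ennreal_mult[symmetric]) (auto simp: Q0 intro!: ennreal_leI)
  qed auto
  also have "\<dots> < \<infinity>"
  proof -
    have "summable (\<lambda>n. inverse (real (Suc n) ^ 2))"
      using inverse_power_summable[of 2, where 'a = real] by (subst summable_Suc_iff) auto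
    then have "summable (\<lambda>n. 4 * C * (1 / real (Suc n) ^ 2))"
      by (intro summable_mult) (simp add: inverse_eq_divide)
    then show ?thesis
      using C0 by (subst suminf_ennreal2) auto
  qed
  finally show ?thesis by (intro integrableI_bounded) auto
qed

section \<open>Square integrable functions and the closure of the dual space\<close>

lemma L2_space_iff: "f \<in> L2_space M \<longleftrightarrow> f \<in> borel_measurable M \<and> integrable M (\<lambda>x. (f x)\<^sup>2)"
  unfolding L2_space_def by simp

lemma L2_measurable: "f \<in> L2_space M \<Longrightarrow> f \<in> borel_measurable M"
  by (simp add: L2_space_iff)

lemma L2_prod_integrable:
  assumes f: "f \<in> L2_space M" and g: "g \<in> L2_space M"
  shows "integrable M (\<lambda>x. f x * g x)"
proof (rule Bochner_Integration.integrable_bound)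
  show "integrable M (\<lambda>x. (f x)\<^sup>2 + (g x)\<^sup>2)" using f g by (simp add: L2_space_iff)
  show "(\<lambda>x. f x * g x) \<in> borel_measurable M" using f g by (auto simp: L2_space_iff intro: borel_measurable_times)
  have "\<bar>a * b\<bar> \<le> a\<^sup>2 + b\<^sup>2" for a b :: real
  proof -
    have "0 \<le> (\<bar>a\<bar> - \<bar>b\<bar>)\<^sup>2" by simp
    then have "2 * \<bar>a * b\<bar> \<le> a\<^sup>2 + b\<^sup>2" by (simp add: power2_diff abs_mult)
    moreover have "0 \<le> \<bar>a * b\<bar>" by simp
    ultimately show ?thesis by linarith
  qed
  then show "AE x in M. norm (f x * g x) \<le> norm ((f x)\<^sup>2 + (g x)\<^sup>2)" by auto
qed

lemma L2_scale: "f \<in> L2_space M \<Longrightarrow> (\<lambda>x. c * f x) \<in> L2_space M"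
  by (auto simp: L2_space_iff power_mult_distrib)

lemma L2_add:
  assumes "f \<in> L2_space M" "g \<in> L2_space M"
  shows "(\<lambda>x. f x + g x) \<in> L2_space M"
proof -
  have "integrable M (\<lambda>x. (f x)\<^sup>2 + 2 * (f x * g x) + (g x)\<^sup>2)"
    using assms L2_prod_integrable[OF assms] by (auto simp: L2_space_iff)
  then show ?thesis using assms by (auto simp: L2_space_iff power2_sum algebra_simps)
qed

lemma L2_diff:
  assumes "f \<in> L2_space M" "g \<in> L2_space M"
  shows "(\<lambda>x. f x - g x) \<in> L2_space M"
  using L2_add[OF assms(1) L2_scale[OF assms(2), of "-1"]] by simp

lemma L2_nrm_nonneg [simp]: "0 \<le> L2_nrm M f"
  unfolding L2_nrm_def by simp

lemma L2_nrm_sq: "(L2_nrm M f)\<^sup>2 = (\<integral>x. (f x)\<^sup>2 \<partial>M)"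
  unfolding L2_nrm_def by simp

lemma L2_nrm_scale: "L2_nrm M (\<lambda>x. c * f x) = \<bar>c\<bar> * L2_nrm M f"
  unfolding L2_nrm_def by (simp add: power_mult_distrib real_sqrt_mult)

lemma L2_nrm_minus_commute: "L2_nrm M (\<lambda>x. f x - g x) = L2_nrm M (\<lambda>x. g x - f x)"
  unfolding L2_nrm_def by (simp add: power2_commute)

lemma L2_sq_add:
  assumes f: "f \<in> L2_space M" and g: "g \<in> L2_space M"
  shows "(\<integral>x. (f x + g x)\<^sup>2 \<partial>M) = (\<integral>x. (f x)\<^sup>2 \<partial>M) + 2 * (\<integral>x. f x * g x \<partial>M) + (\<integral>x. (g x)\<^sup>2 \<partial>M)"
proof -
  have "(f x + g x)\<^sup>2 = (f x)\<^sup>2 + 2 * (f x * g x) + (g x)\<^sup>2" for x by (simp add: power2_sum)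
  then show ?thesis
    using f g L2_prod_integrable[OF f g] by (simp add: L2_space_iff)
qed

lemma nonneg_quadratic_imp_zero:
  fixes b q :: real
  assumes "\<And>s. 0 \<le> 2 * s * b + s\<^sup>2 * q"
  shows "b = 0"
proof (rule ccontr)
  assume b: "b \<noteq> 0"
  \<comment> \<open>The inequality fails at \<open>s = - b / k\<close> for any positive \<open>k\<close> larger than \<open>q\<close>.\<close>
  define k where "k = \<bar>q\<bar> + 1"
  have k: "k > 0" "q < k" unfolding k_def by auto
  have "0 \<le> 2 * (- b / k) * b + (- b / k)\<^sup>2 * q" by (rule assms)
  also have "\<dots> \<le> 2 * (- b / k) * b + (- b / k)\<^sup>2 * k"
    using k by (intro add_left_mono mult_left_mono) auto
  also have "\<dots> = - (b\<^sup>2 / k)" using k by (simp add: power2_eq_square field_simps)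
  also have "\<dots> < 0" using b k by simp
  finally show False by simp
qed

lemma L2_Cauchy_Schwarz:
  assumes f: "f \<in> L2_space M" and g: "g \<in> L2_space M"
  shows "\<bar>\<integral>x. f x * g x \<partial>M\<bar> \<le> L2_nrm M f * L2_nrm M g"
proof -
  define b where "b = (\<integral>x. f x * g x \<partial>M)"
  have ineq: "0 \<le> (L2_nrm M f)\<^sup>2 + 2 * s * b + s\<^sup>2 * (L2_nrm M g)\<^sup>2" for s
  proof -
    have "0 \<le> (\<integral>x. (f x + s * g x)\<^sup>2 \<partial>M)" by simp
    also have "\<dots> = (L2_nrm M f)\<^sup>2 + 2 * s * b + s\<^sup>2 * (L2_nrm M g)\<^sup>2"
      unfolding L2_sq_add[OF f L2_scale[OF g]] L2_nrm_sq b_def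
      by (simp add: power_mult_distrib mult.left_commute[of _ s])
    finally show ?thesis .
  qed
  show ?thesis
  proof (cases "L2_nrm M g = 0")
    case True
    have "b = 0"
    proof (rule ccontr)
      assume "b \<noteq> 0"
      then have "0 \<le> (L2_nrm M f)\<^sup>2 + 2 * (- ((L2_nrm M f)\<^sup>2 + 1) / (2 * b)) * b"
        using ineq[of "- ((L2_nrm M f)\<^sup>2 + 1) / (2 * b)"] True by simp
      then show False using \<open>b \<noteq> 0\<close> by (simp add: field_simps)
    qed
    then show ?thesis using True unfolding b_def by simp
  next
    case False
    define q where "q = (L2_nrm M g)\<^sup>2"
    have q: "q > 0" using False unfolding q_def by simp
    have "0 \<le> (L2_nrm M f)\<^sup>2 + 2 * (- b / q) * b + (- b / q)\<^sup>2 * q"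
      using ineq[of "- b / q"] unfolding q_def .
    also have "\<dots> = (L2_nrm M f)\<^sup>2 - b\<^sup>2 / q" using q by (simp add: power2_eq_square field_simps)
    finally have "b\<^sup>2 \<le> (L2_nrm M f * L2_nrm M g)\<^sup>2"
      using q unfolding power_mult_distrib q_def[symmetric] by (simp add: field_simps)
    then show ?thesis unfolding b_def[symmetric]
      by (metis L2_nrm_nonneg abs_le_square_iff abs_of_nonneg mult_nonneg_nonneg)
  qed
qed

lemma L2_triangle:
  assumes f: "f \<in> L2_space M" and g: "g \<in> L2_space M"
  shows "L2_nrm M (\<lambda>x. f x + g x) \<le> L2_nrm M f + L2_nrm M g"
proof (rule power2_le_imp_le)
  show "(L2_nrm M (\<lambda>x. f x + g x))\<^sup>2 \<le> (L2_nrm M f + L2_nrm M g)\<^sup>2"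
    using L2_Cauchy_Schwarz[OF f g] L2_sq_add[OF f g]
    by (simp add: L2_nrm_sq power2_sum abs_le_iff)
qed simp

lemma L2_nrm_zero_AE:
  assumes "f \<in> L2_space M" "L2_nrm M f = 0"
  shows "AE x in M. f x = 0"
  using assms integral_nonneg_eq_0_iff_AE[of M "\<lambda>x. (f x)\<^sup>2"]
  by (simp add: L2_space_iff L2_nrm_def)

lemma L2_nrm_cong_AE:
  assumes "f \<in> borel_measurable M" "g \<in> borel_measurable M" "AE x in M. f x = g x"
  shows "L2_nrm M f = L2_nrm M g"
  unfolding L2_nrm_def using assms by (intro arg_cong[of _ _ sqrt] integral_cong_AE) auto

text \<open>A Cauchy sequence in \<open>L\<^sup>2\<close> of a finite measure is Cauchy in \<open>L\<^sup>1\<close>, hence converges almost everywhere along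
  a subsequence; Fatou's lemma upgrades this to convergence in \<open>L\<^sup>2\<close> of the whole sequence.\<close>

lemma L2_complete:
  fixes f :: "nat \<Rightarrow> 'a \<Rightarrow> real"
  assumes fin: "finite_measure M" and f: "\<And>n. f n \<in> L2_space M"
    and cauchy: "\<And>e. e > 0 \<Longrightarrow> \<exists>N. \<forall>i\<ge>N. \<forall>j\<ge>N. L2_nrm M (\<lambda>x. f i x - f j x) < e"
  shows "\<exists>g\<in>L2_space M. (\<lambda>n. L2_nrm M (\<lambda>x. f n x - g x)) \<longlonglongrightarrow> 0"
proof -
  interpret finite_measure M by fact
  have [measurable]: "f n \<in> borel_measurable M" for n using f by (rule L2_measurable)
  have one: "(\<lambda>_. 1) \<in> L2_space M" by (simp add: L2_space_iff)
  define c where "c = L2_nrm M (\<lambda>_. 1) + 1"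
  have c: "c > 0" unfolding c_def using L2_nrm_nonneg[of M "\<lambda>_. 1"] by linarith
  have L1: "(\<integral>x. norm (f i x - f j x) \<partial>M) \<le> L2_nrm M (\<lambda>x. f i x - f j x) * c" for i j
  proof -
    have d: "(\<lambda>x. \<bar>f i x - f j x\<bar>) \<in> L2_space M" using L2_diff[OF f[of i] f[of j]] by (simp add: L2_space_iff)
    have "(\<integral>x. norm (f i x - f j x) \<partial>M) = (\<integral>x. \<bar>f i x - f j x\<bar> * 1 \<partial>M)" by simp
    also have "\<dots> \<le> L2_nrm M (\<lambda>x. \<bar>f i x - f j x\<bar>) * L2_nrm M (\<lambda>_. 1)"
      using L2_Cauchy_Schwarz[OF d one] by linarith
    also have "\<dots> \<le> L2_nrm M (\<lambda>x. f i x - f j x) * c"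
      unfolding c_def by (simp add: L2_nrm_def mult_left_mono)
    finally show ?thesis .
  qed
  obtain r where r: "strict_mono r" "AE x in M. Cauchy (\<lambda>i. f (r i) x)"
  proof (rule cauchy_L1_AE_cauchy_subseq[of M f])
    show "integrable M (f n)" for n using L2_prod_integrable[OF f one] by simp
    fix e :: real assume "e > 0"
    then obtain N where N: "\<forall>i\<ge>N. \<forall>j\<ge>N. L2_nrm M (\<lambda>x. f i x - f j x) < e / c"
      using cauchy[of "e / c"] c by auto
    have "(\<integral>x. norm (f i x - f j x) \<partial>M) < e" if "i \<ge> N" "j \<ge> N" for i j
    proof -
      have "L2_nrm M (\<lambda>x. f i x - f j x) * c < e" using N that c by (simp add: field_simps)
      then show ?thesis using L1[of i j] by linarith
    qed
    then show "\<exists>N. \<forall>i\<ge>N. \<forall>j\<ge>N. (\<integral>x. norm (f i x - f j x) \<partial>M) < e" by blast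
  qed blast
  define g where "g x = lim (\<lambda>i. f (r i) x)" for x
  have g[measurable]: "g \<in> borel_measurable M" unfolding g_def by (rule borel_measurable_lim_metric) simp
  have lim: "AE x in M. (\<lambda>i. f (r i) x) \<longlonglongrightarrow> g x"
    using r(2) unfolding g_def by eventually_elim (metis Cauchy_convergent convergent_LIMSEQ_iff)
  have bound: "(\<integral>\<^sup>+x. ennreal ((f n x - g x)\<^sup>2) \<partial>M) \<le> ennreal (e\<^sup>2)"
    if N: "\<And>i j. i \<ge> N \<Longrightarrow> j \<ge> N \<Longrightarrow> L2_nrm M (\<lambda>x. f i x - f j x) < e" and n: "n \<ge> N" for e N n
  proof -
    have "(\<integral>\<^sup>+x. ennreal ((f n x - g x)\<^sup>2) \<partial>M) = (\<integral>\<^sup>+x. liminf (\<lambda>i. ennreal ((f n x - f (r i) x)\<^sup>2)) \<partial>M)"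
    proof (rule nn_integral_cong_AE)
      show "AE x in M. ennreal ((f n x - g x)\<^sup>2) = liminf (\<lambda>i. ennreal ((f n x - f (r i) x)\<^sup>2))"
        using lim
      proof eventually_elim
        case (elim x)
        have "(\<lambda>i. ennreal ((f n x - f (r i) x)\<^sup>2)) \<longlonglongrightarrow> ennreal ((f n x - g x)\<^sup>2)"
          by (intro tendsto_ennrealI tendsto_intros elim)
        then show ?case by (rule lim_imp_Liminf[OF sequentially_bot, symmetric])
      qed
    qed
    also have "\<dots> \<le> liminf (\<lambda>i. \<integral>\<^sup>+x. ennreal ((f n x - f (r i) x)\<^sup>2) \<partial>M)"
      by (rule nn_integral_liminf) measurable
    also have "\<dots> \<le> ennreal (e\<^sup>2)"
    proof (rule Liminf_le)
      show "\<forall>\<^sub>F i in sequentially. (\<integral>\<^sup>+x. ennreal ((f n x - f (r i) x)\<^sup>2) \<partial>M) \<le> ennreal (e\<^sup>2)"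
        using eventually_ge_at_top[of N]
      proof eventually_elim
        case (elim i)
        have "r i \<ge> N" using elim seq_suble[OF r(1), of i] by simp
        then have "L2_nrm M (\<lambda>x. f n x - f (r i) x) \<le> e" using N[OF n] by (simp add: less_imp_le)
        then have "(\<integral>x. (f n x - f (r i) x)\<^sup>2 \<partial>M) \<le> e\<^sup>2"
          unfolding L2_nrm_sq[symmetric] by (intro power_mono) auto
        moreover have "integrable M (\<lambda>x. (f n x - f (r i) x)\<^sup>2)"
          using L2_diff[OF f[of n] f[of "r i"]] by (simp add: L2_space_iff)
        ultimately show ?case by (subst nn_integral_eq_integral) (auto intro: ennreal_leI)
      qed
    qed simp
    finally show ?thesis .
  qed
  have diff_L2: "(\<lambda>x. f n x - g x) \<in> L2_space M \<and> L2_nrm M (\<lambda>x. f n x - g x) \<le> e"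
    if N: "\<And>i j. i \<ge> N \<Longrightarrow> j \<ge> N \<Longrightarrow> L2_nrm M (\<lambda>x. f i x - f j x) < e" and n: "n \<ge> N" and e: "e > 0" for e N n
  proof
    have b: "(\<integral>\<^sup>+x. ennreal ((f n x - g x)\<^sup>2) \<partial>M) \<le> ennreal (e\<^sup>2)" by (rule bound[OF N n])
    then have int: "integrable M (\<lambda>x. (f n x - g x)\<^sup>2)"
      by (intro integrableI_bounded) (auto simp: le_less_trans[OF _ ennreal_less_top])
    then show "(\<lambda>x. f n x - g x) \<in> L2_space M" by (simp add: L2_space_iff)
    have "ennreal (\<integral>x. (f n x - g x)\<^sup>2 \<partial>M) \<le> ennreal (e\<^sup>2)"
      using b int by (subst nn_integral_eq_integral[symmetric]) auto
    then show "L2_nrm M (\<lambda>x. f n x - g x) \<le> e"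
      unfolding L2_nrm_def using e by (simp add: real_le_lsqrt)
  qed
  have "g \<in> L2_space M"
  proof -
    obtain N where N: "\<forall>i\<ge>N. \<forall>j\<ge>N. L2_nrm M (\<lambda>x. f i x - f j x) < 1" using cauchy[of 1] by auto
    then have "(\<lambda>x. f N x - g x) \<in> L2_space M" using diff_L2[of N 1 N] by simp
    from L2_diff[OF f[of N] this] show ?thesis by simp
  qed
  moreover have "(\<lambda>n. L2_nrm M (\<lambda>x. f n x - g x)) \<longlonglongrightarrow> 0"
  proof (rule LIMSEQ_I)
    fix e :: real assume e: "0 < e"
    then obtain N where N: "\<forall>i\<ge>N. \<forall>j\<ge>N. L2_nrm M (\<lambda>x. f i x - f j x) < e / 2" using cauchy[of "e / 2"] by auto
    have "norm (L2_nrm M (\<lambda>x. f n x - g x) - 0) < e" if "n \<ge> N" for n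
      using diff_L2[of N "e / 2" n] N that e by simp
    then show "\<exists>N. \<forall>n\<ge>N. norm (L2_nrm M (\<lambda>x. f n x - g x) - 0) < e" by blast
  qed
  ultimately show ?thesis by blast
qed

locale centered_gaussian =
  fixes \<gamma> :: "'a::{banach, second_countable_topology} measure"
  assumes gaussian: "gaussian_measure \<gamma>" and centered: "centered \<gamma>"
begin

lemma sets_gaussian [measurable_cong, simp]: "sets \<gamma> = sets borel"
  by (rule gaussian_sets[OF gaussian])

lemma space_gaussian [simp]: "space \<gamma> = UNIV"
  using sets_eq_imp_space_eq[OF sets_gaussian] by simp

sublocale prob_space \<gamma>
  by (rule gaussian_prob[OF gaussian])

lemma functional_L2: "blinfun_apply l \<in> L2_space \<gamma>"
  using gaussian_functional_square_integrable[OF gaussian centered] by (simp add: L2_space_iff)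

lemma dual_closureD: "f \<in> dual_closure \<gamma> \<Longrightarrow> f \<in> L2_space \<gamma>"
  unfolding dual_closure_def by simp

lemma functional_dual_closure: "blinfun_apply l \<in> dual_closure \<gamma>"
  unfolding dual_closure_def using functional_L2[of l] by (auto intro!: exI[of _ l] simp: L2_nrm_def)

lemma dual_closureE:
  assumes "f \<in> dual_closure \<gamma>" "e > 0"
  obtains l :: "'a \<Rightarrow>\<^sub>L real" where "L2_nrm \<gamma> (\<lambda>x. f x - l x) < e"
  using assms unfolding dual_closure_def by blast

text \<open>The usual minimisation of \<open>\<parallel>l\<parallel>\<^sup>2 - 2 \<Phi> l\<close>, carried out over the dual space itself. By the parallelogram
  law a minimising sequence is Cauchy in \<open>L\<^sup>2\<close>; its limit lies in the closure of the dual by construction,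
  and the first variation vanishes in every direction \<open>k\<close>.\<close>

lemma dual_riesz:
  fixes \<Phi> :: "('a \<Rightarrow>\<^sub>L real) \<Rightarrow> real"
  assumes lin: "linear \<Phi>" and bd: "\<And>l. \<bar>\<Phi> l\<bar> \<le> C * L2_nrm \<gamma> (blinfun_apply l)"
  shows "\<exists>g\<in>dual_closure \<gamma>. \<forall>l. (\<integral>x. g x * blinfun_apply l x \<partial>\<gamma>) = \<Phi> l"
proof -
  define N where "N l = (\<integral>x. (blinfun_apply l x)\<^sup>2 \<partial>\<gamma>)" for l :: "'a \<Rightarrow>\<^sub>L real"
  define J where "J l = N l - 2 * \<Phi> l" for l
  have N_add: "N (k + l) = N k + 2 * (\<integral>x. blinfun_apply k x * blinfun_apply l x \<partial>\<gamma>) + N l" for k l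
    unfolding N_def using L2_sq_add[OF functional_L2 functional_L2, of k l] by (simp add: blinfun.add_left)
  have N_scale: "N (s *\<^sub>R l) = s\<^sup>2 * N l" for s l
    unfolding N_def by (simp add: blinfun.scaleR_left power_mult_distrib)
  have N_neg: "N (k - l) = N k - 2 * (\<integral>x. blinfun_apply k x * blinfun_apply l x \<partial>\<gamma>) + N l" for k l
    using N_add[of k "- l"] N_scale[of "-1" l] by (simp add: blinfun.minus_left)
  have J_lower: "- (C\<^sup>2) \<le> J l" for l
  proof -
    have "0 \<le> (L2_nrm \<gamma> (blinfun_apply l) - C)\<^sup>2" by simp
    also have "\<dots> = N l - 2 * (C * L2_nrm \<gamma> (blinfun_apply l)) + C\<^sup>2"
      by (simp add: power2_diff L2_nrm_sq N_def)
    finally show ?thesis using bd[of l] unfolding J_def by linarith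
  qed
  define d where "d = (INF l. J l)"
  have bdd: "bdd_below (range J)" by (rule bdd_belowI2[OF J_lower])
  have dle: "d \<le> J l" for l unfolding d_def by (rule cINF_lower[OF bdd]) simp
  have "\<exists>l. J l < d + 1 / real (Suc n)" for n
    unfolding d_def using cINF_less_iff[OF _ bdd, of "(INF l. J l) + 1 / real (Suc n)"] by auto
  then obtain l where l: "\<And>n. J (l n) < d + 1 / real (Suc n)" by metis
  have near: "N (l i - l j) \<le> 2 / real (Suc i) + 2 / real (Suc j)" for i j
  proof -
    have "N (l i - l j) = 2 * J (l i) + 2 * J (l j) - 4 * J ((1 / 2) *\<^sub>R (l i + l j))"
      unfolding J_def N_neg N_scale N_add linear_cmul[OF lin] linear_add[OF lin]
      by (simp add: power2_eq_square field_simps)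
    also have "\<dots> \<le> 2 * (d + 1 / real (Suc i)) + 2 * (d + 1 / real (Suc j)) - 4 * d"
    proof -
      have "2 * a + 2 * b - 4 * c \<le> 2 * (d + u) + 2 * (d + v) - 4 * d"
        if "a < d + u" "b < d + v" "d \<le> c" for a b c u v :: real
        using add_mono[OF less_imp_le[OF that(1)] less_imp_le[OF that(2)]] that(3) by (simp add: algebra_simps)
      then show ?thesis using l dle by blast
    qed
    finally show ?thesis by simp
  qed
  have "\<exists>g\<in>L2_space \<gamma>. (\<lambda>n. L2_nrm \<gamma> (\<lambda>x. blinfun_apply (l n) x - g x)) \<longlonglongrightarrow> 0"
  proof (rule L2_complete[OF finite_measure_axioms functional_L2])
    fix e :: real assume e: "e > 0"
    obtain n where n: "1 / real (Suc n) < e\<^sup>2 / 4" using reals_Archimedean[of "e\<^sup>2 / 4"] e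
      by (auto simp: inverse_eq_divide)
    have "L2_nrm \<gamma> (\<lambda>x. l i x - l j x) < e" if "i \<ge> n" "j \<ge> n" for i j
    proof -
      have "1 / real (Suc i) \<le> 1 / real (Suc n)" "1 / real (Suc j) \<le> 1 / real (Suc n)"
        using that by (auto intro!: divide_left_mono)
      then have "N (l i - l j) < e\<^sup>2" using near[of i j] n by linarith
      then have "(L2_nrm \<gamma> (\<lambda>x. l i x - l j x))\<^sup>2 < e\<^sup>2"
        unfolding L2_nrm_sq N_def by (simp add: blinfun.diff_left)
      then show ?thesis using e by (simp add: power2_less_imp_less)
    qed
    then show "\<exists>n. \<forall>i\<ge>n. \<forall>j\<ge>n. L2_nrm \<gamma> (\<lambda>x. blinfun_apply (l i) x - blinfun_apply (l j) x) < e" by blast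
  qed
  then obtain g where g: "g \<in> L2_space \<gamma>" and lim: "(\<lambda>n. L2_nrm \<gamma> (\<lambda>x. blinfun_apply (l n) x - g x)) \<longlonglongrightarrow> 0" by blast
  have "g \<in> dual_closure \<gamma>"
    unfolding dual_closure_def
  proof (intro CollectI conjI g allI impI)
    fix e :: real assume "e > 0"
    then have "\<forall>\<^sub>F n in sequentially. L2_nrm \<gamma> (\<lambda>x. l n x - g x) < e"
      using lim by (auto dest: order_tendstoD)
    then obtain n where "L2_nrm \<gamma> (\<lambda>x. l n x - g x) < e" by (auto simp: eventually_sequentially)
    then show "\<exists>l. L2_nrm \<gamma> (\<lambda>x. g x - blinfun_apply l x) < e"
      by (subst (asm) L2_nrm_minus_commute) blast
  qed
  moreover have "(\<integral>x. g x * k x \<partial>\<gamma>) = \<Phi> k" for k :: "'a \<Rightarrow>\<^sub>L real"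
  proof -
    have conv: "(\<lambda>n. \<integral>x. l n x * k x \<partial>\<gamma>) \<longlonglongrightarrow> (\<integral>x. g x * k x \<partial>\<gamma>)"
    proof (rule LIM_zero_cancel, rule Lim_null_comparison)
      show "\<forall>\<^sub>F n in sequentially. norm ((\<integral>x. l n x * k x \<partial>\<gamma>) - (\<integral>x. g x * k x \<partial>\<gamma>))
          \<le> L2_nrm \<gamma> (\<lambda>x. l n x - g x) * L2_nrm \<gamma> (blinfun_apply k)"
      proof (rule always_eventually, rule allI)
        fix n
        have "(\<integral>x. l n x * k x \<partial>\<gamma>) - (\<integral>x. g x * k x \<partial>\<gamma>) = (\<integral>x. (l n x - g x) * k x \<partial>\<gamma>)"
          using L2_prod_integrable[OF functional_L2 functional_L2, of "l n" k] L2_prod_integrable[OF g functional_L2, of k]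
          by (simp add: left_diff_distrib)
        then show "norm ((\<integral>x. l n x * k x \<partial>\<gamma>) - (\<integral>x. g x * k x \<partial>\<gamma>))
          \<le> L2_nrm \<gamma> (\<lambda>x. l n x - g x) * L2_nrm \<gamma> (blinfun_apply k)"
          using L2_Cauchy_Schwarz[OF L2_diff[OF functional_L2 g] functional_L2, of "l n" k] by simp
      qed
      show "(\<lambda>n. L2_nrm \<gamma> (\<lambda>x. l n x - g x) * L2_nrm \<gamma> (blinfun_apply k)) \<longlonglongrightarrow> 0"
        using tendsto_mult_left_zero[OF lim] .
    qed
    have "0 \<le> 2 * s * ((\<integral>x. g x * k x \<partial>\<gamma>) - \<Phi> k) + s\<^sup>2 * N k" for s
    proof -
      have "0 \<le> 2 * s * ((\<integral>x. l n x * k x \<partial>\<gamma>) - \<Phi> k) + s\<^sup>2 * N k + 1 / real (Suc n)" for n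
      proof -
        have "J (l n + s *\<^sub>R k) = J (l n) + 2 * s * ((\<integral>x. l n x * k x \<partial>\<gamma>) - \<Phi> k) + s\<^sup>2 * N k"
          unfolding J_def N_add N_scale linear_cmul[OF lin] linear_add[OF lin]
          by (simp add: blinfun.scaleR_left algebra_simps)
        then show ?thesis using dle[of "l n + s *\<^sub>R k"] l[of n] by linarith
      qed
      moreover have "(\<lambda>n. 2 * s * ((\<integral>x. l n x * k x \<partial>\<gamma>) - \<Phi> k) + s\<^sup>2 * N k + 1 / real (Suc n)) \<longlonglongrightarrow>
          2 * s * ((\<integral>x. g x * k x \<partial>\<gamma>) - \<Phi> k) + s\<^sup>2 * N k + 0"
        by (intro tendsto_intros conv LIMSEQ_Suc[OF lim_1_over_n])
      ultimately have "0 \<le> 2 * s * ((\<integral>x. g x * k x \<partial>\<gamma>) - \<Phi> k) + s\<^sup>2 * N k + 0"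
        by (intro LIMSEQ_le_const) auto
      then show ?thesis by simp
    qed
    then show ?thesis using nonneg_quadratic_imp_zero by fastforce
  qed
  ultimately show ?thesis by blast
qed

end

section \<open>The Cameron-Martin space\<close>

context centered_gaussian
begin

lemma norm_L2: "norm \<in> L2_space \<gamma>"
  using gaussian_norm_square_integrable[OF gaussian centered] by (simp add: L2_space_iff)

text \<open>Square integrability of the norm makes the integral defining the Cameron-Martin space a genuine
  Bochner integral, not the default value \<open>0\<close>.\<close>

lemma L2_barycenter_integrable:
  assumes f: "f \<in> L2_space \<gamma>"
  shows "integrable \<gamma> (\<lambda>x. f x *\<^sub>R x)"
proof (rule Bochner_Integration.integrable_bound)
  show "integrable \<gamma> (\<lambda>x. f x * norm x)" by (rule L2_prod_integrable[OF f norm_L2])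
  show "(\<lambda>x. f x *\<^sub>R x) \<in> borel_measurable \<gamma>"
    using L2_measurable[OF f] by measurable
qed simp

lemma functional_barycenter:
  assumes f: "f \<in> L2_space \<gamma>"
  shows "blinfun_apply l (\<integral>x. f x *\<^sub>R x \<partial>\<gamma>) = (\<integral>x. f x * blinfun_apply l x \<partial>\<gamma>)"
  using integral_bounded_linear[OF blinfun.bounded_linear_right[of l] L2_barycenter_integrable[OF f]]
  by (simp add: blinfun.scaleR_right)

lemma eq_by_functionals:
  assumes "\<And>l :: 'a \<Rightarrow>\<^sub>L real. blinfun_apply l x = blinfun_apply l y"
  shows "x = y"
  using functionals_separate[of "x - y"] assms by (simp add: blinfun.diff_right)

lemma dual_closure_add:
  assumes f: "f \<in> dual_closure \<gamma>" and g: "g \<in> dual_closure \<gamma>"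
  shows "(\<lambda>x. f x + g x) \<in> dual_closure \<gamma>"
  unfolding dual_closure_def
proof (intro CollectI conjI allI impI L2_add dual_closureD f g)
  fix e :: real assume e: "e > 0"
  obtain k where k: "L2_nrm \<gamma> (\<lambda>x. f x - blinfun_apply k x) < e / 2" using dual_closureE[OF f, of "e / 2"] e by auto
  obtain l where l: "L2_nrm \<gamma> (\<lambda>x. g x - blinfun_apply l x) < e / 2" using dual_closureE[OF g, of "e / 2"] e by auto
  have "L2_nrm \<gamma> (\<lambda>x. (f x - blinfun_apply k x) + (g x - blinfun_apply l x)) < e"
    using L2_triangle[OF L2_diff[OF dual_closureD[OF f] functional_L2[of k]]
      L2_diff[OF dual_closureD[OF g] functional_L2[of l]]] k l by linarith
  then show "\<exists>l. L2_nrm \<gamma> (\<lambda>x. f x + g x - blinfun_apply l x) < e"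
    by (intro exI[of _ "k + l"]) (simp add: blinfun.add_left algebra_simps)
qed

lemma dual_closure_scale:
  assumes f: "f \<in> dual_closure \<gamma>"
  shows "(\<lambda>x. c * f x) \<in> dual_closure \<gamma>"
  unfolding dual_closure_def
proof (intro CollectI conjI allI impI L2_scale dual_closureD f)
  fix e :: real assume e: "e > 0"
  obtain k where k: "L2_nrm \<gamma> (\<lambda>x. f x - blinfun_apply k x) < e / (\<bar>c\<bar> + 1)"
    using dual_closureE[OF f, of "e / (\<bar>c\<bar> + 1)"] e by auto
  have "L2_nrm \<gamma> (\<lambda>x. c * (f x - blinfun_apply k x)) \<le> (\<bar>c\<bar> + 1) * L2_nrm \<gamma> (\<lambda>x. f x - blinfun_apply k x)"
    unfolding L2_nrm_scale by (intro mult_right_mono) auto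
  also have "\<dots> < e" using k by (simp add: field_simps)
  finally show "\<exists>l. L2_nrm \<gamma> (\<lambda>x. c * f x - blinfun_apply l x) < e"
    by (intro exI[of _ "c *\<^sub>R k"]) (simp add: blinfun.scaleR_left algebra_simps)
qed

text \<open>A difference \<open>u\<close> that is orthogonal to all functionals is orthogonal to functionals arbitrarily close to
  \<open>u\<close> itself.\<close>

lemma dual_closure_unique:
  assumes f: "f \<in> dual_closure \<gamma>" and g: "g \<in> dual_closure \<gamma>"
    and eq: "\<And>l. (\<integral>x. f x * blinfun_apply l x \<partial>\<gamma>) = (\<integral>x. g x * blinfun_apply l x \<partial>\<gamma>)"
  shows "AE x in \<gamma>. f x = g x"
proof -
  define u where "u x = f x - g x" for x
  have u: "u \<in> dual_closure \<gamma>"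
    using dual_closure_add[OF f dual_closure_scale[OF g, of "-1"]] unfolding u_def by simp
  note uL = dual_closureD[OF u]
  have orth: "(\<integral>x. u x * blinfun_apply l x \<partial>\<gamma>) = 0" for l
    unfolding u_def left_diff_distrib
    using L2_prod_integrable[OF dual_closureD[OF f] functional_L2, of l]
      L2_prod_integrable[OF dual_closureD[OF g] functional_L2, of l] eq[of l] by simp
  have "L2_nrm \<gamma> u \<le> e" if e: "e > 0" for e
  proof -
    obtain l where l: "L2_nrm \<gamma> (\<lambda>x. u x - blinfun_apply l x) < e" using dual_closureE[OF u e] .
    have "L2_nrm \<gamma> u * L2_nrm \<gamma> u = (\<integral>x. u x * u x \<partial>\<gamma>)" 
      using L2_nrm_sq[of \<gamma> u] by (simp add: power2_eq_square)
    also have "\<dots> = (\<integral>x. u x * (u x - blinfun_apply l x) \<partial>\<gamma>)"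
      unfolding right_diff_distrib
      using L2_prod_integrable[OF uL uL] L2_prod_integrable[OF uL functional_L2, of l] orth[of l] by simp
    also have "\<dots> \<le> L2_nrm \<gamma> u * L2_nrm \<gamma> (\<lambda>x. u x - blinfun_apply l x)"
      using L2_Cauchy_Schwarz[OF uL L2_diff[OF uL functional_L2, of l]] by linarith
    also have "\<dots> \<le> L2_nrm \<gamma> u * e" using l by (intro mult_left_mono) auto
    finally have "L2_nrm \<gamma> u * L2_nrm \<gamma> u \<le> L2_nrm \<gamma> u * e" .
    then show ?thesis using e L2_nrm_nonneg[of \<gamma> u] by (cases "L2_nrm \<gamma> u = 0") auto
  qed
  then have "L2_nrm \<gamma> u \<le> 0" using field_le_epsilon[of "L2_nrm \<gamma> u" 0] by simp
  then have "AE x in \<gamma>. u x = 0" using L2_nrm_zero_AE[OF uL] by (simp add: antisym)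
  then show ?thesis unfolding u_def by simp
qed

text \<open>Orthogonal projection onto the closure of the dual; it does not change the barycenter because
  functionals separate points.\<close>

lemma L2_projection:
  assumes f: "f \<in> L2_space \<gamma>"
  shows "\<exists>g\<in>dual_closure \<gamma>. (\<integral>x. g x *\<^sub>R x \<partial>\<gamma>) = (\<integral>x. f x *\<^sub>R x \<partial>\<gamma>)"
proof -
  define \<Phi> where "\<Phi> l = (\<integral>x. f x * blinfun_apply l x \<partial>\<gamma>)" for l :: "'a \<Rightarrow>\<^sub>L real"
  have lin: "linear \<Phi>"
    unfolding \<Phi>_def using L2_prod_integrable[OF f functional_L2]
    by (intro linearI) (simp_all add: blinfun.add_left blinfun.scaleR_left distrib_left mult.left_commute)
  obtain g where g: "g \<in> dual_closure \<gamma>" "\<And>l. (\<integral>x. g x * blinfun_apply l x \<partial>\<gamma>) = \<Phi> l"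
    using dual_riesz[OF lin, of "L2_nrm \<gamma> f"] L2_Cauchy_Schwarz[OF f functional_L2] unfolding \<Phi>_def by blast
  have "(\<integral>x. g x *\<^sub>R x \<partial>\<gamma>) = (\<integral>x. f x *\<^sub>R x \<partial>\<gamma>)"
    by (rule eq_by_functionals)
       (simp add: functional_barycenter[OF f] functional_barycenter[OF dual_closureD[OF g(1)]] g(2) \<Phi>_def)
  with g(1) show ?thesis by blast
qed

lemma CM_hat:
  assumes "k \<in> CM_space \<gamma>"
  shows CM_hat_dual_closure: "CM_hat \<gamma> k \<in> dual_closure \<gamma>"
    and CM_hat_barycenter: "(\<integral>x. CM_hat \<gamma> k x *\<^sub>R x \<partial>\<gamma>) = k"
proof -
  have "\<exists>f. f \<in> dual_closure \<gamma> \<and> k = (\<integral>x. f x *\<^sub>R x \<partial>\<gamma>)"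
    using assms L2_projection unfolding CM_space_def by force
  from someI_ex[OF this] show "CM_hat \<gamma> k \<in> dual_closure \<gamma>" "(\<integral>x. CM_hat \<gamma> k x *\<^sub>R x \<partial>\<gamma>) = k"
    unfolding CM_hat_def by auto
qed

lemma CM_hat_L2: "k \<in> CM_space \<gamma> \<Longrightarrow> CM_hat \<gamma> k \<in> L2_space \<gamma>"
  by (rule dual_closureD[OF CM_hat_dual_closure])

lemma functional_CM:
  "k \<in> CM_space \<gamma> \<Longrightarrow> blinfun_apply l k = (\<integral>x. CM_hat \<gamma> k x * blinfun_apply l x \<partial>\<gamma>)"
  using functional_barycenter[OF CM_hat_L2, of k l] CM_hat_barycenter by simp

lemma barycenter_CM: "f \<in> L2_space \<gamma> \<Longrightarrow> (\<integral>x. f x *\<^sub>R x \<partial>\<gamma>) \<in> CM_space \<gamma>"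
  unfolding CM_space_def by blast

lemma CM_hat_barycenter_AE:
  assumes f: "f \<in> dual_closure \<gamma>"
  shows "AE x in \<gamma>. CM_hat \<gamma> (\<integral>x. f x *\<^sub>R x \<partial>\<gamma>) x = f x"
proof (rule dual_closure_unique[OF CM_hat_dual_closure f])
  show k: "(\<integral>x. f x *\<^sub>R x \<partial>\<gamma>) \<in> CM_space \<gamma>" by (rule barycenter_CM[OF dual_closureD[OF f]])
  show "(\<integral>x. CM_hat \<gamma> (\<integral>x. f x *\<^sub>R x \<partial>\<gamma>) x * blinfun_apply l x \<partial>\<gamma>) = (\<integral>x. f x * blinfun_apply l x \<partial>\<gamma>)" for l
    using functional_CM[OF k, of l] functional_barycenter[OF dual_closureD[OF f], of l] by simp
qed

lemma CM_combination:
  assumes h: "h \<in> CM_space \<gamma>" and k: "k \<in> CM_space \<gamma>"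
  shows CM_space_combination: "a *\<^sub>R h + b *\<^sub>R k \<in> CM_space \<gamma>"
    and CM_hat_combination: "AE x in \<gamma>. CM_hat \<gamma> (a *\<^sub>R h + b *\<^sub>R k) x = a * CM_hat \<gamma> h x + b * CM_hat \<gamma> k x"
proof -
  let ?f = "\<lambda>x. a * CM_hat \<gamma> h x + b * CM_hat \<gamma> k x"
  have f: "?f \<in> dual_closure \<gamma>"
    by (intro dual_closure_add dual_closure_scale CM_hat_dual_closure h k)
  have "(\<integral>x. ?f x *\<^sub>R x \<partial>\<gamma>) = a *\<^sub>R (\<integral>x. CM_hat \<gamma> h x *\<^sub>R x \<partial>\<gamma>) + b *\<^sub>R (\<integral>x. CM_hat \<gamma> k x *\<^sub>R x \<partial>\<gamma>)"
    using L2_barycenter_integrable[OF CM_hat_L2[OF h]] L2_barycenter_integrable[OF CM_hat_L2[OF k]]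
    by (simp add: scaleR_add_left flip: scaleR_scaleR)
  then have eq: "(\<integral>x. ?f x *\<^sub>R x \<partial>\<gamma>) = a *\<^sub>R h + b *\<^sub>R k"
    by (simp add: CM_hat_barycenter h k)
  show "a *\<^sub>R h + b *\<^sub>R k \<in> CM_space \<gamma>"
    using barycenter_CM[OF dual_closureD[OF f]] unfolding eq .
  show "AE x in \<gamma>. CM_hat \<gamma> (a *\<^sub>R h + b *\<^sub>R k) x = ?f x"
    using CM_hat_barycenter_AE[OF f] unfolding eq .
qed

lemma CM_space_add: "h \<in> CM_space \<gamma> \<Longrightarrow> k \<in> CM_space \<gamma> \<Longrightarrow> h + k \<in> CM_space \<gamma>"
  using CM_space_combination[of h k 1 1] by simp

lemma CM_space_diff: "h \<in> CM_space \<gamma> \<Longrightarrow> k \<in> CM_space \<gamma> \<Longrightarrow> h - k \<in> CM_space \<gamma>"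
  using CM_space_combination[of h k 1 "-1"] by simp

lemma CM_space_zero: "0 \<in> CM_space \<gamma>"
  using barycenter_CM[OF functional_L2[of 0]] by simp

lemma CM_space_sum: "finite I \<Longrightarrow> (\<And>i. i \<in> I \<Longrightarrow> f i \<in> CM_space \<gamma>) \<Longrightarrow> (\<Sum>i\<in>I. f i) \<in> CM_space \<gamma>"
  by (induction I rule: finite_induct) (auto intro: CM_space_zero CM_space_add)

lemma CM_norm_nonneg [simp]: "0 \<le> CM_norm \<gamma> k"
  unfolding CM_norm_def by simp

lemma CM_inner_combination:
  assumes h: "h \<in> CM_space \<gamma>" and k: "k \<in> CM_space \<gamma>" and z: "z \<in> CM_space \<gamma>"
  shows "CM_inner \<gamma> (a *\<^sub>R h + b *\<^sub>R k) z = a * CM_inner \<gamma> h z + b * CM_inner \<gamma> k z"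
proof -
  have [measurable]: "CM_hat \<gamma> v \<in> borel_measurable \<gamma>" if "v \<in> CM_space \<gamma>" for v
    by (rule L2_measurable[OF CM_hat_L2[OF that]])
  note [measurable] = CM_space_combination[OF h k, of a b] h k z
  have "CM_inner \<gamma> (a *\<^sub>R h + b *\<^sub>R k) z
      = (\<integral>x. a * (CM_hat \<gamma> h x * CM_hat \<gamma> z x) + b * (CM_hat \<gamma> k x * CM_hat \<gamma> z x) \<partial>\<gamma>)"
    unfolding CM_inner_def
  proof (rule integral_cong_AE)
    show "AE x in \<gamma>. CM_hat \<gamma> (a *\<^sub>R h + b *\<^sub>R k) x * CM_hat \<gamma> z x =
        a * (CM_hat \<gamma> h x * CM_hat \<gamma> z x) + b * (CM_hat \<gamma> k x * CM_hat \<gamma> z x)"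
      using CM_hat_combination[OF h k, of a b] by eventually_elim (simp add: algebra_simps)
  qed measurable
  also have "\<dots> = a * CM_inner \<gamma> h z + b * CM_inner \<gamma> k z"
    unfolding CM_inner_def
    using L2_prod_integrable[OF CM_hat_L2[OF h] CM_hat_L2[OF z]] L2_prod_integrable[OF CM_hat_L2[OF k] CM_hat_L2[OF z]]
    by simp
  finally show ?thesis .
qed

lemma CM_inner_commute: "CM_inner \<gamma> h k = CM_inner \<gamma> k h"
  unfolding CM_inner_def by (simp add: mult.commute)

lemma CM_inner_diff_left:
  "h \<in> CM_space \<gamma> \<Longrightarrow> k \<in> CM_space \<gamma> \<Longrightarrow> z \<in> CM_space \<gamma> \<Longrightarrow>
    CM_inner \<gamma> (h - k) z = CM_inner \<gamma> h z - CM_inner \<gamma> k z"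
  using CM_inner_combination[of h k z 1 "-1"] by simp

lemma CM_inner_zero_left: "z \<in> CM_space \<gamma> \<Longrightarrow> CM_inner \<gamma> 0 z = 0"
  using CM_inner_diff_left[OF CM_space_zero CM_space_zero, of z] by simp

lemma CM_inner_sum_left:
  assumes z: "z \<in> CM_space \<gamma>"
  shows "finite I \<Longrightarrow> (\<And>i. i \<in> I \<Longrightarrow> f i \<in> CM_space \<gamma>) \<Longrightarrow>
    CM_inner \<gamma> (\<Sum>i\<in>I. f i) z = (\<Sum>i\<in>I. CM_inner \<gamma> (f i) z)"
proof (induction I rule: finite_induct)
  case (insert i I)
  then show ?case
    using CM_inner_combination[of "f i" "\<Sum>i\<in>I. f i" z 1 1] CM_space_sum[of I f] z by simp
qed (simp add: CM_inner_zero_left z)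

lemma CM_inner_le:
  "h \<in> CM_space \<gamma> \<Longrightarrow> k \<in> CM_space \<gamma> \<Longrightarrow> \<bar>CM_inner \<gamma> h k\<bar> \<le> CM_norm \<gamma> h * CM_norm \<gamma> k"
  unfolding CM_inner_def CM_norm_def by (intro L2_Cauchy_Schwarz CM_hat_L2)

lemma CM_norm_triangle:
  assumes h: "h \<in> CM_space \<gamma>" and k: "k \<in> CM_space \<gamma>"
  shows "CM_norm \<gamma> (h + k) \<le> CM_norm \<gamma> h + CM_norm \<gamma> k"
proof -
  have "CM_norm \<gamma> (h + k) = L2_nrm \<gamma> (\<lambda>x. CM_hat \<gamma> h x + CM_hat \<gamma> k x)"
    unfolding CM_norm_def
    using CM_hat_combination[OF h k, of 1 1]
    by (intro L2_nrm_cong_AE) (auto intro!: L2_measurable CM_hat_L2 L2_add CM_space_add h k)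
  then show ?thesis unfolding CM_norm_def using L2_triangle[OF CM_hat_L2[OF h] CM_hat_L2[OF k]] by simp
qed

lemma CM_norm_sum_le:
  "finite I \<Longrightarrow> (\<And>i. i \<in> I \<Longrightarrow> f i \<in> CM_space \<gamma>) \<Longrightarrow> CM_norm \<gamma> 0 = 0 \<Longrightarrow>
    CM_norm \<gamma> (\<Sum>i\<in>I. f i) \<le> (\<Sum>i\<in>I. CM_norm \<gamma> (f i))"
proof (induction I rule: finite_induct)
  case (insert i I)
  then show ?case using CM_norm_triangle[of "f i" "\<Sum>i\<in>I. f i"] CM_space_sum[of I f] by force
qed simp

text \<open>The covariance operator. Its image is dense in the Cameron-Martin space, and the inner product with the
  image of \<open>l\<close> is evaluation of \<open>l\<close>.\<close>

definition dual_embedding :: "('a \<Rightarrow>\<^sub>L real) \<Rightarrow> 'a" where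
  "dual_embedding l = (\<integral>x. blinfun_apply l x *\<^sub>R x \<partial>\<gamma>)"

lemma dual_embedding_CM: "dual_embedding l \<in> CM_space \<gamma>"
  unfolding dual_embedding_def by (rule barycenter_CM[OF functional_L2])

lemma CM_hat_dual_embedding: "AE x in \<gamma>. CM_hat \<gamma> (dual_embedding l) x = blinfun_apply l x"
  unfolding dual_embedding_def by (rule CM_hat_barycenter_AE[OF functional_dual_closure])

lemma linear_dual_embedding: "linear dual_embedding"
  unfolding dual_embedding_def using L2_barycenter_integrable[OF functional_L2]
  by (intro linearI) (simp_all add: blinfun.add_left blinfun.scaleR_left scaleR_add_left flip: scaleR_scaleR)

lemma CM_inner_dual_embedding:
  assumes k: "k \<in> CM_space \<gamma>"
  shows "CM_inner \<gamma> k (dual_embedding l) = blinfun_apply l k"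
proof -
  have [measurable]: "CM_hat \<gamma> v \<in> borel_measurable \<gamma>" if "v \<in> CM_space \<gamma>" for v
    by (rule L2_measurable[OF CM_hat_L2[OF that]])
  note [measurable] = k dual_embedding_CM[of l]
  show ?thesis unfolding CM_inner_def functional_CM[OF k]
    using CM_hat_dual_embedding[of l] by (intro integral_cong_AE) auto
qed

lemma CM_norm_dual_embedding: "CM_norm \<gamma> (dual_embedding l) = L2_nrm \<gamma> (blinfun_apply l)"
  unfolding CM_norm_def using CM_hat_dual_embedding[of l]
  by (intro L2_nrm_cong_AE L2_measurable CM_hat_L2 dual_embedding_CM functional_L2)

lemma functional_CM_le:
  "k \<in> CM_space \<gamma> \<Longrightarrow> blinfun_apply l k \<le> L2_nrm \<gamma> (blinfun_apply l) * CM_norm \<gamma> k"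
  using CM_inner_le[OF _ dual_embedding_CM, of k l]
  by (simp add: CM_inner_dual_embedding CM_norm_dual_embedding mult.commute)

lemma CM_norm_zero: "CM_norm \<gamma> 0 = 0"
  using CM_norm_dual_embedding[of 0] linear_0[OF linear_dual_embedding] by (simp add: L2_nrm_def)

lemma dual_embedding_dense:
  assumes k: "k \<in> CM_space \<gamma>" and e: "e > 0"
  shows "\<exists>l. CM_norm \<gamma> (k - dual_embedding l) < e"
proof -
  obtain l where l: "L2_nrm \<gamma> (\<lambda>x. CM_hat \<gamma> k x - blinfun_apply l x) < e"
    using dual_closureE[OF CM_hat_dual_closure[OF k] e] .
  have "CM_norm \<gamma> (k - dual_embedding l) = L2_nrm \<gamma> (\<lambda>x. CM_hat \<gamma> k x - blinfun_apply l x)"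
    unfolding CM_norm_def
  proof (rule L2_nrm_cong_AE)
    show "AE x in \<gamma>. CM_hat \<gamma> (k - dual_embedding l) x = CM_hat \<gamma> k x - blinfun_apply l x"
      using CM_hat_combination[OF k dual_embedding_CM[of l], of 1 "-1"] CM_hat_dual_embedding[of l]
      by (simp, eventually_elim) simp
  qed (auto intro!: L2_measurable CM_hat_L2 L2_diff CM_space_diff k dual_embedding_CM functional_L2)
  with l show ?thesis by (intro exI[of _ l]) simp
qed

text \<open>The Cameron-Martin norm is the supremum of the values of functionals in the unit ball of \<open>L\<^sup>2\<close>. This is
  how norms of measures are reduced to real components: a functional \<open>l\<close> close to the representative of \<open>k\<close>
  is normalised.\<close>

lemma CM_norm_approx:
  assumes k: "k \<in> CM_space \<gamma>" and e: "e > 0"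
  shows "\<exists>l. L2_nrm \<gamma> (blinfun_apply l) \<le> 1 \<and> CM_norm \<gamma> k - e \<le> blinfun_apply l k"
proof -
  obtain l where l: "CM_norm \<gamma> (k - dual_embedding l) < e / 2"
    using dual_embedding_dense[OF k, of "e / 2"] e by auto
  define n where "n = L2_nrm \<gamma> (blinfun_apply l)"
  have n0: "0 \<le> n" unfolding n_def by simp
  have near: "CM_norm \<gamma> k - e / 2 \<le> n"
    using CM_norm_triangle[OF CM_space_diff[OF k dual_embedding_CM] dual_embedding_CM, of l l] l
    unfolding n_def CM_norm_dual_embedding[symmetric] by simp
  show ?thesis
  proof (cases "n = 0")
    case True
    then show ?thesis using near e by (intro exI[of _ 0]) (auto simp: L2_nrm_def)
  next
    case False
    then have n: "n > 0" using n0 by simp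
    have "blinfun_apply l (k - dual_embedding l) \<ge> - (n * (e / 2))"
    proof -
      have "blinfun_apply (- l) (k - dual_embedding l) \<le> L2_nrm \<gamma> (blinfun_apply (- l)) * CM_norm \<gamma> (k - dual_embedding l)"
        by (rule functional_CM_le[OF CM_space_diff[OF k dual_embedding_CM]])
      also have "L2_nrm \<gamma> (blinfun_apply (- l)) = n"
        unfolding n_def L2_nrm_def by (simp add: blinfun.minus_left)
      also have "n * CM_norm \<gamma> (k - dual_embedding l) \<le> n * (e / 2)" using l n0 by (intro mult_left_mono) auto
      finally show ?thesis by (simp add: blinfun.minus_left)
    qed
    moreover have "blinfun_apply l (dual_embedding l) = n * n"
      using functional_CM[OF dual_embedding_CM, of l l] CM_inner_dual_embedding[OF dual_embedding_CM, of l l]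
        functional_barycenter[OF functional_L2, of l l] L2_nrm_sq[of \<gamma> "blinfun_apply l"]
      unfolding n_def dual_embedding_def by (simp add: power2_eq_square)
    ultimately have "n * (n - e / 2) \<le> blinfun_apply l k"
      by (simp add: blinfun.diff_right algebra_simps)
    then have "n - e / 2 \<le> blinfun_apply ((1 / n) *\<^sub>R l) k"
      using n by (simp add: blinfun.scaleR_left field_simps)
    moreover have "blinfun_apply ((1 / n) *\<^sub>R l) = (\<lambda>x. (1 / n) * blinfun_apply l x)"
      by (simp add: fun_eq_iff blinfun.scaleR_left)
    then have "L2_nrm \<gamma> (blinfun_apply ((1 / n) *\<^sub>R l)) = 1"
      using L2_nrm_scale[of \<gamma> "1 / n" "blinfun_apply l"] n unfolding n_def[symmetric] by simp
    ultimately show ?thesis using near by (intro exI[of _ "(1 / n) *\<^sub>R l"]) auto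
  qed
qed

text \<open>Representing \<open>\<Psi>\<close> on the image of the dual space is the Riesz theorem there; boundedness and density
  extend the identity to all of the Cameron-Martin space.\<close>

lemma CM_riesz:
  assumes comb: "\<And>a b h k. h \<in> CM_space \<gamma> \<Longrightarrow> k \<in> CM_space \<gamma> \<Longrightarrow> \<Psi> (a *\<^sub>R h + b *\<^sub>R k) = a * \<Psi> h + b * \<Psi> k"
    and bd: "\<And>h. h \<in> CM_space \<gamma> \<Longrightarrow> \<bar>\<Psi> h\<bar> \<le> C * CM_norm \<gamma> h"
  shows "\<exists>k\<in>CM_space \<gamma>. \<forall>h\<in>CM_space \<gamma>. CM_inner \<gamma> k h = \<Psi> h"
proof -
  have lin: "linear (\<lambda>l. \<Psi> (dual_embedding l))"
  proof (rule linearI)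
    show "\<Psi> (dual_embedding (l + l')) = \<Psi> (dual_embedding l) + \<Psi> (dual_embedding l')" for l l'
      using comb[OF dual_embedding_CM dual_embedding_CM, of 1 l 1 l'] by (simp add: linear_add[OF linear_dual_embedding])
    show "\<Psi> (dual_embedding (c *\<^sub>R l)) = c *\<^sub>R \<Psi> (dual_embedding l)" for c l
      using comb[OF dual_embedding_CM dual_embedding_CM, of c l 0 l] by (simp add: linear_cmul[OF linear_dual_embedding])
  qed
  obtain g where g: "g \<in> dual_closure \<gamma>" "\<And>l. (\<integral>x. g x * blinfun_apply l x \<partial>\<gamma>) = \<Psi> (dual_embedding l)"
    using dual_riesz[OF lin, of C] bd[OF dual_embedding_CM] unfolding CM_norm_dual_embedding by blast
  define k where "k = (\<integral>x. g x *\<^sub>R x \<partial>\<gamma>)"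
  have k: "k \<in> CM_space \<gamma>" unfolding k_def by (rule barycenter_CM[OF dual_closureD[OF g(1)]])
  have emb: "CM_inner \<gamma> k (dual_embedding l) = \<Psi> (dual_embedding l)" for l
    unfolding CM_inner_dual_embedding[OF k] unfolding k_def functional_barycenter[OF dual_closureD[OF g(1)]]
    by (rule g(2))
  have "CM_inner \<gamma> k h = \<Psi> h" if h: "h \<in> CM_space \<gamma>" for h
  proof -
    have "\<bar>CM_inner \<gamma> k h - \<Psi> h\<bar> \<le> 0 + e" if e: "e > 0" for e
    proof -
      define c where "c = CM_norm \<gamma> k + \<bar>C\<bar> + 1"
      have c: "c > 0" unfolding c_def using CM_norm_nonneg[of k] by linarith
      obtain l where l: "CM_norm \<gamma> (h - dual_embedding l) < e / c"
        using dual_embedding_dense[OF h, of "e / c"] e c by auto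
      let ?d = "h - dual_embedding l"
      have d: "?d \<in> CM_space \<gamma>" by (rule CM_space_diff[OF h dual_embedding_CM])
      have "CM_inner \<gamma> k h - \<Psi> h = CM_inner \<gamma> k ?d - \<Psi> ?d"
        using CM_inner_diff_left[OF h dual_embedding_CM[of l] k] emb[of l] comb[OF h dual_embedding_CM[of l], of 1 "-1"]
        by (simp add: CM_inner_commute)
      also have "\<bar>\<dots>\<bar> \<le> CM_norm \<gamma> k * CM_norm \<gamma> ?d + C * CM_norm \<gamma> ?d"
        using CM_inner_le[OF k d] bd[OF d] by linarith
      also have "\<dots> \<le> c * CM_norm \<gamma> ?d"
        unfolding c_def distrib_right[symmetric] by (intro mult_right_mono) auto
      also have "\<dots> \<le> e" using l c by (simp add: field_simps)
      finally show ?thesis by simp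
    qed
    then have "\<bar>CM_inner \<gamma> k h - \<Psi> h\<bar> \<le> 0" by (rule field_le_epsilon)
    then show ?thesis by simp
  qed
  with k show ?thesis by blast
qed

end

section \<open>Signed measures\<close>

lemma signed_measure_sums:
  "signed_measure \<mu> \<Longrightarrow> range A \<subseteq> sets borel \<Longrightarrow> disjoint_family A \<Longrightarrow> (\<lambda>n. \<mu> (A n)) sums \<mu> (\<Union>n. A n)"
  unfolding signed_measure_def by blast

lemma signed_measure_empty:
  assumes "signed_measure \<mu>"
  shows "\<mu> {} = 0"
proof -
  have "(\<lambda>n::nat. \<mu> {}) sums \<mu> {}"
    using signed_measure_sums[OF assms, of "\<lambda>_. {}"] by (simp add: disjoint_family_on_def)
  then have "(\<lambda>n::nat. \<mu> {}) \<longlonglongrightarrow> 0" by (intro summable_LIMSEQ_zero sums_summable)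
  then show ?thesis by (simp add: LIMSEQ_const_iff)
qed

lemma signed_measure_Un:
  assumes \<mu>: "signed_measure \<mu>" and A: "A \<in> sets borel" and B: "B \<in> sets borel" and AB: "A \<inter> B = {}"
  shows "\<mu> (A \<union> B) = \<mu> A + \<mu> B"
proof -
  have "(\<lambda>n. \<mu> (binaryset A B n)) sums \<mu> (\<Union>n. binaryset A B n)"
    using A B AB by (intro signed_measure_sums[OF \<mu>]) (auto simp: range_binaryset_eq disjoint_family_on_def binaryset_def)
  moreover have "(\<lambda>n. \<mu> (binaryset A B n)) sums (\<mu> A + \<mu> B)"
    by (rule binaryset_sums) (rule signed_measure_empty[OF \<mu>])
  ultimately show ?thesis unfolding UN_binaryset_eq by (rule sums_unique2)
qed

lemma signed_measure_Diff:
  assumes \<mu>: "signed_measure \<mu>" and A: "A \<in> sets borel" and B: "B \<in> sets borel" and BA: "B \<subseteq> A"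
  shows "\<mu> (A - B) = \<mu> A - \<mu> B"
proof -
  have "B \<union> (A - B) = A" using BA by auto
  then show ?thesis using signed_measure_Un[OF \<mu> B, of "A - B"] A B by simp
qed

lemma signed_measure_uminus: "signed_measure \<mu> \<Longrightarrow> signed_measure (\<lambda>A. - \<mu> A)"
  unfolding signed_measure_def by (auto intro: sums_minus)

text \<open>Truncating at \<open>0\<close>, as \<^const>\<open>ennreal\<close> does, can only increase a sum.\<close>

lemma ennreal_sums_le:
  fixes x :: "nat \<Rightarrow> real"
  assumes "x sums s"
  shows "ennreal s \<le> (\<Sum>n. ennreal (x n))"
proof (rule LIMSEQ_le_const2)
  show "(\<lambda>n. ennreal (\<Sum>i<n. x i)) \<longlonglongrightarrow> ennreal s"
    using assms unfolding sums_def by (rule tendsto_ennrealI)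
  have "ennreal (\<Sum>i<n. x i) \<le> (\<Sum>n. ennreal (x n))" for n
  proof -
    have "ennreal (\<Sum>i<n. x i) \<le> ennreal (\<Sum>i<n. max 0 (x i))" by (intro ennreal_leI sum_mono) auto
    also have "\<dots> = (\<Sum>i<n. ennreal (max 0 (x i)))" by (subst sum_ennreal) auto
    also have "\<dots> = (\<Sum>i<n. ennreal (x i))" by (intro sum.cong) (auto simp: max_def ennreal_neg)
    also have "\<dots> \<le> (\<Sum>n. ennreal (x n))" by (rule sum_le_suminf) auto
    finally show ?thesis .
  qed
  then show "\<exists>N. \<forall>n\<ge>N. ennreal (\<Sum>i<n. x i) \<le> (\<Sum>n. ennreal (x n))" by blast
qed

lemma sets_jordan_pos [measurable_cong, simp]: "sets (jordan_pos \<mu>) = sets borel"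
  unfolding jordan_pos_def using sets.sigma_sets_eq[of borel] by (simp add: sets_measure_of)

lemma space_jordan_pos [simp]: "space (jordan_pos \<mu>) = UNIV"
  using sets_eq_imp_space_eq[OF sets_jordan_pos] by simp

text \<open>For disjoint sets the supremum over subsets of the union splits into the suprema over subsets of the
  pieces, by countable additivity of \<open>\<mu>\<close> in one direction and by joining subsets of the pieces in the other.\<close>

lemma emeasure_jordan_pos:
  fixes \<mu> :: "'a::topological_space set \<Rightarrow> real"
  assumes \<mu>: "signed_measure \<mu>" and A: "A \<in> sets borel"
  shows "emeasure (jordan_pos \<mu>) A = (SUP B\<in>{B \<in> sets borel. B \<subseteq> A}. ennreal (\<mu> B))"
proof -
  define p where "p A = (SUP B\<in>{B \<in> sets borel. B \<subseteq> A}. ennreal (\<mu> B))" for A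
  have p_upper: "ennreal (\<mu> B) \<le> p A" if "B \<in> sets borel" "B \<subseteq> A" for A B
    unfolding p_def using that by (intro SUP_upper) auto
  have p_least: "p A \<le> c" if "\<And>B. B \<in> sets borel \<Longrightarrow> B \<subseteq> A \<Longrightarrow> ennreal (\<mu> B) \<le> c" for A c
    unfolding p_def using that by (intro SUP_least) auto
  have super: "p A + p B \<le> p (A \<union> B)" if AB: "A \<inter> B = {}" for A B
  proof -
    have 1: "ennreal (\<mu> C) + ennreal (\<mu> D) \<le> p (A \<union> B)"
      if C: "C \<in> sets borel" "C \<subseteq> A" and D: "D \<in> sets borel" "D \<subseteq> B" for C D
    proof -
      consider "\<mu> C < 0" | "\<mu> D < 0" | "0 \<le> \<mu> C" "0 \<le> \<mu> D" by linarith
      then show ?thesis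
      proof cases
        case 1 then show ?thesis using p_upper[OF D(1), of "A \<union> B"] D by (auto simp: ennreal_neg)
      next
        case 2 then show ?thesis using p_upper[OF C(1), of "A \<union> B"] C by (auto simp: ennreal_neg)
      next
        case 3
        have "\<mu> (C \<union> D) = \<mu> C + \<mu> D" by (rule signed_measure_Un[OF \<mu>]) (use C D AB in auto)
        then show ?thesis using p_upper[of "C \<union> D" "A \<union> B"] C D 3 by (auto simp: ennreal_plus)
      qed
    qed
    have ne: "{B \<in> sets borel. B \<subseteq> X} \<noteq> {}" for X :: "'a set" by (auto intro: exI[of _ "{}"])
    have 2: "p A + ennreal (\<mu> D) \<le> p (A \<union> B)" if D: "D \<in> sets borel" "D \<subseteq> B" for D
      unfolding p_def[of A] by (subst ennreal_SUP_add_left[OF ne, symmetric]) (auto intro!: SUP_least 1 D)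
    show ?thesis
      unfolding p_def[of B] by (subst ennreal_SUP_add_right[OF ne]) (auto intro!: SUP_least 2)
  qed
  have p_mono: "p A \<le> p B" if "A \<subseteq> B" for A B
    using that by (intro p_least p_upper) auto
  have p_empty: "p {} = 0"
    using p_least[of "{}" 0] signed_measure_empty[OF \<mu>] by (simp add: subset_empty)
  have "emeasure (jordan_pos \<mu>) A = p A"
  proof (rule emeasure_measure_of)
    show "jordan_pos \<mu> = measure_of UNIV (sets borel) p" unfolding jordan_pos_def p_def ..
    show "positive (sets (jordan_pos \<mu>)) p" by (simp add: positive_def p_empty)
    show "countably_additive (sets (jordan_pos \<mu>)) p"
      unfolding countably_additive_def sets_jordan_pos
    proof (intro allI impI antisym)
      fix F :: "nat \<Rightarrow> 'a set" assume F: "range F \<subseteq> sets borel" "disjoint_family F" and UF: "\<Union> (range F) \<in> sets borel"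
      show "(\<Sum>i. p (F i)) \<le> p (\<Union> (range F))"
      proof (rule suminf_le_const[OF summableI])
        fix n
        have "sum (\<lambda>i. p (F i)) {..<n} \<le> p (\<Union>i<n. F i)"
        proof (induction n)
          case (Suc n)
          have "(\<Union>i<n. F i) \<inter> F n = {}"
            using disjoint_family_onD[OF F(2), of _ n] by fastforce
          have "sum (\<lambda>i. p (F i)) {..<Suc n} \<le> p (\<Union>i<n. F i) + p (F n)" using Suc by (simp add: add_right_mono)
          also have "\<dots> \<le> p ((\<Union>i<n. F i) \<union> F n)" by (rule super) fact
          also have "(\<Union>i<n. F i) \<union> F n = (\<Union>i<Suc n. F i)" by (auto simp: lessThan_Suc)
          finally show ?case .
        qed simp
        also have "\<dots> \<le> p (\<Union> (range F))" by (rule p_mono) auto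
        finally show "sum (\<lambda>i. p (F i)) {..<n} \<le> p (\<Union> (range F))" .
      qed
      show "p (\<Union> (range F)) \<le> (\<Sum>i. p (F i))"
      proof (rule p_least)
        fix B assume B: "B \<in> sets borel" "B \<subseteq> \<Union> (range F)"
        have "(\<lambda>i. \<mu> (B \<inter> F i)) sums \<mu> (\<Union>i. B \<inter> F i)"
          using F B by (intro signed_measure_sums[OF \<mu>]) (auto simp: disjoint_family_on_def)
        moreover have "(\<Union>i. B \<inter> F i) = B" using B by auto
        ultimately have "ennreal (\<mu> B) \<le> (\<Sum>i. ennreal (\<mu> (B \<inter> F i)))" using ennreal_sums_le by metis
        also have "\<dots> \<le> (\<Sum>i. p (F i))" using B F by (intro suminf_le p_upper summableI) auto
        finally show "ennreal (\<mu> B) \<le> (\<Sum>i. p (F i))" .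
      qed
    qed
  qed (use A in auto)
  then show ?thesis unfolding p_def .
qed

lemma jordan_pos_upper:
  assumes "signed_measure \<mu>" "B \<in> sets borel" "A \<in> sets borel" "B \<subseteq> A"
  shows "ennreal (\<mu> B) \<le> emeasure (jordan_pos \<mu>) A"
  unfolding emeasure_jordan_pos[OF assms(1,3)] using assms by (intro SUP_upper) auto

text \<open>If the positive part of \<open>X\<close> were infinite, one could repeatedly pass to a subset whose positive part is
  still infinite while removing a piece on which \<open>\<mu>\<close> has absolute value at least \<open>1\<close>. The removed pieces
  are disjoint, so their measures would have to be summable.\<close>

lemma finite_jordan_pos:
  fixes \<mu> :: "'a::topological_space set \<Rightarrow> real"
  assumes \<mu>: "signed_measure \<mu>"
  shows "finite_measure (jordan_pos \<mu>)"
proof (rule finite_measureI, rule notI)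
  let ?p = "emeasure (jordan_pos \<mu>)"
  assume "?p (space (jordan_pos \<mu>)) = \<infinity>"
  then have inf: "?p UNIV = \<infinity>" by simp
  have step: "\<exists>A'. (A' \<in> sets borel \<and> ?p A' = \<infinity>) \<and> A' \<subseteq> A \<and> 1 \<le> \<bar>\<mu> (A - A')\<bar>"
    if A: "A \<in> sets borel" "?p A = \<infinity>" for A
  proof -
    have "ennreal (\<bar>\<mu> A\<bar> + 1) < ?p A" unfolding A(2) by simp
    then obtain B where B: "B \<in> sets borel" "B \<subseteq> A" "ennreal (\<bar>\<mu> A\<bar> + 1) < ennreal (\<mu> B)"
      unfolding emeasure_jordan_pos[OF \<mu> A(1)] by (auto simp: less_SUP_iff)
    then have \<mu>B: "\<bar>\<mu> A\<bar> + 1 < \<mu> B" by (subst (asm) ennreal_less_iff) auto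
    have AB: "A - B \<in> sets borel" using A B by auto
    have "?p A = ?p B + ?p (A - B)"
      using plus_emeasure[of B "jordan_pos \<mu>" "A - B"] A(1) B AB by (simp add: Un_absorb1)
    then have "?p B + ?p (A - B) = top" using A(2) by simp
    then have "?p B = \<infinity> \<or> ?p (A - B) = \<infinity>" unfolding ennreal_add_eq_top by simp
    moreover have "A - (A - B) = B" using B by auto
    ultimately show ?thesis
      using B AB \<mu>B signed_measure_Diff[OF \<mu> A(1) B(1,2)]
      by (elim disjE) (rule exI[of _ B] exI[of _ "A - B"], auto)+
  qed
  have "\<exists>F :: nat \<Rightarrow> 'a set. \<forall>n. (F n \<in> sets borel \<and> ?p (F n) = \<infinity>) \<and> (F (Suc n) \<subseteq> F n \<and> 1 \<le> \<bar>\<mu> (F n - F (Suc n))\<bar>)"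
    by (rule dependent_nat_choice) (use inf step in auto)
  then obtain F :: "nat \<Rightarrow> 'a set" where F: "\<And>n. F n \<in> sets borel" "\<And>n. F (Suc n) \<subseteq> F n"
    "\<And>n. 1 \<le> \<bar>\<mu> (F n - F (Suc n))\<bar>" by blast
  have dec: "F m \<subseteq> F n" if "n \<le> m" for m n
    using that F(2) by (induction rule: dec_induct) auto
  have "disjoint_family (\<lambda>n. F n - F (Suc n))"
    unfolding disjoint_family_on_def
  proof (intro ballI impI)
    have *: "(F m - F (Suc m)) \<inter> (F n - F (Suc n)) = {}" if "m < n" for m n
      using dec[of "Suc m" n] that by auto
    fix m n :: nat assume "m \<noteq> n"
    then show "(F m - F (Suc m)) \<inter> (F n - F (Suc n)) = {}"
      using *[of m n] *[of n m] by (cases "m < n") auto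
  qed
  then have "(\<lambda>n. \<mu> (F n - F (Suc n))) sums \<mu> (\<Union>n. F n - F (Suc n))"
    using F(1) by (intro signed_measure_sums[OF \<mu>]) auto
  then have "(\<lambda>n. \<bar>\<mu> (F n - F (Suc n))\<bar>) \<longlonglongrightarrow> 0"
    by (intro tendsto_rabs_zero summable_LIMSEQ_zero sums_summable)
  then have "(1::real) \<le> 0" by (rule LIMSEQ_le_const) (use F(3) in auto)
  then show False by simp
qed

text \<open>For \<open>B \<subseteq> A\<close> one has \<open>\<mu> B = \<mu> A - \<mu> (A - B)\<close>, so the supremum of \<open>\<mu>\<close> over subsets of \<open>A\<close> is \<open>\<mu> A\<close> plus the
  supremum of \<open>- \<mu>\<close>.\<close>

lemma jordan_decomposition:
  fixes \<mu> :: "'a::topological_space set \<Rightarrow> real"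
  assumes \<mu>: "signed_measure \<mu>" and A: "A \<in> sets borel"
  shows "\<mu> A = measure (jordan_pos \<mu>) A - measure (jordan_pos (\<lambda>A. - \<mu> A)) A"
proof -
  have half: "measure (jordan_pos \<rho>) A \<le> \<rho> A + measure (jordan_pos (\<lambda>A. - \<rho> A)) A"
    if \<rho>: "signed_measure \<rho>" for \<rho> :: "'a set \<Rightarrow> real"
  proof -
    interpret P: finite_measure "jordan_pos \<rho>" by (rule finite_jordan_pos[OF \<rho>])
    interpret N: finite_measure "jordan_pos (\<lambda>A. - \<rho> A)" by (rule finite_jordan_pos[OF signed_measure_uminus[OF \<rho>]])
    let ?c = "\<rho> A + measure (jordan_pos (\<lambda>A. - \<rho> A)) A"
    have le: "\<rho> B \<le> ?c" if B: "B \<in> sets borel" "B \<subseteq> A" for B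
    proof -
      have "ennreal (- \<rho> (A - B)) \<le> ennreal (measure (jordan_pos (\<lambda>A. - \<rho> A)) A)"
        using jordan_pos_upper[OF signed_measure_uminus[OF \<rho>], of "A - B" A] A B by (auto simp: N.emeasure_eq_measure)
      then have "- \<rho> (A - B) \<le> measure (jordan_pos (\<lambda>A. - \<rho> A)) A"
        by (cases "- \<rho> (A - B) \<ge> 0") (auto intro: order_trans[OF _ measure_nonneg])
      then show ?thesis using signed_measure_Diff[OF \<rho> A B] by simp
    qed
    have c0: "0 \<le> ?c" using le[of "{}"] signed_measure_empty[OF \<rho>] by simp
    have "ennreal (measure (jordan_pos \<rho>) A) \<le> ennreal ?c"
      unfolding P.emeasure_eq_measure[symmetric] emeasure_jordan_pos[OF \<rho> A]
      using le by (auto intro!: SUP_least ennreal_leI)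
    then show ?thesis using c0 by simp
  qed
  show ?thesis using half[OF \<mu>] half[OF signed_measure_uminus[OF \<mu>]] by simp
qed

lemma signed_integral_indicator:
  assumes \<mu>: "signed_measure \<mu>" and A: "A \<in> sets borel"
  shows "signed_integral \<mu> (indicat_real A) = \<mu> A"
  unfolding signed_integral_def using jordan_decomposition[OF assms] A by simp

lemma nn_integral_add_measures:
  assumes s: "sets \<alpha> = sets borel" "sets \<beta> = sets borel" "sets \<alpha>' = sets borel" "sets \<beta>' = sets borel"
    and eq: "\<And>A. A \<in> sets borel \<Longrightarrow> emeasure \<alpha> A + emeasure \<beta>' A = emeasure \<alpha>' A + emeasure \<beta> A"
    and f: "f \<in> borel_measurable (borel :: 'a::topological_space measure)"
  shows "(\<integral>\<^sup>+x. f x \<partial>\<alpha>) + (\<integral>\<^sup>+x. f x \<partial>\<beta>') = (\<integral>\<^sup>+x. f x \<partial>\<alpha>') + (\<integral>\<^sup>+x. f x \<partial>\<beta>)"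
  using f
proof (induction rule: borel_measurable_induct)
  note [measurable_cong] = s
  case (cong f g)
  then show ?case by (simp cong: nn_integral_cong)
next
  note [measurable_cong] = s
  case (set A)
  then show ?case using eq by (simp add: s)
next
  note [measurable_cong] = s
  case (mult u c)
  then show ?case by (simp add: nn_integral_cmult flip: distrib_left)
next
  note [measurable_cong] = s
  case (add u v)
  then show ?case by (simp add: nn_integral_add) (metis (no_types, lifting) add.assoc add.left_commute)
next
  note [measurable_cong] = s
  case (seq U)
  have mono: "incseq (\<lambda>i. \<integral>\<^sup>+x. U i x \<partial>M)" for M :: "'a measure"
    using \<open>incseq U\<close> by (auto simp: incseq_def le_fun_def intro!: nn_integral_mono)
  have sup: "(\<integral>\<^sup>+x. (SUP i. U i) x \<partial>M) = (SUP i. \<integral>\<^sup>+x. U i x \<partial>M)" if [measurable_cong]: "sets M = sets borel" for M :: "'a measure"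
  proof -
    have "(\<integral>\<^sup>+x. (SUP i. U i) x \<partial>M) = (\<integral>\<^sup>+x. (SUP i. U i x) \<partial>M)" by (simp add: SUP_apply image_comp)
    also have "\<dots> = (SUP i. \<integral>\<^sup>+x. U i x \<partial>M)"
      using seq by (intro nn_integral_monotone_convergence_SUP) auto
    finally show ?thesis .
  qed
  show ?case unfolding s(1-4)[THEN sup]
    by (simp add: ennreal_SUP_add[OF mono mono, symmetric] seq)
qed

text \<open>The integral may be computed from any representation as a difference of finite measures: moving the
  negative parts to the other side gives an identity between sums of measures, which extends from sets to
  functions.\<close>

lemma signed_integral_diff:
  fixes \<mu> :: "'a::topological_space set \<Rightarrow> real"
  assumes \<mu>: "signed_measure \<mu>"
    and fin: "finite_measure \<alpha>" "finite_measure \<beta>" and s: "sets \<alpha> = sets borel" "sets \<beta> = sets borel"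
    and eq: "\<And>A. A \<in> sets borel \<Longrightarrow> \<mu> A = measure \<alpha> A - measure \<beta> A"
    and f[measurable]: "f \<in> borel_measurable borel" and bd: "bounded (range f)"
  shows "signed_integral \<mu> f = (\<integral>x. f x \<partial>\<alpha>) - (\<integral>x. f x \<partial>\<beta>)"
proof -
  let ?P = "jordan_pos \<mu>" and ?N = "jordan_pos (\<lambda>A. - \<mu> A)"
  note [measurable_cong] = s
  have finP: "finite_measure ?P" and finN: "finite_measure ?N"
    using finite_jordan_pos \<mu> signed_measure_uminus by auto
  obtain c where c: "\<And>x. norm (f x) \<le> c" using bd by (auto simp: bounded_iff)
  have int: "integrable M f" if "finite_measure M" "sets M = sets borel" for M
    using finite_measure.integrable_const_bound[OF that(1), of f c] c that(2) by (simp cong: measurable_cong_sets)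
  have meq: "measure ?P A + measure \<beta> A = measure \<alpha> A + measure ?N A" if "A \<in> sets borel" for A
    using eq[OF that] jordan_decomposition[OF \<mu> that] by simp
  have emeq: "emeasure ?P A + emeasure \<beta> A = emeasure \<alpha> A + emeasure ?N A" if "A \<in> sets borel" for A
    using meq[OF that] unfolding finite_measure.emeasure_eq_measure[OF finP] finite_measure.emeasure_eq_measure[OF finN]
      finite_measure.emeasure_eq_measure[OF fin(1)] finite_measure.emeasure_eq_measure[OF fin(2)]
    by (simp flip: ennreal_plus)
  \<comment> \<open>Adding a bound \<open>c\<close> of \<open>f\<close> makes the integrand nonnegative; the total masses cancel at the end.\<close>
  have nn: "(\<integral>\<^sup>+x. ennreal (f x + c) \<partial>?P) + (\<integral>\<^sup>+x. ennreal (f x + c) \<partial>\<beta>) = (\<integral>\<^sup>+x. ennreal (f x + c) \<partial>\<alpha>) + (\<integral>\<^sup>+x. ennreal (f x + c) \<partial>?N)"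
  proof (rule nn_integral_add_measures[OF sets_jordan_pos sets_jordan_pos s(1) s(2) emeq])
    show "(\<lambda>x. ennreal (f x + c)) \<in> borel_measurable borel"
      by (intro measurable_compose[OF _ measurable_ennreal] borel_measurable_add f borel_measurable_const)
  qed
  have fc: "0 \<le> f x + c" for x using c[of x] by (auto simp: abs_le_iff)
  have val: "(\<integral>\<^sup>+x. ennreal (f x + c) \<partial>M) = ennreal ((\<integral>x. f x \<partial>M) + c * measure M UNIV)"
    and pos: "0 \<le> (\<integral>x. f x \<partial>M) + c * measure M UNIV"
    if M: "finite_measure M" "sets M = sets borel" for M
  proof -
    interpret finite_measure M by fact
    have sp: "space M = UNIV" using sets_eq_imp_space_eq[OF M(2)] by simp
    have *: "(\<integral>x. f x + c \<partial>M) = (\<integral>x. f x \<partial>M) + c * measure M UNIV"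
      using int[OF M] by (simp add: sp)
    show "(\<integral>\<^sup>+x. ennreal (f x + c) \<partial>M) = ennreal ((\<integral>x. f x \<partial>M) + c * measure M UNIV)"
      using int[OF M] fc by (subst nn_integral_eq_integral) (auto simp: sp mult.commute)
    show "0 \<le> (\<integral>x. f x \<partial>M) + c * measure M UNIV"
      unfolding *[symmetric] using fc by simp
  qed
  note P = val[OF finP sets_jordan_pos] pos[OF finP sets_jordan_pos] val[OF finN sets_jordan_pos] pos[OF finN sets_jordan_pos]
    val[OF fin(1) s(1)] pos[OF fin(1) s(1)] val[OF fin(2) s(2)] pos[OF fin(2) s(2)]
  have "(\<integral>x. f x \<partial>?P) + c * measure ?P UNIV + ((\<integral>x. f x \<partial>\<beta>) + c * measure \<beta> UNIV)
    = (\<integral>x. f x \<partial>\<alpha>) + c * measure \<alpha> UNIV + ((\<integral>x. f x \<partial>?N) + c * measure ?N UNIV)"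
    using nn unfolding P(1,3,5,7) using P(2,4,6,8) by (simp flip: ennreal_plus)
  moreover have "c * measure ?P UNIV + c * measure \<beta> UNIV = c * measure \<alpha> UNIV + c * measure ?N UNIV"
    using meq[of UNIV] by (simp flip: distrib_left)
  ultimately show ?thesis unfolding signed_integral_def by simp
qed

lemma signed_measure_diff:
  fixes \<alpha> \<beta> :: "'a::topological_space measure"
  assumes fin: "finite_measure \<alpha>" "finite_measure \<beta>" and s: "sets \<alpha> = sets borel" "sets \<beta> = sets borel"
  shows "signed_measure (\<lambda>A. measure \<alpha> A - measure \<beta> A)"
  unfolding signed_measure_def
proof (intro conjI allI impI)
  fix A :: "'a set" assume "A \<notin> sets borel"
  then show "measure \<alpha> A - measure \<beta> A = 0" using s by (simp add: measure_notin_sets)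
next
  fix A :: "nat \<Rightarrow> 'a set" assume A: "range A \<subseteq> sets borel \<and> disjoint_family A"
  interpret a: finite_measure \<alpha> by fact
  interpret b: finite_measure \<beta> by fact
  show "(\<lambda>n. measure \<alpha> (A n) - measure \<beta> (A n)) sums (measure \<alpha> (\<Union>n. A n) - measure \<beta> (\<Union>n. A n))"
    using A s by (intro sums_diff a.finite_measure_UNION b.finite_measure_UNION) auto
qed

text \<open>The measure \<open>\<rho> + C M\<close> is nonnegative, absolutely continuous and at most \<open>2 C M\<close>; subtracting \<open>C\<close> from its
  Radon-Nikodym density gives the density of \<open>\<rho>\<close>. Truncation makes the bound hold everywhere.\<close>

lemma dominated_signed_density:
  fixes \<rho> :: "'a::topological_space set \<Rightarrow> real"
  assumes fin: "finite_measure M" and s: "sets M = sets borel" and \<rho>: "signed_measure \<rho>"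
    and dom: "\<And>A. A \<in> sets borel \<Longrightarrow> \<bar>\<rho> A\<bar> \<le> C * measure M A" and C: "0 \<le> C"
  shows "\<exists>g\<in>borel_measurable borel. (\<forall>x. \<bar>g x\<bar> \<le> C) \<and> (\<forall>A\<in>sets borel. \<rho> A = (\<integral>x. indicator A x * g x \<partial>M))"
proof -
  interpret M: finite_measure M by fact
  note [measurable_cong] = s
  have sp: "space M = UNIV" using sets_eq_imp_space_eq[OF s] by simp
  define q where "q A = \<rho> A + C * measure M A" for A
  have q0: "0 \<le> q A" if "A \<in> sets borel" for A using dom[OF that] unfolding q_def by (simp add: abs_le_iff)
  define K where "K = measure_of UNIV (sets (borel :: 'a measure)) (\<lambda>A. ennreal (q A))"
  have sK[measurable_cong]: "sets K = sets borel"
    unfolding K_def using sets.sigma_sets_eq[of borel] by (simp add: sets_measure_of)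
  have eK: "emeasure K A = ennreal (q A)" if A: "A \<in> sets borel" for A
  proof (rule emeasure_measure_of[OF K_def])
    show "positive (sets K) (\<lambda>A. ennreal (q A))"
      by (simp add: positive_def q_def signed_measure_empty[OF \<rho>])
    show "countably_additive (sets K) (\<lambda>A. ennreal (q A))"
      unfolding countably_additive_def sK
    proof (intro allI impI)
      fix F :: "nat \<Rightarrow> 'a set" assume F: "range F \<subseteq> sets borel" "disjoint_family F"
      have "(\<lambda>i. q (F i)) sums q (\<Union>i. F i)" unfolding q_def
        using F s by (intro sums_add sums_mult signed_measure_sums[OF \<rho>] M.finite_measure_UNION) auto
      then show "(\<Sum>i. ennreal (q (F i))) = ennreal (q (\<Union> (range F)))"
        using F q0 by (subst suminf_ennreal2) (auto simp: sums_iff)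
    qed
  qed (use A sK in auto)
  have "absolutely_continuous M K"
  proof (unfold absolutely_continuous_def, rule subsetI)
    fix A assume "A \<in> null_sets M"
    then have A: "A \<in> sets borel" "measure M A = 0" using s by (auto simp: null_sets_def measure_def)
    then have "q A = 0" using dom[OF A(1)] unfolding q_def by simp
    then show "A \<in> null_sets K" using A eK sK by auto
  qed
  then obtain f where f[measurable]: "f \<in> borel_measurable M" and K: "density M f = K"
    using M.Radon_Nikodym[of K] s sK by auto
  have fK: "(\<integral>\<^sup>+x. f x * indicator A x \<partial>M) = ennreal (q A)" if "A \<in> sets borel" for A
    using that s eK unfolding K[symmetric] by (simp add: emeasure_density)
  have fint: "(\<integral>\<^sup>+x. f x \<partial>M) = ennreal (q UNIV)" using fK[of UNIV] by simp
  then have ffin: "AE x in M. f x \<noteq> \<infinity>" by (intro nn_integral_PInf_AE) auto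
  define r where "r x = enn2real (f x)" for x
  have r[measurable]: "r \<in> borel_measurable M" unfolding r_def by measurable
  have fr: "AE x in M. f x = ennreal (r x)"
    using ffin by eventually_elim (auto simp: r_def less_top[symmetric] ennreal_enn2real_if)
  have r0: "0 \<le> r x" for x unfolding r_def by simp
  have rA: "integrable M (\<lambda>x. indicator A x * r x)" "(\<integral>x. indicator A x * r x \<partial>M) = q A" if A: "A \<in> sets borel" for A
  proof -
    have "(\<integral>\<^sup>+x. ennreal (indicator A x * r x) \<partial>M) = (\<integral>\<^sup>+x. f x * indicator A x \<partial>M)"
      by (rule nn_integral_cong_AE) (use fr in eventually_elim, auto simp: indicator_def)
    then have "(\<integral>\<^sup>+x. ennreal (indicator A x * r x) \<partial>M) = ennreal (q A)" using fK[OF A] by simp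
    then show "integrable M (\<lambda>x. indicator A x * r x)" "(\<integral>x. indicator A x * r x \<partial>M) = q A"
      using A q0[OF A] r0 by (auto simp: nn_integral_eq_integrable[of _ _ "q A"])
  qed
  have intr: "integrable M r" using rA(1)[of UNIV] by simp
  define S where "S = {x. 2 * C < r x}"
  have S: "S \<in> sets borel" unfolding S_def using measurable_cong_sets[OF s refl, of borel] r by measurable
  have "AE x in M. indicator S x * (r x - 2 * C) = 0"
  proof (rule integral_nonneg_eq_0_iff_AE[THEN iffD1])
    have *: "indicator S x * (r x - 2 * C) = indicator S x * r x - (2 * C) * indicator S x" for x
      by (simp add: algebra_simps)
    have i: "integrable M (\<lambda>x. indicator S x * r x)" "integrable M (\<lambda>x. (2 * C) * indicat_real S x)"
      using rA(1)[OF S] S s by (auto simp: M.emeasure_eq_measure)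
    show int: "integrable M (\<lambda>x. indicator S x * (r x - 2 * C))" unfolding * by (rule Bochner_Integration.integrable_diff[OF i])
    show ge: "AE x in M. 0 \<le> indicator S x * (r x - 2 * C)" by (auto simp: S_def indicator_def)
    have "(\<integral>x. indicator S x * (r x - 2 * C) \<partial>M) = q S - 2 * C * measure M S"
      unfolding * Bochner_Integration.integral_diff[OF i] using rA(2)[OF S] S s by simp
    also have "\<dots> \<le> 0" using dom[OF S] unfolding q_def by (simp add: abs_le_iff)
    finally show "(\<integral>x. indicator S x * (r x - 2 * C) \<partial>M) = 0"
      using integral_nonneg_AE[OF ge] by linarith
  qed
  then have rle: "AE x in M. r x \<le> 2 * C"
    by eventually_elim (auto simp: S_def indicator_def split: if_splits)
  define g where "g x = min (r x - C) C" for x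
  have g[measurable]: "g \<in> borel_measurable borel"
    using r unfolding g_def measurable_cong_sets[OF s refl] by measurable
  have gr: "AE x in M. g x = r x - C" using rle unfolding g_def by eventually_elim auto
  have "\<rho> A = (\<integral>x. indicator A x * g x \<partial>M)" if A: "A \<in> sets borel" for A
  proof -
    have "(\<integral>x. indicator A x * g x \<partial>M) = (\<integral>x. indicator A x * r x - C * indicator A x \<partial>M)"
    proof (rule integral_cong_AE)
      show "AE x in M. indicator A x * g x = indicator A x * r x - C * indicator A x"
        using gr by eventually_elim (simp add: indicator_def)
    qed (use A in measurable)
    also have "\<dots> = q A - C * measure M A"
      using rA[OF A] A s by (subst Bochner_Integration.integral_diff) (auto simp: M.emeasure_eq_measure)
    finally show ?thesis unfolding q_def by simp
  qed
  moreover have "\<bar>g x\<bar> \<le> C" for x unfolding g_def using r0[of x] C by (auto simp: abs_le_iff min_def)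
  ultimately show ?thesis using g by blast
qed

lemma signed_integral_density:
  fixes \<rho> :: "'a::topological_space set \<Rightarrow> real"
  assumes fin: "finite_measure M" and s: "sets M = sets borel" and \<rho>: "signed_measure \<rho>"
    and g[measurable]: "g \<in> borel_measurable borel" and gC: "\<And>x. \<bar>g x\<bar> \<le> C"
    and \<rho>g: "\<And>A. A \<in> sets borel \<Longrightarrow> \<rho> A = (\<integral>x. indicator A x * g x \<partial>M)"
    and f[measurable]: "f \<in> borel_measurable borel" and bd: "bounded (range f)"
  shows "signed_integral \<rho> f = (\<integral>x. f x * g x \<partial>M)"
proof -
  interpret M: finite_measure M by fact
  note [measurable_cong] = s
  have sp: "space M = UNIV" using sets_eq_imp_space_eq[OF s] by simp
  obtain c where c: "\<And>x. norm (f x) \<le> c" using bd by (auto simp: bounded_iff)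
  define D where "D u = density M (\<lambda>x. ennreal (u x))" for u :: "'a \<Rightarrow> real"
  have intM: "integrable M u" if "u \<in> borel_measurable borel" "\<And>x. \<bar>u x\<bar> \<le> b" for u :: "'a \<Rightarrow> real" and b
    using M.integrable_const_bound[of u b] that by (auto cong: measurable_cong_sets simp: s)
  have finD: "finite_measure (D u)" if u[measurable]: "u \<in> borel_measurable borel" and b: "\<And>x. \<bar>u x\<bar> \<le> b" and u0: "\<And>x. 0 \<le> u x" for u b
  proof (rule finite_measureI)
    have "emeasure (D u) (space (D u)) = (\<integral>\<^sup>+x. ennreal (u x) \<partial>M)"
      unfolding D_def by (simp add: emeasure_density sp s)
    also have "\<dots> = ennreal (\<integral>x. u x \<partial>M)"
      using intM[OF u b] u0 by (intro nn_integral_eq_integral) auto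
    finally show "emeasure (D u) (space (D u)) \<noteq> \<infinity>" by simp
  qed
  have intD: "(\<integral>x. v x \<partial>D u) = (\<integral>x. v x * u x \<partial>M)"
    if [measurable]: "u \<in> borel_measurable borel" "v \<in> borel_measurable borel" and "\<And>x. 0 \<le> u x" for u v
    unfolding D_def using that by (subst integral_density) (auto simp: mult.commute)
  have sD: "sets (D u) = sets borel" for u unfolding D_def using s by simp
  define gp where "gp x = max 0 (g x)" for x
  define gn where "gn x = max 0 (- g x)" for x
  have gpm[measurable]: "gp \<in> borel_measurable borel" unfolding gp_def by measurable
  have gnm[measurable]: "gn \<in> borel_measurable borel" unfolding gn_def by measurable
  have gp: "\<bar>gp x\<bar> \<le> C" "0 \<le> gp x" for x using gC[of x] unfolding gp_def by auto
  have gn: "\<bar>gn x\<bar> \<le> C" "0 \<le> gn x" for x using gC[of x] unfolding gn_def by auto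
  have gg: "g x = gp x - gn x" for x unfolding gp_def gn_def by auto
  have C: "0 \<le> C" using gC[of undefined] by linarith
  have int2: "integrable M (\<lambda>x. v x * u x)"
    if [measurable]: "u \<in> borel_measurable borel" "v \<in> borel_measurable borel" and b: "\<And>x. \<bar>u x\<bar> \<le> C" "\<And>x. \<bar>v x\<bar> \<le> d" for u v and d :: real
    by (rule intM[of _ "d * C"]) (measurable, simp add: abs_mult, intro mult_mono b, use b(2) order_trans[OF abs_ge_zero] in auto)
  have split: "(\<integral>x. v x * g x \<partial>M) = (\<integral>x. v x \<partial>D gp) - (\<integral>x. v x \<partial>D gn)"
    if v[measurable]: "v \<in> borel_measurable borel" and d: "\<And>x. \<bar>v x\<bar> \<le> d" for v d
    unfolding intD[OF gpm v gp(2)] intD[OF gnm v gn(2)] gg right_diff_distrib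
    by (intro Bochner_Integration.integral_diff int2[where d = d] gp gn d gpm gnm v)
  have "signed_integral \<rho> f = (\<integral>x. f x \<partial>D gp) - (\<integral>x. f x \<partial>D gn)"
  proof (rule signed_integral_diff[OF \<rho> finD[OF gpm gp] finD[OF gnm gn] sD sD _ f bd])
    fix A :: "'a set" assume A: "A \<in> sets borel"
    have "\<rho> A = (\<integral>x. indicator A x \<partial>D gp) - (\<integral>x. indicator A x \<partial>D gn)"
      unfolding \<rho>g[OF A] by (rule split[of _ 1]) (use A in \<open>auto simp: indicator_def\<close>)
    then show "\<rho> A = measure (D gp) A - measure (D gn) A" using A by (simp add: sD)
  qed
  also have "\<dots> = (\<integral>x. f x * g x \<partial>M)" by (rule split[symmetric, of _ c]) (use c in auto)
  finally show ?thesis .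
qed

section \<open>The Ornstein-Uhlenbeck semigroup and its dual\<close>

lemma measure_signed_measure:
  assumes "finite_measure M" "sets M = sets borel"
  shows "signed_measure (measure M)"
proof -
  have "signed_measure (\<lambda>A. measure M A - measure (null_measure borel) A)"
    by (rule signed_measure_diff[OF assms(1) _ assms(2)]) (auto intro: finite_measureI)
  then show ?thesis by simp
qed

lemma signed_integral_measure:
  assumes M: "finite_measure M" "sets M = sets borel"
    and f: "f \<in> borel_measurable borel" "bounded (range f)"
  shows "signed_integral (measure M) f = (\<integral>x. f x \<partial>M)"
  using signed_integral_diff[OF measure_signed_measure[OF M] M(1) _ M(2) _ _ f, of "null_measure borel"]
  by (simp add: finite_measureI)

context centered_gaussian
begin

definition mehler :: "real \<Rightarrow> 'a \<times> 'a \<Rightarrow> 'a" where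
  "mehler t = (\<lambda>(x, y). exp (- t) *\<^sub>R x + sqrt (1 - exp (- 2 * t)) *\<^sub>R y)"

text \<open>The dual semigroup on positive measures, as an image measure: the law of \<open>e\<^bsup>-t\<^esup> x + \<surd>(1 - e\<^bsup>-2t\<^esup>) y\<close> for \<open>x\<close>
  distributed according to \<open>M\<close> and an independent \<open>y\<close> distributed according to \<open>\<gamma>\<close>.\<close>

definition OU_push :: "real \<Rightarrow> 'a measure \<Rightarrow> 'a measure" where
  "OU_push t M = distr (M \<Otimes>\<^sub>M \<gamma>) borel (mehler t)"

lemma measurable_mehler [measurable]: "mehler t \<in> borel \<Otimes>\<^sub>M borel \<rightarrow>\<^sub>M borel"
  unfolding mehler_def by measurable

lemma measurable_OU [measurable]:
  assumes [measurable]: "f \<in> borel_measurable borel"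
  shows "OU \<gamma> t f \<in> borel_measurable borel"
proof -
  have "OU \<gamma> t f = (\<lambda>x. \<integral>y. f (mehler t (x, y)) \<partial>\<gamma>)" by (simp add: OU_def mehler_def fun_eq_iff)
  then show ?thesis by simp
qed

lemma prob_UNIV [simp]: "prob UNIV = 1"
  using prob_space by simp

lemma OU_integrable:
  fixes f :: "'a \<Rightarrow> real"
  assumes [measurable]: "f \<in> borel_measurable borel" and "\<And>x. \<bar>f x\<bar> \<le> c"
  shows "integrable \<gamma> (\<lambda>y. f (exp (- t) *\<^sub>R x + sqrt (1 - exp (- 2 * t)) *\<^sub>R y))"
  by (rule integrable_const_bound[of _ c]) (use assms(2) in auto)

lemma OU_mono:
  assumes "f \<in> borel_measurable borel" "\<And>x. \<bar>f x\<bar> \<le> c" "g \<in> borel_measurable borel" "\<And>x. \<bar>g x\<bar> \<le> d"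
    and "\<And>x. f x \<le> g x"
  shows "OU \<gamma> t f x \<le> OU \<gamma> t g x"
  unfolding OU_def by (intro integral_mono OU_integrable[OF assms(1,2)] OU_integrable[OF assms(3,4)] assms(5))

lemma OU_const: "OU \<gamma> t (\<lambda>_. c) x = c"
  unfolding OU_def by (simp add: prob_space)

lemma OU_abs_le:
  assumes "f \<in> borel_measurable borel" "\<And>x. \<bar>f x\<bar> \<le> c"
  shows "\<bar>OU \<gamma> t f x\<bar> \<le> c"
proof -
  have c: "f x \<le> c" "- c \<le> f x" "0 \<le> c" for x using assms(2)[of x] by auto
  have "OU \<gamma> t f x \<le> OU \<gamma> t (\<lambda>_. c) x" "OU \<gamma> t (\<lambda>_. - c) x \<le> OU \<gamma> t f x"
    by (rule OU_mono[where c = c and d = c]; use assms c in auto)+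
  then show ?thesis by (simp add: OU_const abs_le_iff)
qed

lemma OU_bounded:
  assumes "f \<in> borel_measurable borel" "bounded (range f)"
  shows "bounded (range (OU \<gamma> t f))"
proof -
  obtain c where "\<And>x. \<bar>f x\<bar> \<le> c" using assms(2) by (auto simp: bounded_iff)
  then show ?thesis using OU_abs_le[OF assms(1), of c t] by (auto simp: bounded_iff)
qed

lemma sets_OU_push [measurable_cong, simp]: "sets (OU_push t M) = sets borel"
  unfolding OU_push_def by simp

context
  fixes M :: "'a measure"
  assumes fin: "finite_measure M" and s: "sets M = sets borel"
begin

lemma finite_pair_gaussian: "finite_measure (M \<Otimes>\<^sub>M \<gamma>)"
proof (rule finite_measureI)
  interpret M: finite_measure M by (rule fin)
  have "emeasure (M \<Otimes>\<^sub>M \<gamma>) (space M \<times> space \<gamma>) = emeasure M (space M) * emeasure \<gamma> (space \<gamma>)"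
    by (rule emeasure_pair_measure_Times) auto
  then show "emeasure (M \<Otimes>\<^sub>M \<gamma>) (space (M \<Otimes>\<^sub>M \<gamma>)) \<noteq> \<infinity>"
    using emeasure_space_1 by (simp add: space_pair_measure)
qed

lemma finite_OU_push: "finite_measure (OU_push t M)"
proof -
  note [measurable_cong] = s
  show ?thesis
    unfolding OU_push_def by (rule finite_measure.finite_measure_distr[OF finite_pair_gaussian]) measurable
qed

lemma integral_OU_push:
  assumes f[measurable]: "f \<in> borel_measurable borel" and bd: "\<And>x. \<bar>f x\<bar> \<le> (c::real)"
  shows "(\<integral>x. f x \<partial>OU_push t M) = (\<integral>x. OU \<gamma> t f x \<partial>M)"
proof -
  interpret M: finite_measure M by (rule fin)
  interpret P: pair_sigma_finite M \<gamma> ..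
  note [measurable_cong] = s
  interpret PF: finite_measure "M \<Otimes>\<^sub>M \<gamma>" by (rule finite_pair_gaussian)
  have "(\<integral>x. f x \<partial>OU_push t M) = (\<integral>z. f (mehler t z) \<partial>(M \<Otimes>\<^sub>M \<gamma>))"
    unfolding OU_push_def by (rule integral_distr) measurable
  also have "\<dots> = (\<integral>x. \<integral>y. f (mehler t (x, y)) \<partial>\<gamma> \<partial>M)"
    by (rule P.integral_fst'[symmetric], rule PF.integrable_const_bound[of _ c]) (use bd in auto)
  also have "\<dots> = (\<integral>x. OU \<gamma> t f x \<partial>M)" by (simp add: OU_def mehler_def)
  finally show ?thesis .
qed

end

text \<open>The image measures of the two Jordan parts of \<open>\<mu>\<close> have the required difference.\<close>

lemma OU_dual_exists:
  fixes \<mu> :: "'a set \<Rightarrow> real"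
  assumes \<mu>: "signed_measure \<mu>"
  shows "\<exists>\<rho>. signed_measure \<rho> \<and> (\<forall>\<phi>\<in>borel_measurable borel. bounded (range \<phi>) \<longrightarrow>
        signed_integral \<rho> \<phi> = signed_integral \<mu> (OU \<gamma> t \<phi>))"
proof -
  define \<alpha> where "\<alpha> = jordan_pos \<mu>"
  define \<beta> where "\<beta> = jordan_pos (\<lambda>A. - \<mu> A)"
  have s: "sets \<alpha> = sets borel" "sets \<beta> = sets borel" unfolding \<alpha>_def \<beta>_def by simp_all
  have fin: "finite_measure \<alpha>" "finite_measure \<beta>"
    unfolding \<alpha>_def \<beta>_def using finite_jordan_pos \<mu> signed_measure_uminus by auto
  define \<rho> where "\<rho> A = measure (OU_push t \<alpha>) A - measure (OU_push t \<beta>) A" for A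
  note f = finite_OU_push[OF fin(1) s(1), of t] finite_OU_push[OF fin(2) s(2), of t]
  have \<rho>: "signed_measure \<rho>" unfolding \<rho>_def by (rule signed_measure_diff[OF f]) simp_all
  have "signed_integral \<rho> \<phi> = signed_integral \<mu> (OU \<gamma> t \<phi>)"
    if m: "\<phi> \<in> borel_measurable borel" and bd: "bounded (range \<phi>)" for \<phi>
  proof -
    obtain c where c: "\<And>x. \<bar>\<phi> x\<bar> \<le> c" using bd by (auto simp: bounded_iff)
    have "signed_integral \<rho> \<phi> = (\<integral>x. \<phi> x \<partial>OU_push t \<alpha>) - (\<integral>x. \<phi> x \<partial>OU_push t \<beta>)"
      by (rule signed_integral_diff[OF \<rho> f _ _ _ m bd]) (simp_all add: \<rho>_def)
    then show ?thesis
      unfolding integral_OU_push[OF fin(1) s(1) m c] integral_OU_push[OF fin(2) s(2) m c]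
      by (simp add: signed_integral_def \<alpha>_def \<beta>_def)
  qed
  with \<rho> show ?thesis by blast
qed

lemma OU_dual:
  fixes \<mu> :: "'a set \<Rightarrow> real"
  assumes \<mu>: "signed_measure \<mu>"
  shows OU_dual_signed_measure: "signed_measure (OU_dual \<gamma> t \<mu>)"
    and OU_dual_eq: "A \<in> sets borel \<Longrightarrow> OU_dual \<gamma> t \<mu> A = signed_integral \<mu> (OU \<gamma> t (indicat_real A))"
proof -
  have *: "signed_measure (OU_dual \<gamma> t \<mu>) \<and> (\<forall>\<phi>\<in>borel_measurable borel. bounded (range \<phi>) \<longrightarrow>
        signed_integral (OU_dual \<gamma> t \<mu>) \<phi> = signed_integral \<mu> (OU \<gamma> t \<phi>))"
    unfolding OU_dual_def by (rule someI_ex[OF OU_dual_exists[OF \<mu>]])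
  then show sm: "signed_measure (OU_dual \<gamma> t \<mu>)" by blast
  assume A: "A \<in> sets borel"
  have "bounded (range (indicat_real A))" by (auto simp: bounded_iff indicator_def intro!: exI[of _ 1])
  then show "OU_dual \<gamma> t \<mu> A = signed_integral \<mu> (OU \<gamma> t (indicat_real A))"
    using * A signed_integral_indicator[OF sm A] by auto
qed

lemma OU_dual_pos_eq:
  assumes fin: "finite_measure M" and s: "sets M = sets borel"
  shows "OU_dual_pos \<gamma> t M = OU_push t M"
proof -
  interpret P: finite_measure "OU_push t M" by (rule finite_OU_push[OF fin s])
  have "OU_dual \<gamma> t (measure M) A = measure (OU_push t M) A" if A: "A \<in> sets borel" for A
  proof -
    have ind: "indicat_real A \<in> borel_measurable borel" "bounded (range (indicat_real A))"
      using A by (auto simp: bounded_iff indicator_def intro!: exI[of _ 1])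
    have "OU_dual \<gamma> t (measure M) A = (\<integral>x. OU \<gamma> t (indicat_real A) x \<partial>M)"
      unfolding OU_dual_eq[OF measure_signed_measure[OF fin s] A]
      by (intro signed_integral_measure[OF fin s] measurable_OU OU_bounded ind)
    also have "\<dots> = (\<integral>x. indicator A x \<partial>OU_push t M)"
      by (rule integral_OU_push[OF fin s ind(1), of 1, symmetric]) (auto simp: indicator_def)
    finally show ?thesis using A by simp
  qed
  then have "OU_dual_pos \<gamma> t M = measure_of UNIV (sets borel) (emeasure (OU_push t M))"
    unfolding OU_dual_pos_def using sets.sigma_sets_eq[of "borel :: 'a measure"]
    by (intro measure_of_eq) (auto simp: P.emeasure_eq_measure)
  also have "\<dots> = OU_push t M"
    using measure_of_of_measure[of "OU_push t M"] by (simp add: OU_push_def)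
  finally show ?thesis .
qed

end

section \<open>The total variation measure\<close>

lemma sets_total_variation [measurable_cong, simp]: "sets (total_variation \<gamma> \<nu>) = sets borel"
  unfolding total_variation_def using sets.sigma_sets_eq[of borel] by (simp add: sets_measure_of)

lemma space_total_variation [simp]: "space (total_variation \<gamma> \<nu>) = UNIV"
  using sets_eq_imp_space_eq[OF sets_total_variation] by simp

lemma suminf_swap_ennreal:
  fixes f :: "nat \<Rightarrow> nat \<Rightarrow> ennreal"
  shows "(\<Sum>i. \<Sum>j. f i j) = (\<Sum>j. \<Sum>i. f i j)"
proof -
  have "(\<Sum>i. \<Sum>j. f i j) = (\<integral>\<^sup>+i. (\<Sum>j. f i j) \<partial>count_space UNIV)" by (simp add: nn_integral_count_space_nat)
  also have "\<dots> = (\<Sum>j. \<integral>\<^sup>+i. f i j \<partial>count_space UNIV)" by (rule nn_integral_suminf) simp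
  finally show ?thesis by (simp add: nn_integral_count_space_nat)
qed

text \<open>The set function is superadditive because partitions of disjoint sets can be interleaved. It is countably
  subadditive because a partition of a union can be intersected with the pieces, where countable
  subadditivity of the norm enters.\<close>

lemma emeasure_total_variation:
  fixes \<nu> :: "'a::{banach, second_countable_topology} set \<Rightarrow> 'a"
  assumes sub: "\<And>F :: nat \<Rightarrow> 'a set. range F \<subseteq> sets borel \<Longrightarrow> disjoint_family F \<Longrightarrow>
      ennreal (CM_norm \<gamma> (\<nu> (\<Union>i. F i))) \<le> (\<Sum>i. ennreal (CM_norm \<gamma> (\<nu> (F i))))"
    and empty: "CM_norm \<gamma> (\<nu> {}) = 0"
    and A: "A \<in> sets borel"
  shows "emeasure (total_variation \<gamma> \<nu>) A =
    (SUP P\<in>{P :: nat \<Rightarrow> 'a set. range P \<subseteq> sets borel \<and> disjoint_family P \<and> (\<Union>i. P i) = A}.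
        \<Sum>i. ennreal (CM_norm \<gamma> (\<nu> (P i))))"
proof -
  define N where "N A = ennreal (CM_norm \<gamma> (\<nu> A))" for A
  define parts where "parts A = {P :: nat \<Rightarrow> 'a set. range P \<subseteq> sets borel \<and> disjoint_family P \<and> (\<Union>i. P i) = A}" for A
  define tv where "tv A = (SUP P\<in>parts A. \<Sum>i. N (P i))" for A
  have N0: "N {} = 0" unfolding N_def empty by simp
  have triv: "binaryset A {} \<in> parts A" if "A \<in> sets borel" for A
    using that unfolding parts_def by (auto simp: range_binaryset_eq UN_binaryset_eq disjoint_family_on_def binaryset_def)
  have upper: "(\<Sum>i. N (P i)) \<le> tv A" if "P \<in> parts A" for P A
    unfolding tv_def using that by (rule SUP_upper)
  have least: "tv A \<le> c" if "\<And>P. P \<in> parts A \<Longrightarrow> (\<Sum>i. N (P i)) \<le> c" for A c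
    unfolding tv_def using that by (rule SUP_least)
  have single: "N A \<le> tv A" if A: "A \<in> sets borel" for A
  proof -
    have "sum (\<lambda>i. N (binaryset A {} i)) {0} \<le> (\<Sum>i. N (binaryset A {} i))" by (rule sum_le_suminf) auto
    then show ?thesis using upper[OF triv[OF A]] by (simp add: binaryset_def)
  qed
  have super: "tv A + tv B \<le> tv (A \<union> B)" if A: "A \<in> sets borel" and B: "B \<in> sets borel" and AB: "A \<inter> B = {}" for A B
  proof -
    have 1: "(\<Sum>i. N (P i)) + (\<Sum>i. N (Q i)) \<le> tv (A \<union> B)" if P: "P \<in> parts A" and Q: "Q \<in> parts B" for P Q
    proof -
      define R where "R n = (if even n then P (n div 2) else Q (n div 2))" for n
      have PQ: "range P \<subseteq> sets borel" "disjoint_family P" "(\<Union>i. P i) = A"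
        "range Q \<subseteq> sets borel" "disjoint_family Q" "(\<Union>i. Q i) = B"
        using P Q unfolding parts_def by auto
      have Rsub: "R n \<subseteq> (if even n then A else B)" for n unfolding R_def using PQ by auto
      have "R m \<inter> R n = {}" if "m \<noteq> n" for m n
      proof (cases "even m = even n")
        case False
        then show ?thesis using Rsub[of m] Rsub[of n] AB by (auto split: if_splits)
      next
        case True
        then have "m div 2 \<noteq> n div 2" using that by presburger
        then have "P (m div 2) \<inter> P (n div 2) = {}" "Q (m div 2) \<inter> Q (n div 2) = {}"
          using PQ(2,5) by (auto simp: disjoint_family_on_def)
        then show ?thesis using True by (simp add: R_def)
      qed
      moreover have "(\<Union>n. R n) = A \<union> B"
      proof
        show "(\<Union>n. R n) \<subseteq> A \<union> B" using Rsub by (force split: if_splits)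
        have "P i \<subseteq> R (2 * i)" "Q i \<subseteq> R (2 * i + 1)" for i unfolding R_def by simp_all
        then show "A \<union> B \<subseteq> (\<Union>n. R n)" unfolding PQ(3,6)[symmetric] by blast
      qed
      ultimately have "R \<in> parts (A \<union> B)"
        unfolding parts_def disjoint_family_on_def using PQ(1,4) by (auto simp: R_def)
      have part: "(\<Sum>i<n. N (P i) + N (Q i)) = (\<Sum>i<2 * n. N (R i))" for n
        by (induction n) (simp_all add: R_def add.assoc)
      have "(\<Sum>i. N (P i)) + (\<Sum>i. N (Q i)) = (\<Sum>i. N (P i) + N (Q i))"
        by (rule suminf_add) auto
      also have "\<dots> \<le> (\<Sum>i. N (R i))"
        by (rule suminf_le_const[OF summableI]) (unfold part, rule sum_le_suminf, auto)
      also have "\<dots> \<le> tv (A \<union> B)" by (rule upper) fact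
      finally show ?thesis .
    qed
    have ne: "parts X \<noteq> {}" if "X \<in> sets borel" for X using triv[OF that] by auto
    have 2: "tv A + (\<Sum>i. N (Q i)) \<le> tv (A \<union> B)" if Q: "Q \<in> parts B" for Q
      unfolding tv_def[of A] by (subst ennreal_SUP_add_left[OF ne[OF A], symmetric]) (auto intro!: SUP_least 1 Q)
    show ?thesis
      unfolding tv_def[of B] by (subst ennreal_SUP_add_right[OF ne[OF B]]) (auto intro!: SUP_least 2)
  qed
  have tv_empty: "tv {} = 0"
  proof -
    have "tv {} \<le> 0"
    proof (rule least)
      fix P assume "P \<in> parts {}"
      then have "P i = {}" for i unfolding parts_def by auto
      then show "(\<Sum>i. N (P i)) \<le> 0" by (simp add: N0)
    qed
    then show ?thesis by simp
  qed
  have mono: "tv A \<le> tv B" if "A \<in> sets borel" "B \<in> sets borel" "A \<subseteq> B" for A B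
  proof -
    have "tv A + tv (B - A) \<le> tv (A \<union> (B - A))" by (rule super) (use that in auto)
    also have "A \<union> (B - A) = B" using that by auto
    finally show ?thesis by (meson le_iff_add order_trans)
  qed
  have "emeasure (total_variation \<gamma> \<nu>) A = tv A"
  proof (rule emeasure_measure_of)
    show "total_variation \<gamma> \<nu> = measure_of UNIV (sets borel) tv"
      unfolding total_variation_def tv_def parts_def N_def ..
    show "positive (sets (total_variation \<gamma> \<nu>)) tv" by (simp add: positive_def tv_empty)
    show "countably_additive (sets (total_variation \<gamma> \<nu>)) tv"
      unfolding countably_additive_def sets_total_variation
    proof (intro allI impI antisym)
      fix F :: "nat \<Rightarrow> 'a set" assume F: "range F \<subseteq> sets borel" "disjoint_family F" and UF: "\<Union> (range F) \<in> sets borel"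
      have Fb: "F i \<in> sets borel" for i using F(1) by auto
      show "(\<Sum>i. tv (F i)) \<le> tv (\<Union> (range F))"
      proof (rule suminf_le_const[OF summableI])
        fix n
        have "sum (\<lambda>i. tv (F i)) {..<n} \<le> tv (\<Union>i<n. F i)"
        proof (induction n)
          case (Suc n)
          have disj: "(\<Union>i<n. F i) \<inter> F n = {}"
            using disjoint_family_onD[OF F(2), of _ n] by fastforce
          have "sum (\<lambda>i. tv (F i)) {..<Suc n} \<le> tv (\<Union>i<n. F i) + tv (F n)" using Suc by (simp add: add_right_mono)
          also have "\<dots> \<le> tv ((\<Union>i<n. F i) \<union> F n)" by (rule super[OF _ Fb disj]) (use Fb in auto)
          also have "(\<Union>i<n. F i) \<union> F n = (\<Union>i<Suc n. F i)" by (auto simp: lessThan_Suc)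
          finally show ?case .
        qed simp
        also have "\<dots> \<le> tv (\<Union> (range F))" by (rule mono) (use UF Fb in auto)
        finally show "sum (\<lambda>i. tv (F i)) {..<n} \<le> tv (\<Union> (range F))" .
      qed
      show "tv (\<Union> (range F)) \<le> (\<Sum>i. tv (F i))"
      proof (rule least)
        fix P assume "P \<in> parts (\<Union> (range F))"
        then have P: "range P \<subseteq> sets borel" "disjoint_family P" "(\<Union>j. P j) = \<Union> (range F)" unfolding parts_def by auto
        have Pb: "P i \<in> sets borel" for i using P(1) by auto
        have "(\<Sum>j. N (P j)) \<le> (\<Sum>j. \<Sum>i. N (P j \<inter> F i))"
        proof (rule suminf_le)
          fix j
          have "(\<Union>i. P j \<inter> F i) = P j" using P(3) by auto
          moreover have "N (\<Union>i. P j \<inter> F i) \<le> (\<Sum>i. N (P j \<inter> F i))"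
            unfolding N_def using F(2) Pb Fb by (intro sub) (auto simp: disjoint_family_on_def)
          ultimately show "N (P j) \<le> (\<Sum>i. N (P j \<inter> F i))" by simp
        qed auto
        also have "\<dots> = (\<Sum>i. \<Sum>j. N (P j \<inter> F i))" by (rule suminf_swap_ennreal)
        also have "\<dots> \<le> (\<Sum>i. tv (F i))"
        proof (intro suminf_le upper summableI)
          fix i
          show "(\<lambda>j. P j \<inter> F i) \<in> parts (F i)"
            unfolding parts_def using P Pb Fb by (auto simp: disjoint_family_on_def)
        qed
        finally show "(\<Sum>j. N (P j)) \<le> (\<Sum>i. tv (F i))" .
      qed
    qed
  qed (use A in auto)
  then show ?thesis unfolding tv_def parts_def N_def .
qed

lemma CM_norm_le_total_variation:
  fixes \<nu> :: "'a::{banach, second_countable_topology} set \<Rightarrow> 'a"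
  assumes sub: "\<And>F :: nat \<Rightarrow> 'a set. range F \<subseteq> sets borel \<Longrightarrow> disjoint_family F \<Longrightarrow>
      ennreal (CM_norm \<gamma> (\<nu> (\<Union>i. F i))) \<le> (\<Sum>i. ennreal (CM_norm \<gamma> (\<nu> (F i))))"
    and empty: "CM_norm \<gamma> (\<nu> {}) = 0"
    and F: "range F \<subseteq> sets borel" "disjoint_family F"
  shows "(\<Sum>i. ennreal (CM_norm \<gamma> (\<nu> (F i)))) \<le> emeasure (total_variation \<gamma> \<nu>) (\<Union>i. F i)"
  using F by (subst emeasure_total_variation[OF sub empty]) (auto intro!: SUP_upper)

section \<open>Cameron-Martin valued measures under the dual semigroup\<close>

text \<open>The sets of points that are closer to one of the given sets than to each of the others are open and
  disjoint. Empty sets are treated apart because \<^const>\<open>infdist\<close> to the empty set is \<open>0\<close> by default.\<close>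

lemma closed_family_separation:
  fixes K :: "nat \<Rightarrow> 'a::metric_space set"
  assumes K: "\<And>i. i < n \<Longrightarrow> closed (K i)" and disj: "\<And>i j. i < n \<Longrightarrow> j < n \<Longrightarrow> i \<noteq> j \<Longrightarrow> K i \<inter> K j = {}"
  obtains U where "\<And>i. open (U i)" "\<And>i. i < n \<Longrightarrow> K i \<subseteq> U i"
    "\<And>i j. i < n \<Longrightarrow> j < n \<Longrightarrow> i \<noteq> j \<Longrightarrow> U i \<inter> U j = {}"
proof
  define J where "J i = {j. j < n \<and> j \<noteq> i \<and> K j \<noteq> {}}" for i
  define U where "U i = (if K i = {} then {} else \<Inter>j\<in>J i. {x. infdist x (K i) < infdist x (K j)})" for i
  show "open (U i)" for i
    unfolding U_def J_def by (auto intro!: open_INT open_Collect_less continuous_intros)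
  show "K i \<subseteq> U i" if i: "i < n" for i
  proof
    fix x assume x: "x \<in> K i"
    have "infdist x (K i) < infdist x (K j)" if j: "j \<in> J i" for j
    proof -
      have "j < n" "j \<noteq> i" "K j \<noteq> {}" using j unfolding J_def by auto
      then have "x \<notin> K j" using disj[of i j] i x by auto
      then have "infdist x (K j) \<noteq> 0"
        using in_closed_iff_infdist_zero[OF K[OF \<open>j < n\<close>] \<open>K j \<noteq> {}\<close>] by simp
      then show ?thesis using x infdist_nonneg[of x "K j"] by simp
    qed
    then show "x \<in> U i" unfolding U_def using x by auto
  qed
  show "U i \<inter> U j = {}" if "i < n" "j < n" "i \<noteq> j" for i j
  proof (rule ccontr)
    assume "U i \<inter> U j \<noteq> {}"
    then obtain x where x: "x \<in> U i" "x \<in> U j" by blast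
    then have "K i \<noteq> {}" "K j \<noteq> {}" by (auto simp: U_def split: if_splits)
    then have "j \<in> J i" "i \<in> J j" using that unfolding J_def by auto
    then have "infdist x (K i) < infdist x (K j)" "infdist x (K j) < infdist x (K i)"
      using x unfolding U_def by (auto split: if_splits)
    then show False by simp
  qed
qed

context centered_gaussian
begin

text \<open>For \<open>x\<close> in the open set \<open>U\<close> the point \<open>e\<^bsup>-t\<^esup> x + \<surd>(1 - e\<^bsup>-2t\<^esup>) y\<close> lies in \<open>U\<close> for small \<open>t\<close>, whatever \<open>y\<close> is.
  Dominated convergence is used once for \<open>\<gamma>\<close> and once for \<open>M\<close>.\<close>

lemma integral_OU_open_tendsto:
  fixes M :: "'a measure"
  assumes fin: "finite_measure M" and s: "sets M = sets borel"
    and U: "open U" and K: "K \<in> sets borel" "K \<subseteq> U"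
  shows "((\<lambda>t. \<integral>x. indicator K x * (1 - OU \<gamma> t (indicat_real U) x) \<partial>M) \<longlongrightarrow> 0) (at_right 0)"
  unfolding tendsto_at_iff_sequentially
proof (intro allI impI)
  fix X :: "nat \<Rightarrow> real" assume X: "X \<longlonglongrightarrow> 0"
  interpret M: finite_measure M by (rule fin)
  note [measurable_cong] = s
  have [measurable]: "U \<in> sets borel" "K \<in> sets borel" using U K by auto
  have ptw: "(\<lambda>n. OU \<gamma> (X n) (indicat_real U) x) \<longlonglongrightarrow> 1" if x: "x \<in> U" for x
  proof -
    have "(\<lambda>n. \<integral>y. indicat_real U (exp (- X n) *\<^sub>R x + sqrt (1 - exp (- 2 * X n)) *\<^sub>R y) \<partial>\<gamma>) \<longlonglongrightarrow> (\<integral>y. 1 \<partial>\<gamma>)"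
    proof (rule integral_dominated_convergence[where w = "\<lambda>_. 1"])
      show "AE y in \<gamma>. (\<lambda>n. indicat_real U (exp (- X n) *\<^sub>R x + sqrt (1 - exp (- 2 * X n)) *\<^sub>R y)) \<longlonglongrightarrow> 1"
      proof (rule AE_I2)
        fix y
        have "(\<lambda>n. exp (- X n) *\<^sub>R x + sqrt (1 - exp (- 2 * X n)) *\<^sub>R y) \<longlonglongrightarrow> exp (- 0) *\<^sub>R x + sqrt (1 - exp (- 2 * 0)) *\<^sub>R y"
          by (intro tendsto_intros X)
        then have "(\<lambda>n. exp (- X n) *\<^sub>R x + sqrt (1 - exp (- 2 * X n)) *\<^sub>R y) \<longlonglongrightarrow> x" by simp
        from topological_tendstoD[OF this U x]
        have "\<forall>\<^sub>F n in sequentially. indicat_real U (exp (- X n) *\<^sub>R x + sqrt (1 - exp (- 2 * X n)) *\<^sub>R y) = 1"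
          by eventually_elim simp
        then show "(\<lambda>n. indicat_real U (exp (- X n) *\<^sub>R x + sqrt (1 - exp (- 2 * X n)) *\<^sub>R y)) \<longlonglongrightarrow> 1"
          by (rule tendsto_eventually)
      qed
    qed (auto simp: indicator_def)
    then show ?thesis unfolding OU_def by simp
  qed
  have "(\<lambda>n. \<integral>x. indicator K x * (1 - OU \<gamma> (X n) (indicat_real U) x) \<partial>M) \<longlonglongrightarrow> (\<integral>x. 0 \<partial>M)"
  proof (rule integral_dominated_convergence[where w = "\<lambda>_. 2"])
    show "AE x in M. (\<lambda>n. indicat_real K x * (1 - OU \<gamma> (X n) (indicat_real U) x)) \<longlonglongrightarrow> 0"
    proof (rule AE_I2)
      fix x
      show "(\<lambda>n. indicat_real K x * (1 - OU \<gamma> (X n) (indicat_real U) x)) \<longlonglongrightarrow> 0"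
      proof (cases "x \<in> K")
        case True
        have "(\<lambda>n. indicat_real K x * (1 - OU \<gamma> (X n) (indicat_real U) x)) \<longlonglongrightarrow> indicat_real K x * (1 - 1)"
          by (intro tendsto_intros ptw) (use True K in auto)
        then show ?thesis by simp
      qed simp
    qed
    show "AE x in M. norm (indicat_real K x * (1 - OU \<gamma> (X n) (indicat_real U) x)) \<le> 2" for n
    proof (rule AE_I2)
      fix x
      have "\<bar>OU \<gamma> (X n) (indicat_real U) x\<bar> \<le> 1" by (rule OU_abs_le) (auto simp: indicator_def)
      then show "norm (indicat_real K x * (1 - OU \<gamma> (X n) (indicat_real U) x)) \<le> 2" by (auto simp: indicator_def)
    qed
  qed auto
  then show "((\<lambda>t. \<integral>x. indicator K x * (1 - OU \<gamma> t (indicat_real U) x) \<partial>M) \<circ> X) \<longlonglongrightarrow> 0"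
    by (simp add: comp_def)
qed

end

text \<open>Gradients of functions of bounded variation are measures of this kind, and the convergence is proved for
  all of them.\<close>

locale CM_measure = centered_gaussian \<gamma>
  for \<gamma> :: "'a::{banach, second_countable_topology} measure" +
  fixes \<nu> :: "'a set \<Rightarrow> 'a"
  assumes CM_valued: "CM_valued_measure \<gamma> \<nu>"
    and finite_variation: "emeasure (total_variation \<gamma> \<nu>) UNIV < \<infinity>"
begin

lemma in_CM_space: "\<nu> A \<in> CM_space \<gamma>"
  using CM_valued unfolding CM_valued_measure_def by blast

lemma CM_norm_sums:
  "range A \<subseteq> sets borel \<Longrightarrow> disjoint_family A \<Longrightarrow>
    (\<lambda>n. CM_norm \<gamma> (\<nu> (\<Union>i. A i) - (\<Sum>i<n. \<nu> (A i)))) \<longlonglongrightarrow> 0"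
  using CM_valued unfolding CM_valued_measure_def by blast

lemma component_signed_measure:
  assumes h: "h \<in> CM_space \<gamma>"
  shows "signed_measure (\<lambda>A. CM_inner \<gamma> (\<nu> A) h)"
  unfolding signed_measure_def
proof (intro conjI allI impI)
  fix A :: "'a set" assume "A \<notin> sets borel"
  then have "\<nu> A = 0" using CM_valued unfolding CM_valued_measure_def by blast
  then show "CM_inner \<gamma> (\<nu> A) h = 0" using CM_inner_zero_left[OF h] by simp
next
  fix A :: "nat \<Rightarrow> 'a set" assume A: "range A \<subseteq> sets borel \<and> disjoint_family A"
  have "(\<lambda>n. CM_inner \<gamma> (\<nu> (\<Union>i. A i)) h - (\<Sum>i<n. CM_inner \<gamma> (\<nu> (A i)) h)) \<longlonglongrightarrow> 0"
  proof (rule Lim_null_comparison)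
    show "\<forall>\<^sub>F n in sequentially. norm (CM_inner \<gamma> (\<nu> (\<Union>i. A i)) h - (\<Sum>i<n. CM_inner \<gamma> (\<nu> (A i)) h))
        \<le> CM_norm \<gamma> (\<nu> (\<Union>i. A i) - (\<Sum>i<n. \<nu> (A i))) * CM_norm \<gamma> h"
    proof (rule always_eventually, rule allI)
      fix n
      have "(\<Sum>i<n. \<nu> (A i)) \<in> CM_space \<gamma>" by (rule CM_space_sum) (auto simp: in_CM_space)
      then show "norm (CM_inner \<gamma> (\<nu> (\<Union>i. A i)) h - (\<Sum>i<n. CM_inner \<gamma> (\<nu> (A i)) h))
        \<le> CM_norm \<gamma> (\<nu> (\<Union>i. A i) - (\<Sum>i<n. \<nu> (A i))) * CM_norm \<gamma> h"
        using CM_inner_le[OF CM_space_diff[OF in_CM_space] h]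
        by (simp add: CM_inner_diff_left in_CM_space h flip: CM_inner_sum_left[OF h])
    qed
    show "(\<lambda>n. CM_norm \<gamma> (\<nu> (\<Union>i. A i) - (\<Sum>i<n. \<nu> (A i))) * CM_norm \<gamma> h) \<longlonglongrightarrow> 0"
      by (rule tendsto_mult_left_zero) (use A CM_norm_sums in blast)
  qed
  from tendsto_diff[OF tendsto_const[of "CM_inner \<gamma> (\<nu> (\<Union>i. A i)) h"] this]
  show "(\<lambda>n. CM_inner \<gamma> (\<nu> (A n)) h) sums CM_inner \<gamma> (\<nu> (\<Union>n. A n)) h"
    unfolding sums_def by simp
qed

lemma at_empty: "\<nu> {} = 0"
proof (rule eq_by_functionals)
  fix l :: "'a \<Rightarrow>\<^sub>L real"
  show "blinfun_apply l (\<nu> {}) = blinfun_apply l 0"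
    using signed_measure_empty[OF component_signed_measure[OF dual_embedding_CM[of l]]]
    by (simp add: CM_inner_dual_embedding in_CM_space)
qed

lemma CM_norm_UN_le:
  fixes F :: "nat \<Rightarrow> 'a set"
  assumes F: "range F \<subseteq> sets borel" "disjoint_family F"
  shows "ennreal (CM_norm \<gamma> (\<nu> (\<Union>i. F i))) \<le> (\<Sum>i. ennreal (CM_norm \<gamma> (\<nu> (F i))))"
proof (rule LIMSEQ_le_const)
  let ?S = "\<Sum>i. ennreal (CM_norm \<gamma> (\<nu> (F i)))"
  let ?a = "\<lambda>n. CM_norm \<gamma> (\<nu> (\<Union>i. F i) - (\<Sum>i<n. \<nu> (F i)))"
  have "(\<lambda>n. ennreal (?a n) + ?S) \<longlonglongrightarrow> ennreal 0 + ?S"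
    by (intro tendsto_add tendsto_const tendsto_ennrealI CM_norm_sums F)
  then show "(\<lambda>n. ennreal (?a n) + ?S) \<longlonglongrightarrow> ?S" by simp
  have "ennreal (CM_norm \<gamma> (\<nu> (\<Union>i. F i))) \<le> ennreal (?a n) + ?S" for n
  proof -
    have sum: "(\<Sum>i<n. \<nu> (F i)) \<in> CM_space \<gamma>" by (rule CM_space_sum) (auto simp: in_CM_space)
    have "CM_norm \<gamma> (\<nu> (\<Union>i. F i)) \<le> ?a n + CM_norm \<gamma> (\<Sum>i<n. \<nu> (F i))"
      using CM_norm_triangle[OF CM_space_diff[OF in_CM_space sum] sum] by simp
    also have "\<dots> \<le> ?a n + (\<Sum>i<n. CM_norm \<gamma> (\<nu> (F i)))"
      by (intro add_left_mono CM_norm_sum_le) (auto simp: in_CM_space CM_norm_zero)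
    finally have "ennreal (CM_norm \<gamma> (\<nu> (\<Union>i. F i))) \<le> ennreal (?a n) + (\<Sum>i<n. ennreal (CM_norm \<gamma> (\<nu> (F i))))"
      by (simp add: sum_nonneg ennreal_leI flip: ennreal_plus)
    also have "\<dots> \<le> ennreal (?a n) + ?S" by (intro add_left_mono sum_le_suminf) auto
    finally show ?thesis .
  qed
  then show "\<exists>N. \<forall>n\<ge>N. ennreal (CM_norm \<gamma> (\<nu> (\<Union>i. F i))) \<le> ennreal (?a n) + ?S" by blast
qed

abbreviation "M \<equiv> total_variation \<gamma> \<nu>"

sublocale M: finite_measure M
  by (rule finite_measureI) (use finite_variation in simp)

lemma CM_norm_le_variation:
  assumes A: "A \<in> sets borel"
  shows "CM_norm \<gamma> (\<nu> A) \<le> measure M A"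
proof -
  have "sum (\<lambda>i. ennreal (CM_norm \<gamma> (\<nu> (binaryset A {} i)))) {0} \<le> (\<Sum>i. ennreal (CM_norm \<gamma> (\<nu> (binaryset A {} i))))"
    by (rule sum_le_suminf) auto
  also have "\<dots> \<le> emeasure M (\<Union>i. binaryset A {} i)"
    using A by (intro CM_norm_le_total_variation CM_norm_UN_le)
      (auto simp: at_empty CM_norm_zero range_binaryset_eq disjoint_family_on_def binaryset_def)
  finally have "ennreal (CM_norm \<gamma> (\<nu> A)) \<le> emeasure M A"
    by (simp add: UN_binaryset_eq) (simp add: binaryset_def)
  then show ?thesis by (simp add: M.emeasure_eq_measure)
qed

definition component_density :: "'a \<Rightarrow> 'a \<Rightarrow> real" where
  "component_density h = (SOME g. g \<in> borel_measurable borel \<and> (\<forall>x. \<bar>g x\<bar> \<le> CM_norm \<gamma> h) \<and>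
     (\<forall>A\<in>sets borel. CM_inner \<gamma> (\<nu> A) h = (\<integral>x. indicator A x * g x \<partial>M)))"

text \<open>Every component \<open>\<langle>\<nu>, h\<rangle>\<close> is dominated by \<open>|h|\<^sub>H M\<close>. Its bounded density turns all signed integrals into
  ordinary integrals with respect to \<open>M\<close>.\<close>

lemma component_density:
  assumes h: "h \<in> CM_space \<gamma>"
  shows measurable_component_density: "component_density h \<in> borel_measurable borel"
    and component_density_le: "\<bar>component_density h x\<bar> \<le> CM_norm \<gamma> h"
    and component_eq: "A \<in> sets borel \<Longrightarrow> CM_inner \<gamma> (\<nu> A) h = (\<integral>x. indicator A x * component_density h x \<partial>M)"
proof -
  have "\<exists>g\<in>borel_measurable borel. (\<forall>x. \<bar>g x\<bar> \<le> CM_norm \<gamma> h) \<and>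
     (\<forall>A\<in>sets borel. CM_inner \<gamma> (\<nu> A) h = (\<integral>x. indicator A x * g x \<partial>M))"
  proof (rule dominated_signed_density[OF M.finite_measure_axioms sets_total_variation component_signed_measure[OF h]])
    fix A :: "'a set" assume A: "A \<in> sets borel"
    have "\<bar>CM_inner \<gamma> (\<nu> A) h\<bar> \<le> CM_norm \<gamma> (\<nu> A) * CM_norm \<gamma> h" by (rule CM_inner_le[OF in_CM_space h])
    also have "\<dots> \<le> measure M A * CM_norm \<gamma> h" by (intro mult_right_mono CM_norm_le_variation A) simp
    finally show "\<bar>CM_inner \<gamma> (\<nu> A) h\<bar> \<le> CM_norm \<gamma> h * measure M A" by (simp add: mult.commute)
  qed simp
  then have "\<exists>g. g \<in> borel_measurable borel \<and> (\<forall>x. \<bar>g x\<bar> \<le> CM_norm \<gamma> h) \<and>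
     (\<forall>A\<in>sets borel. CM_inner \<gamma> (\<nu> A) h = (\<integral>x. indicator A x * g x \<partial>M))" by blast
  from someI_ex[OF this]
  show "component_density h \<in> borel_measurable borel" "\<bar>component_density h x\<bar> \<le> CM_norm \<gamma> h"
    "A \<in> sets borel \<Longrightarrow> CM_inner \<gamma> (\<nu> A) h = (\<integral>x. indicator A x * component_density h x \<partial>M)"
    unfolding component_density_def by blast+
qed

text \<open>The density \<open>g\<close> is arbitrary here, so that linear combinations of densities can be used for linear
  combinations of components.\<close>

lemma OU_dual_component:
  assumes h: "h \<in> CM_space \<gamma>" and A: "A \<in> sets borel"
    and g: "g \<in> borel_measurable borel" "\<And>x. \<bar>g x\<bar> \<le> C"
      "\<And>B. B \<in> sets borel \<Longrightarrow> CM_inner \<gamma> (\<nu> B) h = (\<integral>x. indicator B x * g x \<partial>M)"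
  shows "OU_dual \<gamma> t (\<lambda>B. CM_inner \<gamma> (\<nu> B) h) A = (\<integral>x. OU \<gamma> t (indicat_real A) x * g x \<partial>M)"
proof -
  have ind: "indicat_real A \<in> borel_measurable borel" "bounded (range (indicat_real A))"
    using A by (auto simp: bounded_iff indicator_def intro!: exI[of _ 1])
  show ?thesis
    unfolding OU_dual_eq[OF component_signed_measure[OF h] A]
    by (rule signed_integral_density[OF M.finite_measure_axioms sets_total_variation component_signed_measure[OF h]
      g measurable_OU[OF ind(1)] OU_bounded[OF ind]])
qed

lemma OU_indicator_range:
  assumes "A \<in> sets borel"
  shows "0 \<le> OU \<gamma> t (indicat_real A) x" "OU \<gamma> t (indicat_real A) x \<le> 1"
proof -
  have "OU \<gamma> t (\<lambda>_. 0) x \<le> OU \<gamma> t (indicat_real A) x"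
    by (rule OU_mono[where c = 1 and d = 1]) (use assms in \<open>auto simp: indicator_def\<close>)
  then show "0 \<le> OU \<gamma> t (indicat_real A) x" by (simp add: OU_const)
  have "\<bar>OU \<gamma> t (indicat_real A) x\<bar> \<le> 1" by (rule OU_abs_le) (use assms in \<open>auto simp: indicator_def\<close>)
  then show "OU \<gamma> t (indicat_real A) x \<le> 1" by simp
qed

lemma bounded_integrable:
  fixes f :: "'a \<Rightarrow> real"
  assumes "f \<in> borel_measurable borel" "\<And>x. \<bar>f x\<bar> \<le> c"
  shows "integrable M f"
  by (rule M.integrable_const_bound[of _ c]) (use assms in \<open>auto cong: measurable_cong_sets\<close>)

lemma OU_times_integrable:
  assumes A: "A \<in> sets borel" and g: "g \<in> borel_measurable borel" "\<And>x. \<bar>g x\<bar> \<le> C"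
  shows "integrable M (\<lambda>x. OU \<gamma> t (indicat_real A) x * g x)"
proof (rule bounded_integrable)
  note [measurable] = A g(1)
  show "(\<lambda>x. OU \<gamma> t (indicat_real A) x * g x) \<in> borel_measurable borel" by measurable
  show "\<bar>OU \<gamma> t (indicat_real A) x * g x\<bar> \<le> 1 * C" for x
    unfolding abs_mult using OU_indicator_range[OF A, of t x] g(2)[of x] by (intro mult_mono) auto
qed

text \<open>The components of the image on a fixed set \<open>A\<close> are the integrals of \<open>T\<^sub>t \<chi>\<^sub>A\<close> against the densities, a
  bounded linear functional of \<open>h\<close>; the Riesz theorem makes the definite description meaningful.\<close>

lemma OU_dual_CM:
  assumes A: "A \<in> sets borel"
  shows OU_dual_CM_in: "OU_dual_CM \<gamma> t \<nu> A \<in> CM_space \<gamma>"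
    and OU_dual_CM_inner: "h \<in> CM_space \<gamma> \<Longrightarrow>
      CM_inner \<gamma> (OU_dual_CM \<gamma> t \<nu> A) h = OU_dual \<gamma> t (\<lambda>B. CM_inner \<gamma> (\<nu> B) h) A"
proof -
  define \<Psi> where "\<Psi> h = OU_dual \<gamma> t (\<lambda>B. CM_inner \<gamma> (\<nu> B) h) A" for h
  have \<Psi>: "\<Psi> h = (\<integral>x. OU \<gamma> t (indicat_real A) x * component_density h x \<partial>M)" if h: "h \<in> CM_space \<gamma>" for h
    unfolding \<Psi>_def by (rule OU_dual_component[OF h A component_density[OF h]])
  have comb: "\<Psi> (a *\<^sub>R h + b *\<^sub>R k) = a * \<Psi> h + b * \<Psi> k" if h: "h \<in> CM_space \<gamma>" and k: "k \<in> CM_space \<gamma>" for a b h k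
  proof -
    note [measurable] = measurable_component_density[OF h] measurable_component_density[OF k]
    let ?g = "\<lambda>x. a * component_density h x + b * component_density k x"
    have int: "integrable M (\<lambda>x. indicator B x * component_density z x)"
      if z: "z \<in> CM_space \<gamma>" and [measurable]: "B \<in> sets borel" for B z
    proof (rule bounded_integrable)
      note [measurable] = measurable_component_density[OF z]
      show "(\<lambda>x. indicator B x * component_density z x) \<in> borel_measurable borel" by measurable
      show "\<bar>indicator B x * component_density z x\<bar> \<le> CM_norm \<gamma> z" for x
        using component_density_le[OF z, of x] by (auto simp: indicator_def)
    qed
    have "\<Psi> (a *\<^sub>R h + b *\<^sub>R k) = (\<integral>x. OU \<gamma> t (indicat_real A) x * ?g x \<partial>M)"
      unfolding \<Psi>_def
    proof (rule OU_dual_component[OF CM_space_combination[OF h k] A])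
      show "\<bar>?g x\<bar> \<le> \<bar>a\<bar> * CM_norm \<gamma> h + \<bar>b\<bar> * CM_norm \<gamma> k" for x
        using component_density_le[OF h, of x] component_density_le[OF k, of x]
        by (intro order_trans[OF abs_triangle_ineq] add_mono) (auto simp: abs_mult intro!: mult_left_mono)
      fix B :: "'a set" assume B: "B \<in> sets borel"
      have "CM_inner \<gamma> (\<nu> B) (a *\<^sub>R h + b *\<^sub>R k) = a * CM_inner \<gamma> (\<nu> B) h + b * CM_inner \<gamma> (\<nu> B) k"
        using CM_inner_combination[OF h k in_CM_space, of a b B] by (simp add: CM_inner_commute)
      also have "\<dots> = (\<integral>x. a * (indicator B x * component_density h x) + b * (indicator B x * component_density k x) \<partial>M)"
        unfolding component_eq[OF h B] component_eq[OF k B] using int[OF h B] int[OF k B] by simp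
      finally show "CM_inner \<gamma> (\<nu> B) (a *\<^sub>R h + b *\<^sub>R k) = (\<integral>x. indicator B x * ?g x \<partial>M)"
        by (simp add: algebra_simps)
    qed measurable
    also have "\<dots> = (\<integral>x. a * (OU \<gamma> t (indicat_real A) x * component_density h x)
        + b * (OU \<gamma> t (indicat_real A) x * component_density k x) \<partial>M)" by (simp add: algebra_simps)
    also have "\<dots> = a * \<Psi> h + b * \<Psi> k"
      unfolding \<Psi>[OF h] \<Psi>[OF k]
      using OU_times_integrable[OF A component_density(1,2)[OF h], of t]
        OU_times_integrable[OF A component_density(1,2)[OF k], of t] by simp
    finally show ?thesis .
  qed
  have bd: "\<bar>\<Psi> h\<bar> \<le> measure M UNIV * CM_norm \<gamma> h" if h: "h \<in> CM_space \<gamma>" for h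
  proof -
    have "\<bar>\<Psi> h\<bar> \<le> (\<integral>x. CM_norm \<gamma> h \<partial>M)"
      unfolding \<Psi>[OF h]
    proof (rule integral_abs_bound[THEN order_trans], rule integral_mono)
      show "integrable M (\<lambda>x. \<bar>OU \<gamma> t (indicat_real A) x * component_density h x\<bar>)"
        using OU_times_integrable[OF A component_density(1,2)[OF h], of t] by simp
      show "\<bar>OU \<gamma> t (indicat_real A) x * component_density h x\<bar> \<le> CM_norm \<gamma> h" for x
        using mult_mono[of "\<bar>OU \<gamma> t (indicat_real A) x\<bar>" 1 "\<bar>component_density h x\<bar>" "CM_norm \<gamma> h"]
          OU_indicator_range[OF A, of t x] component_density_le[OF h, of x] by (simp add: abs_mult)
    qed simp
    then show ?thesis by simp
  qed
  obtain k where k: "k \<in> CM_space \<gamma>" "\<forall>h\<in>CM_space \<gamma>. CM_inner \<gamma> k h = \<Psi> h"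
    using CM_riesz[of \<Psi>, OF comb bd] by blast
  have uniq: "k' = k" if k': "k' \<in> CM_space \<gamma>" "\<forall>h\<in>CM_space \<gamma>. CM_inner \<gamma> k' h = \<Psi> h" for k'
  proof (rule eq_by_functionals)
    fix l :: "'a \<Rightarrow>\<^sub>L real"
    have "CM_inner \<gamma> k' (dual_embedding l) = CM_inner \<gamma> k (dual_embedding l)"
      using k k' dual_embedding_CM by simp
    then show "blinfun_apply l k' = blinfun_apply l k" by (simp add: CM_inner_dual_embedding k(1) k'(1))
  qed
  have "OU_dual_CM \<gamma> t \<nu> A = k"
    unfolding OU_dual_CM_def \<Psi>_def[symmetric] by (rule the_equality) (use k uniq in blast)+
  then show "OU_dual_CM \<gamma> t \<nu> A \<in> CM_space \<gamma>"
    "h \<in> CM_space \<gamma> \<Longrightarrow> CM_inner \<gamma> (OU_dual_CM \<gamma> t \<nu> A) h = OU_dual \<gamma> t (\<lambda>B. CM_inner \<gamma> (\<nu> B) h) A"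
    using k unfolding \<Psi>_def by auto
qed

lemma functional_OU_dual_CM:
  "A \<in> sets borel \<Longrightarrow> blinfun_apply l (OU_dual_CM \<gamma> t \<nu> A) = OU_dual \<gamma> t (\<lambda>B. CM_inner \<gamma> (\<nu> B) (dual_embedding l)) A"
  using OU_dual_CM_inner[OF _ dual_embedding_CM, of A t l] by (simp add: CM_inner_dual_embedding OU_dual_CM_in)

lemma OU_dual_CM_empty: "OU_dual_CM \<gamma> t \<nu> {} = 0"
  by (rule eq_by_functionals)
     (simp add: functional_OU_dual_CM signed_measure_empty OU_dual_signed_measure component_signed_measure dual_embedding_CM)

text \<open>A single functional nearly norms the value on the union, and along it countable additivity is that of
  a signed measure.\<close>

lemma CM_norm_OU_dual_CM_UN_le:
  fixes F :: "nat \<Rightarrow> 'a set"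
  assumes F: "range F \<subseteq> sets borel" "disjoint_family F"
  shows "ennreal (CM_norm \<gamma> (OU_dual_CM \<gamma> t \<nu> (\<Union>i. F i))) \<le> (\<Sum>i. ennreal (CM_norm \<gamma> (OU_dual_CM \<gamma> t \<nu> (F i))))"
proof (rule ennreal_le_epsilon)
  fix e :: real assume e: "0 < e"
  have Fb: "F i \<in> sets borel" for i using F(1) by auto
  have UF: "(\<Union>i. F i) \<in> sets borel" using Fb by auto
  obtain l where l: "L2_nrm \<gamma> (blinfun_apply l) \<le> 1"
    "CM_norm \<gamma> (OU_dual_CM \<gamma> t \<nu> (\<Union>i. F i)) - e \<le> blinfun_apply l (OU_dual_CM \<gamma> t \<nu> (\<Union>i. F i))"
    using CM_norm_approx[OF OU_dual_CM_in[OF UF] e] by blast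
  have le: "blinfun_apply l (OU_dual_CM \<gamma> t \<nu> (F i)) \<le> CM_norm \<gamma> (OU_dual_CM \<gamma> t \<nu> (F i))" for i
    using functional_CM_le[OF OU_dual_CM_in[OF Fb], of l t i] mult_right_mono[OF l(1) CM_norm_nonneg, of "OU_dual_CM \<gamma> t \<nu> (F i)"]
    by simp
  have "(\<lambda>i. blinfun_apply l (OU_dual_CM \<gamma> t \<nu> (F i))) sums blinfun_apply l (OU_dual_CM \<gamma> t \<nu> (\<Union>i. F i))"
    unfolding functional_OU_dual_CM[OF Fb] functional_OU_dual_CM[OF UF]
    by (rule signed_measure_sums[OF OU_dual_signed_measure[OF component_signed_measure[OF dual_embedding_CM]] F])
  then have "ennreal (blinfun_apply l (OU_dual_CM \<gamma> t \<nu> (\<Union>i. F i))) \<le> (\<Sum>i. ennreal (blinfun_apply l (OU_dual_CM \<gamma> t \<nu> (F i))))"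
    by (rule ennreal_sums_le)
  also have "\<dots> \<le> (\<Sum>i. ennreal (CM_norm \<gamma> (OU_dual_CM \<gamma> t \<nu> (F i))))"
    by (intro suminf_le summableI ennreal_leI le)
  finally have "ennreal (blinfun_apply l (OU_dual_CM \<gamma> t \<nu> (\<Union>i. F i))) + ennreal e \<le> \<dots> + ennreal e"
    by (rule add_right_mono)
  moreover have "ennreal (CM_norm \<gamma> (OU_dual_CM \<gamma> t \<nu> (\<Union>i. F i))) \<le> ennreal (blinfun_apply l (OU_dual_CM \<gamma> t \<nu> (\<Union>i. F i))) + ennreal e"
  proof -
    have "CM_norm \<gamma> (OU_dual_CM \<gamma> t \<nu> (\<Union>i. F i)) \<le> max 0 (blinfun_apply l (OU_dual_CM \<gamma> t \<nu> (\<Union>i. F i))) + e"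
      using l(2) by simp
    then have "ennreal (CM_norm \<gamma> (OU_dual_CM \<gamma> t \<nu> (\<Union>i. F i))) \<le> ennreal (max 0 (blinfun_apply l (OU_dual_CM \<gamma> t \<nu> (\<Union>i. F i))) + e)"
      by (rule ennreal_leI)
    then show ?thesis using e by (simp add: ennreal_plus)
  qed
  ultimately show "ennreal (CM_norm \<gamma> (OU_dual_CM \<gamma> t \<nu> (\<Union>i. F i))) \<le> (\<Sum>i. ennreal (CM_norm \<gamma> (OU_dual_CM \<gamma> t \<nu> (F i)))) + ennreal e"
    by (rule order_trans[rotated])
qed

lemma OU_dual_CM_variation_ge:
  fixes U :: "nat \<Rightarrow> 'a set"
  assumes U: "\<And>i. i < n \<Longrightarrow> U i \<in> sets borel" and disj: "\<And>i j. i < n \<Longrightarrow> j < n \<Longrightarrow> i \<noteq> j \<Longrightarrow> U i \<inter> U j = {}"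
    and l: "\<And>i. i < n \<Longrightarrow> L2_nrm \<gamma> (blinfun_apply (l i)) \<le> 1"
  shows "ennreal (\<Sum>i<n. \<integral>x. OU \<gamma> t (indicat_real (U i)) x * component_density (dual_embedding (l i)) x \<partial>M)
    \<le> emeasure (total_variation \<gamma> (OU_dual_CM \<gamma> t \<nu>)) UNIV"
proof -
  define F where "F i = (if i < n then U i else {})" for i
  have F: "range F \<subseteq> sets borel" "disjoint_family F"
    unfolding F_def using U disj by (auto simp: disjoint_family_on_def)
  have le: "(\<integral>x. OU \<gamma> t (indicat_real (U i)) x * component_density (dual_embedding (l i)) x \<partial>M) \<le> CM_norm \<gamma> (OU_dual_CM \<gamma> t \<nu> (F i))"
    if i: "i < n" for i
  proof -
    have "(\<integral>x. OU \<gamma> t (indicat_real (U i)) x * component_density (dual_embedding (l i)) x \<partial>M) = blinfun_apply (l i) (OU_dual_CM \<gamma> t \<nu> (U i))"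
      unfolding functional_OU_dual_CM[OF U[OF i]]
      by (rule OU_dual_component[OF dual_embedding_CM U[OF i] component_density[OF dual_embedding_CM], symmetric])
    also have "\<dots> \<le> 1 * CM_norm \<gamma> (OU_dual_CM \<gamma> t \<nu> (U i))"
      by (intro order_trans[OF functional_CM_le] mult_right_mono l OU_dual_CM_in U i) simp
    finally show ?thesis using i by (simp add: F_def)
  qed
  have "ennreal (\<Sum>i<n. \<integral>x. OU \<gamma> t (indicat_real (U i)) x * component_density (dual_embedding (l i)) x \<partial>M)
    \<le> ennreal (\<Sum>i<n. CM_norm \<gamma> (OU_dual_CM \<gamma> t \<nu> (F i)))"
    by (intro ennreal_leI sum_mono le) simp
  also have "\<dots> = (\<Sum>i<n. ennreal (CM_norm \<gamma> (OU_dual_CM \<gamma> t \<nu> (F i))))" by simp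
  also have "\<dots> \<le> (\<Sum>i. ennreal (CM_norm \<gamma> (OU_dual_CM \<gamma> t \<nu> (F i))))" by (rule sum_le_suminf) auto
  also have "\<dots> \<le> emeasure (total_variation \<gamma> (OU_dual_CM \<gamma> t \<nu>)) (\<Union>i. F i)"
    using F by (intro CM_norm_le_total_variation CM_norm_OU_dual_CM_UN_le) (auto simp: OU_dual_CM_empty CM_norm_zero)
  also have "\<dots> \<le> emeasure (total_variation \<gamma> (OU_dual_CM \<gamma> t \<nu>)) UNIV" by (rule emeasure_mono) auto
  finally show ?thesis .
qed

lemma compact_approximation:
  assumes A: "A \<in> sets borel" and d: "d > 0"
  shows "\<exists>K. compact K \<and> K \<subseteq> A \<and> measure M (A - K) < d"
proof (cases "measure M A < d")
  case True
  then show ?thesis by (intro exI[of _ "{}"]) auto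
next
  case False
  then have "ennreal (measure M A - d) < emeasure M A"
    using d by (auto simp: M.emeasure_eq_measure ennreal_less_iff)
  also have "emeasure M A = (SUP K\<in>{K. K \<subseteq> A \<and> compact K}. emeasure M K)"
    using A finite_variation by (intro inner_regular) auto
  finally obtain K where K: "K \<subseteq> A" "compact K" "ennreal (measure M A - d) < emeasure M K"
    by (auto simp: less_SUP_iff)
  have Kb: "K \<in> sets borel" using K(2) by (intro borel_closed compact_imp_closed)
  have "measure M A - d < measure M K"
    using K(3) False by (simp add: M.emeasure_eq_measure ennreal_less_iff)
  moreover have "measure M (A - K) = measure M A - measure M K"
    using A Kb K(1) by (intro M.finite_measure_Diff) auto
  ultimately show ?thesis using K by (intro exI[of _ K]) auto
qed

text \<open>The estimate described at the beginning, with the error \<open>e\<close> split into eight parts \<open>d\<close>: one from the choice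
  of a countable partition, two from replacing its sets by compact sets and norms by functionals, three from
  the complement \<open>R\<close> of the compact sets, and two from the defect of \<open>T\<^sub>t \<chi>\<^bsub>U\<^sub>i\<^esub>\<close> on \<open>K\<^sub>i\<close>.\<close>

lemma variation_lower_semicontinuous:
  assumes e: "e > 0"
  shows "\<forall>\<^sub>F t in at_right 0. ennreal (measure M UNIV - e) \<le> emeasure (total_variation \<gamma> (OU_dual_CM \<gamma> t \<nu>)) UNIV"
proof (cases "measure M UNIV \<le> e")
  case True
  then show ?thesis by (simp add: ennreal_neg)
next
  case False
  define m where "m = measure M UNIV"
  define d where "d = e / 8"
  have d: "d > 0" "8 * d = e" "d < m" using e False unfolding d_def m_def by auto
  have "ennreal (m - d) < emeasure M UNIV"
    unfolding M.emeasure_eq_measure m_def[symmetric] using d by (simp add: ennreal_less_iff)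
  then obtain P where P: "range P \<subseteq> sets borel" "disjoint_family P"
    and sumP: "ennreal (m - d) < (\<Sum>i. ennreal (CM_norm \<gamma> (\<nu> (P i))))"
    by (subst (asm) emeasure_total_variation[OF CM_norm_UN_le]) (auto simp: at_empty CM_norm_zero less_SUP_iff)
  obtain n where "ennreal (m - d) < (\<Sum>i<n. ennreal (CM_norm \<gamma> (\<nu> (P i))))"
    using sumP unfolding suminf_eq_SUP by (auto simp: less_SUP_iff)
  then have sum_n: "m - d < (\<Sum>i<n. CM_norm \<gamma> (\<nu> (P i)))"
    using d by (simp add: sum_nonneg ennreal_less_iff)
  define c where "c = d / (real n + 1)"
  have c: "c > 0" "real n * c \<le> d" unfolding c_def using d by (auto simp: field_simps)
  have Pb: "P i \<in> sets borel" for i using P(1) by auto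
  have "\<forall>i. \<exists>l. L2_nrm \<gamma> (blinfun_apply l) \<le> 1 \<and> CM_norm \<gamma> (\<nu> (P i)) - c \<le> blinfun_apply l (\<nu> (P i))"
    using CM_norm_approx[OF in_CM_space c(1)] by blast
  then obtain l where l: "\<And>i. L2_nrm \<gamma> (blinfun_apply (l i)) \<le> 1" "\<And>i. CM_norm \<gamma> (\<nu> (P i)) - c \<le> blinfun_apply (l i) (\<nu> (P i))"
    by metis
  have "\<forall>i. \<exists>K. compact K \<and> K \<subseteq> P i \<and> measure M (P i - K) < c"
    using compact_approximation[OF Pb c(1)] by blast
  then obtain K where K: "\<And>i. compact (K i)" "\<And>i. K i \<subseteq> P i" "\<And>i. measure M (P i - K i) < c" by metis
  have Kc: "closed (K i)" and Kb[measurable]: "K i \<in> sets borel" for i using K(1) by (auto intro: compact_imp_closed borel_closed)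
  have Kdisj: "K i \<inter> K j = {}" if "i \<noteq> j" for i j
    using K(2)[of i] K(2)[of j] disjoint_family_onD[OF P(2), of i j] that by auto
  obtain U where U: "\<And>i. open (U i)" "\<And>i. i < n \<Longrightarrow> K i \<subseteq> U i"
    "\<And>i j. i < n \<Longrightarrow> j < n \<Longrightarrow> i \<noteq> j \<Longrightarrow> U i \<inter> U j = {}"
    using closed_family_separation[of n K] Kc Kdisj by metis
  have Ub[measurable]: "U i \<in> sets borel" for i using U(1) by auto
  define g where "g i = component_density (dual_embedding (l i))" for i
  have g[measurable]: "g i \<in> borel_measurable borel" for i
    unfolding g_def by (rule measurable_component_density[OF dual_embedding_CM])
  have g1: "\<bar>g i x\<bar> \<le> 1" for i x
    unfolding g_def using component_density_le[OF dual_embedding_CM, of "l i" x] l(1)[of i]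
    by (simp add: CM_norm_dual_embedding)
  have intg: "integrable M (\<lambda>x. indicat_real A x * g i x)" if [measurable]: "A \<in> sets borel" for A i
    by (rule bounded_integrable[of _ 1]) (use g1 in \<open>auto simp: indicator_def\<close>)
  have intI: "integrable M (indicat_real A)" if "A \<in> sets borel" for A
    by (rule bounded_integrable[of _ 1]) (use that in \<open>auto simp: indicator_def\<close>)
  have gle: "indicat_real A x * g i x \<le> indicat_real A x" for A i x
    using g1[of i x] by (auto simp: indicator_def abs_le_iff)
  have Kg: "CM_norm \<gamma> (\<nu> (P i)) - 2 * c \<le> (\<integral>x. indicator (K i) x * g i x \<partial>M)" for i
  proof -
    have "blinfun_apply (l i) (\<nu> (P i)) = (\<integral>x. indicator (P i) x * g i x \<partial>M)"
      unfolding g_def component_eq[OF dual_embedding_CM Pb, symmetric] by (simp add: CM_inner_dual_embedding in_CM_space)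
    also have "\<dots> = (\<integral>x. indicator (K i) x * g i x + indicator (P i - K i) x * g i x \<partial>M)"
      using K(2)[of i] by (intro Bochner_Integration.integral_cong) (auto simp: indicator_def)
    also have "\<dots> = (\<integral>x. indicator (K i) x * g i x \<partial>M) + (\<integral>x. indicator (P i - K i) x * g i x \<partial>M)"
      using Pb Kb by (intro Bochner_Integration.integral_add intg) auto
    also have "(\<integral>x. indicator (P i - K i) x * g i x \<partial>M) \<le> (\<integral>x. indicator (P i - K i) x \<partial>M)"
      by (intro integral_mono intg intI gle sets.Diff Pb Kb)
    also have "\<dots> = measure M (P i - K i)" by simp
    finally show ?thesis using l(2)[of i] K(3)[of i] by simp
  qed
  have sumK: "m - 3 * d \<le> (\<Sum>i<n. \<integral>x. indicator (K i) x * g i x \<partial>M)"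
  proof -
    have "(\<Sum>i<n. CM_norm \<gamma> (\<nu> (P i)) - 2 * c) \<le> (\<Sum>i<n. \<integral>x. indicator (K i) x * g i x \<partial>M)"
      by (intro sum_mono Kg)
    then show ?thesis using sum_n c(2) by (simp add: sum_subtractf)
  qed
  define R where "R = - (\<Union>i<n. K i)"
  have Rb[measurable]: "R \<in> sets borel" unfolding R_def by measurable
  \<comment> \<open>Since \<open>|g\<^sub>i| \<le> 1\<close>, the lower bound for the integrals over the \<open>K\<^sub>i\<close> is also one for their total mass.\<close>
  have R: "measure M R \<le> 3 * d"
  proof -
    have "(\<integral>x. indicator (K i) x * g i x \<partial>M) \<le> measure M (K i)" for i
    proof -
      have "(\<integral>x. indicator (K i) x * g i x \<partial>M) \<le> (\<integral>x. indicator (K i) x \<partial>M)"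
        by (intro integral_mono intg intI gle Kb)
      then show ?thesis by simp
    qed
    then have "m - 3 * d \<le> (\<Sum>i<n. measure M (K i))" using sumK by (meson order_trans sum_mono)
    also have "\<dots> = measure M (\<Union>i<n. K i)"
      by (rule M.finite_measure_finite_Union[symmetric]) (auto simp: disjoint_family_on_def Kdisj)
    also have "\<dots> = m - measure M R"
      unfolding R_def m_def using M.finite_measure_compl[of "\<Union>i<n. K i"] by (simp add: Compl_eq_Diff_UNIV)
    finally show ?thesis by simp
  qed
  define T where "T t i = OU \<gamma> t (indicat_real (U i))" for t i
  have T[measurable]: "T t i \<in> borel_measurable borel" for t i unfolding T_def by measurable
  have T01: "0 \<le> T t i x" "T t i x \<le> 1" for t i x unfolding T_def using OU_indicator_range[OF Ub] by auto
  have Tsum: "(\<Sum>i<n. T t i x) \<le> 1" for t x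
  proof -
    have "(\<Sum>i<n. T t i x) = (\<integral>y. (\<Sum>i<n. indicat_real (U i) (exp (- t) *\<^sub>R x + sqrt (1 - exp (- 2 * t)) *\<^sub>R y)) \<partial>\<gamma>)"
      unfolding T_def OU_def
      by (intro Bochner_Integration.integral_sum[symmetric] OU_integrable[of _ 1]) (auto simp: indicator_def)
    also have "\<dots> \<le> (\<integral>y. 1 \<partial>\<gamma>)"
    proof (rule integral_mono)
      show "integrable \<gamma> (\<lambda>y. \<Sum>i<n. indicat_real (U i) (exp (- t) *\<^sub>R x + sqrt (1 - exp (- 2 * t)) *\<^sub>R y))"
        by (intro Bochner_Integration.integrable_sum OU_integrable[of _ 1]) (auto simp: indicator_def)
      fix y
      let ?z = "exp (- t) *\<^sub>R x + sqrt (1 - exp (- 2 * t)) *\<^sub>R y"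
      have "(\<Sum>i<n. indicat_real (U i) ?z) = indicat_real (\<Union>i<n. U i) ?z"
        by (rule indicator_UN_disjoint[symmetric]) (auto simp: disjoint_family_on_def U(3))
      then show "(\<Sum>i<n. indicat_real (U i) ?z) \<le> 1" by (simp add: indicator_def)
    qed simp
    finally show ?thesis by simp
  qed
  \<comment> \<open>On \<open>K\<^sub>j\<close> all \<open>T\<^sub>t \<chi>\<^bsub>U\<^sub>i\<^esub>\<close> with \<open>i \<noteq> j\<close> together are at most \<open>1 - T\<^sub>t \<chi>\<^bsub>U\<^sub>j\<^esub>\<close>, which is the reason for the factor \<open>2\<close>.\<close>
  have ptw: "(\<Sum>i<n. indicator (K i) x * g i x) - 2 * (\<Sum>i<n. indicator (K i) x * (1 - T t i x)) - indicator R x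
      \<le> (\<Sum>i<n. T t i x * g i x)" for t x
  proof (cases "x \<in> R")
    case True
    then have "indicat_real (K i) x = 0" if "i < n" for i using that unfolding R_def by auto
    moreover have "(\<Sum>i<n. - T t i x) \<le> (\<Sum>i<n. T t i x * g i x)"
    proof (rule sum_mono)
      fix i
      have "T t i x * (- 1) \<le> T t i x * g i x"
        using g1[of i x] by (intro mult_left_mono T01) (auto simp: abs_le_iff)
      then show "- T t i x \<le> T t i x * g i x" by simp
    qed
    ultimately show ?thesis using True Tsum[of t x] by (simp add: sum_negf)
  next
    case False
    then obtain j where j: "j < n" "x \<in> K j" unfolding R_def by auto
    have Kx: "indicat_real (K i) x = (if i = j then 1 else 0)" for i
      using j Kdisj[of i j] by (auto simp: indicator_def)
    have split: "(\<Sum>i<n. F i) = F j + (\<Sum>i\<in>{..<n} - {j}. F i)" for F :: "nat \<Rightarrow> real"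
      using j(1) by (intro sum.remove) auto
    have "(\<Sum>i\<in>{..<n} - {j}. - T t i x) \<le> (\<Sum>i\<in>{..<n} - {j}. T t i x * g i x)"
    proof (rule sum_mono)
      fix i
      have "T t i x * (- 1) \<le> T t i x * g i x"
        using g1[of i x] by (intro mult_left_mono T01) (auto simp: abs_le_iff)
      then show "- T t i x \<le> T t i x * g i x" by simp
    qed
    moreover have "(\<Sum>i\<in>{..<n} - {j}. T t i x) \<le> 1 - T t j x" using Tsum[of t x] split[of "\<lambda>i. T t i x"] by simp
    moreover have "g j x - (1 - T t j x) \<le> T t j x * g j x"
      using mult_left_mono[of "g j x" 1 "1 - T t j x"] g1[of j x] T01[of t j x] by (simp add: abs_le_iff algebra_simps)
    ultimately have "g j x - 2 * (1 - T t j x) \<le> (\<Sum>i<n. T t i x * g i x)"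
      unfolding split[of "\<lambda>i. T t i x * g i x"] by (simp add: sum_negf)
    moreover have "(\<Sum>i<n. indicator (K i) x * g i x) = g j x" "(\<Sum>i<n. indicator (K i) x * (1 - T t i x)) = 1 - T t j x"
      unfolding Kx using j(1) by (simp_all add: if_distrib[of "\<lambda>u. u * _"] sum.delta cong: if_cong)
    ultimately show ?thesis using False by simp
  qed
  have intT: "integrable M (\<lambda>x. T t i x * g i x)" for t i
    unfolding T_def by (rule OU_times_integrable[OF Ub g g1])
  have intK: "integrable M (\<lambda>x. indicat_real (K i) x * (1 - T t i x))" for t i
    by (rule bounded_integrable[of _ 1]) (measurable, use T01[of t i] in \<open>auto simp: indicator_def\<close>)
  have intR: "integrable M (indicat_real R)" by (rule intI[OF Rb])
  have lower: "m - 6 * d - 2 * (\<Sum>i<n. \<integral>x. indicator (K i) x * (1 - T t i x) \<partial>M) \<le> (\<Sum>i<n. \<integral>x. T t i x * g i x \<partial>M)" for t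
  proof -
    have "(\<Sum>i<n. \<integral>x. indicator (K i) x * g i x \<partial>M) - 2 * (\<Sum>i<n. \<integral>x. indicator (K i) x * (1 - T t i x) \<partial>M) - measure M R
      = (\<integral>x. (\<Sum>i<n. indicator (K i) x * g i x) - 2 * (\<Sum>i<n. indicator (K i) x * (1 - T t i x)) - indicator R x \<partial>M)"
    proof -
      have "(\<Sum>i<n. \<integral>x. F i x \<partial>M) - 2 * (\<Sum>i<n. \<integral>x. G i x \<partial>M) - (\<integral>x. r x \<partial>M)
          = (\<integral>x. (\<Sum>i<n. F i x) - 2 * (\<Sum>i<n. G i x) - r x \<partial>M)"
        if "\<And>i. integrable M (F i)" "\<And>i. integrable M (G i)" "integrable M r" for F G :: "nat \<Rightarrow> 'a \<Rightarrow> real" and r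
        using that by simp
      from this[OF intg[OF Kb] intK intR] show ?thesis by simp
    qed
    also have "\<dots> \<le> (\<integral>x. (\<Sum>i<n. T t i x * g i x) \<partial>M)"
      by (intro integral_mono ptw Bochner_Integration.integrable_diff Bochner_Integration.integrable_sum
        integrable_mult_right intg[OF Kb] intK intR intT)
    also have "\<dots> = (\<Sum>i<n. \<integral>x. T t i x * g i x \<partial>M)" using intT by (intro Bochner_Integration.integral_sum) auto
    finally show ?thesis using sumK R by linarith
  qed
  have "((\<lambda>t. \<Sum>i<n. \<integral>x. indicator (K i) x * (1 - T t i x) \<partial>M) \<longlongrightarrow> (\<Sum>i<n. 0)) (at_right 0)"
    unfolding T_def
    by (intro tendsto_sum integral_OU_open_tendsto[OF M.finite_measure_axioms sets_total_variation U(1) Kb]) (simp add: U(2))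
  then have "\<forall>\<^sub>F t in at_right 0. (\<Sum>i<n. \<integral>x. indicator (K i) x * (1 - T t i x) \<partial>M) < d"
    using d(1) by (intro order_tendstoD) auto
  then show ?thesis
  proof eventually_elim
    case (elim t)
    have "ennreal (measure M UNIV - e) \<le> ennreal (\<Sum>i<n. \<integral>x. T t i x * g i x \<partial>M)"
      using lower[of t] elim d unfolding m_def[symmetric] by (intro ennreal_leI) linarith
    also have "\<dots> \<le> emeasure (total_variation \<gamma> (OU_dual_CM \<gamma> t \<nu>)) UNIV"
      unfolding T_def g_def by (rule OU_dual_CM_variation_ge) (auto simp: U(3) l(1))
    finally show ?case .
  qed
qed

text \<open>Duality moves the semigroup from the measure \<open>M\<close> onto the density.\<close>

lemma unit_density_variation:
  assumes h: "unit_density (OU_dual_pos \<gamma> t M) (total_variation \<gamma> (OU_dual_CM \<gamma> t \<nu>)) f"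
  shows "emeasure (total_variation \<gamma> (OU_dual_CM \<gamma> t \<nu>)) UNIV = ennreal (\<integral>x. OU \<gamma> t f x \<partial>M)"
proof -
  have f[measurable]: "f \<in> borel_measurable borel" and f01: "\<And>x. 0 \<le> f x" "\<And>x. f x \<le> 1"
    and dens: "density (OU_push t M) (\<lambda>x. ennreal (f x)) = total_variation \<gamma> (OU_dual_CM \<gamma> t \<nu>)"
    using h unfolding unit_density_def OU_dual_pos_eq[OF M.finite_measure_axioms sets_total_variation] by auto
  interpret P: finite_measure "OU_push t M" by (rule finite_OU_push[OF M.finite_measure_axioms sets_total_variation])
  have "emeasure (total_variation \<gamma> (OU_dual_CM \<gamma> t \<nu>)) UNIV = (\<integral>\<^sup>+x. ennreal (f x) \<partial>OU_push t M)"
    unfolding dens[symmetric] by (subst emeasure_density) auto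
  also have "\<dots> = ennreal (\<integral>x. f x \<partial>OU_push t M)"
    using f01 by (intro nn_integral_eq_integral P.integrable_const_bound[of _ 1]) auto
  also have "(\<integral>x. f x \<partial>OU_push t M) = (\<integral>x. OU \<gamma> t f x \<partial>M)"
    by (rule integral_OU_push[OF M.finite_measure_axioms sets_total_variation f, of 1]) (use f01 in auto)
  finally show ?thesis .
qed

theorem OU_density_tendsto:
  assumes h: "\<And>t. t > 0 \<Longrightarrow> unit_density (OU_dual_pos \<gamma> t M) (total_variation \<gamma> (OU_dual_CM \<gamma> t \<nu>)) (h t)"
  shows "tendsto_L1 M (\<lambda>t. OU \<gamma> t (h t)) (\<lambda>_. 1) (at_right 0)"
proof -
  have pos: "\<forall>\<^sub>F t :: real in at_right 0. 0 < t" by (rule eventually_at_right_less)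
  have hm: "h t \<in> borel_measurable borel" and h1: "\<bar>h t x\<bar> \<le> 1" if "t > 0" for t x
    using h[OF that] unfolding unit_density_def by auto
  have int: "integrable M (OU \<gamma> t (h t))" if "t > 0" for t
    by (rule bounded_integrable[of _ 1]) (use hm[OF that] h1[OF that] in \<open>auto intro: OU_abs_le\<close>)
  have L1: "(\<integral>x. \<bar>OU \<gamma> t (h t) x - 1\<bar> \<partial>M) = measure M UNIV - (\<integral>x. OU \<gamma> t (h t) x \<partial>M)" if t: "t > 0" for t
  proof -
    have "\<bar>OU \<gamma> t (h t) x - 1\<bar> = 1 - OU \<gamma> t (h t) x" for x
      using OU_abs_le[OF hm[OF t] h1[OF t], of t x] by simp
    then show ?thesis using int[OF t] by simp
  qed
  have "((\<lambda>t. \<integral>x. \<bar>OU \<gamma> t (h t) x - 1\<bar> \<partial>M) \<longlongrightarrow> 0) (at_right 0)"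
  proof (rule tendstoI)
    fix e :: real assume e: "e > 0"
    then have "\<forall>\<^sub>F t in at_right 0. ennreal (measure M UNIV - e / 2) \<le> emeasure (total_variation \<gamma> (OU_dual_CM \<gamma> t \<nu>)) UNIV"
      by (intro variation_lower_semicontinuous) simp
    with pos show "\<forall>\<^sub>F t in at_right 0. dist (\<integral>x. \<bar>OU \<gamma> t (h t) x - 1\<bar> \<partial>M) 0 < e"
    proof eventually_elim
      case (elim t)
      have "0 \<le> (\<integral>x. OU \<gamma> t (h t) x \<partial>M)"
      proof (rule integral_nonneg_AE, rule AE_I2)
        fix x
        have "OU \<gamma> t (\<lambda>_. 0) x \<le> OU \<gamma> t (h t) x"
          by (rule OU_mono[where c = 1 and d = 1])
             (use h[OF elim(1)] hm[OF elim(1)] h1[OF elim(1)] in \<open>auto simp: unit_density_def\<close>)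
        then show "0 \<le> OU \<gamma> t (h t) x" by (simp add: OU_const)
      qed
      then have "measure M UNIV - e / 2 \<le> (\<integral>x. OU \<gamma> t (h t) x \<partial>M)"
        using elim(2) unfolding unit_density_variation[OF h[OF elim(1)]] by simp
      moreover have "0 \<le> (\<integral>x. \<bar>OU \<gamma> t (h t) x - 1\<bar> \<partial>M)" by simp
      ultimately show ?case using e L1[OF elim(1)] by (simp add: dist_real_def)
    qed
  qed
  moreover have "\<forall>\<^sub>F t in at_right 0. integrable M (OU \<gamma> t (h t))"
    using pos by eventually_elim (rule int)
  ultimately show ?thesis unfolding tendsto_L1_def by simp
qed

end

theorem mainTheorem4:
  fixes \<gamma> :: "'a::{banach, second_countable_topology} measure"
    and E :: "'a set"
    and h :: "real \<Rightarrow> 'a \<Rightarrow> real"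
  assumes "gaussian_measure \<gamma>" and "nondegenerate \<gamma>" and "centered \<gamma>"
    and "finite_perimeter \<gamma> E"
    and "\<And>t. t > 0 \<Longrightarrow>
      unit_density
        (OU_dual_pos \<gamma> t (total_variation \<gamma> (BV_gradient \<gamma> (indicat_real E))))
        (total_variation \<gamma> (OU_dual_CM \<gamma> t (BV_gradient \<gamma> (indicat_real E))))
        (h t)"
  shows "tendsto_L1 (total_variation \<gamma> (BV_gradient \<gamma> (indicat_real E)))
    (\<lambda>t. OU \<gamma> t (h t)) (\<lambda>_. 1) (at_right 0)"
proof -
  have "\<exists>\<nu>. is_BV_gradient \<gamma> (indicat_real E) \<nu>"
    using assms(4) unfolding finite_perimeter_def BV_def by blast
  then have "is_BV_gradient \<gamma> (indicat_real E) (BV_gradient \<gamma> (indicat_real E))"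
    unfolding BV_gradient_def by (rule someI_ex)
  then interpret CM_measure \<gamma> "BV_gradient \<gamma> (indicat_real E)"
    using assms(1,3) unfolding is_BV_gradient_def by unfold_locales auto
  show ?thesis by (rule OU_density_tendsto) (rule assms(5))
qed

end
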